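(* Let $\Gamma=N\rtimes_\sigma H$ with $N$ a discrete abelian group and $H$ a finite group of order $\kappa$. Let $\gamma\mapsto U(\gamma)$ be a unitary representation of $\Gamma$ on a separable Hilbert space $\mathcal{H}$, let $\varphi\in\mathcal{H}$ be such that $\{U(\gamma)\varphi\}_{\gamma\in\Gamma}$ is a Riesz sequence for $\mathcal{H}$, and let $\mathcal{A}_\varphi=\overline{\operatorname{span}}\{U(\gamma)\varphi\}_{\gamma\in\Gamma}$. For a given $\psi\in\mathcal{H}$, let $\mathcal{L}_\psi f(\gamma):=\langle f,U(\gamma)\psi\rangle_{\mathcal{H}}$ for $f\in\mathcal{A}_\varphi$, $\gamma\in\Gamma$, and consider $\mathsf{f}_\psi\in\ell^2(\Gamma)$ given by $\mathsf{f}_\psi(\eta):=\overline{\langle\varphi,U(\eta^{-1})\psi\rangle_{\mathcal{H}}}$, $\eta\in\Gamma$. Assume that all the entries of the $\kappa\times\kappa$ transfer matrix $\mathbf{F}(\xi)$ associated to $\mathsf{f}_\psi$ belong to $L^\infty(\widehat{N})$. The following statements are equivalent: (a) $\operatorname*{ess\,inf}_{\xi\in\widehat{N}}|\det\mathbf{F}(\xi)|>0$. (b) There exists a unique $\mathsf{g}_\psi\in\ell^2(\Gamma)$ such that its associated transfer matrix $\mathbf{G}(\xi)$ has entries in $L^\infty(\widehat{N})$ and satisfies $\mathbf{G}(\xi)\mathbf{F}^*(\xi)=\mathbf{I}_\kappa$ for a.e. $\xi\in\widehat{N}$. (c) There exists a unique $\Phi_\psi\in\mathcal{A}_\varphi$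 such that the sequence $\{U(\gamma)\Phi_\psi\}_{\gamma\in\Gamma}$ is a Riesz basis for $\mathcal{A}_\varphi$ and the sampling formula $$f=\sum_{\gamma\in\Gamma}\mathcal{L}_\psi f(\gamma)\,U(\gamma)\Phi_\psi\quad\text{in }\mathcal{H}$$ holds for each $f\in\mathcal{A}_\varphi$. In case the equivalent conditions are satisfied, necessarily $\Phi_\psi=\mathcal{T}_{U,\varphi}(\mathsf{g}_\psi)$, where $\mathsf{g}_\psi\in\ell^2(\Gamma)$ satisfies the conditions in (b). Moreover, the interpolation property $\mathcal{L}_\psi\Phi_\psi(\gamma)=\delta_{\gamma,e_\Gamma}$, $\gamma\in\Gamma$, holds.
   Context: Setting: $(N,+)$ is a discrete abelian group, $(H,\cdot)$ is a finite group of order $\kappa$, $\sigma:H\to\mathrm{Aut}(N)$ is a homomorphism, and $\Gamma=N\rtimes_\sigma H$ is the set $N\times H$ with product $(n,h)(m,l)=(n+\sigma(h)(m),hl)$ and identity $e_\Gamma=(0_N,1_H)$. $\widehat{N}$ is the (compact) dual group of $N$, with Haar measure normalized so that the Fourier transform $\widehat{\mathsf{a}}(\xi)=\sum_{n\in N}\mathsf{a}(n)\langle -n,\xi\rangle$, defined for $\mathsf{a}\in\ell^1(N)$, extends to a unitary operator $\ell^2(N)\to L^2(\widehat{N})$. Transfer matrix: for $\mathsf{f}\in\ell^2(\Gamma)$ and $h,l\in H$ put $\mathsf{f}_{h,l}(n):=\mathsf{f}[(0,l)^{-1}(n,h)]$, $n\in N$. The transfer matrix associated to $\mathsf{f}$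 is $\mathbf{F}(\xi)=[\,\widehat{\mathsf{f}}_{h,l}(\xi)\,]_{h,l\in H}$ (row index $h$, column index $l$), and $\mathbf{F}^*(\xi)$ is its conjugate transpose. Since $\{U(\gamma)\varphi\}_{\gamma\in\Gamma}$ is a Riesz sequence (i.e. a Riesz basis for its closed linear span), $\mathcal{A}_\varphi=\{\sum_{\gamma}\mathsf{a}(\gamma)U(\gamma)\varphi:\mathsf{a}\in\ell^2(\Gamma)\}$. The isomorphism $\mathcal{T}_{U,\varphi}:\ell^2(\Gamma)\to\mathcal{A}_\varphi$ is $\mathcal{T}_{U,\varphi}(\mathsf{a})=\sum_{\gamma\in\Gamma}\mathsf{a}(\gamma)U(\gamma)\varphi$. *)

theory Defs
  imports "HOL-Probability.Probability"
begin

section \<open>Complex Hilbert spaces\<close>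

text \<open>
  A complex Hilbert space is a real Hilbert space with a compatible complex structure. The inner
  product is linear in the first argument, and its real part is the real inner product, so that
  norm, metric and topology are those of the underlying real class.
\<close>

class complex_hilbert = real_inner + complete_space +
  fixes scaleC :: "complex \<Rightarrow> 'a \<Rightarrow> 'a"  (infixr \<open>*\<^sub>C\<close> 75)
    and cinner :: "'a \<Rightarrow> 'a \<Rightarrow> complex"
  assumes scaleC_add_right: "c *\<^sub>C (x + y) = c *\<^sub>C x + c *\<^sub>C y"
    and scaleC_add_left: "(c + d) *\<^sub>C x = c *\<^sub>C x + d *\<^sub>C x"
    and scaleC_scaleC: "c *\<^sub>C d *\<^sub>C x = (c * d) *\<^sub>C x"
    and scaleC_of_real: "complex_of_real r *\<^sub>C x = r *\<^sub>R x"
    and cinner_commute: "cinner x y = cnj (cinner y x)"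
    and cinner_add_left: "cinner (x + y) z = cinner x z + cinner y z"
    and cinner_scaleC_left: "cinner (c *\<^sub>C x) y = c * cinner x y"
    and Re_cinner: "Re (cinner x y) = inner x y"

instantiation complex :: complex_hilbert
begin

definition scaleC_complex :: "complex \<Rightarrow> complex \<Rightarrow> complex" where
  "scaleC_complex c x = c * x"

definition cinner_complex :: "complex \<Rightarrow> complex \<Rightarrow> complex" where
  "cinner_complex x y = x * cnj y"

instance
  by standard
    (auto simp: scaleC_complex_def cinner_complex_def inner_complex_def algebra_simps
      scaleR_conv_of_real)

end

lemma vector_space_scaleC: "vector_space (scaleC :: complex \<Rightarrow> 'a::complex_hilbert \<Rightarrow> 'a)"
proof
  fix x :: 'a
  show "1 *\<^sub>C x = x"
    using scaleC_of_real[of 1 x] by simp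
qed (simp_all add: scaleC_add_right scaleC_add_left scaleC_scaleC)

abbreviation cspan :: "'a::complex_hilbert set \<Rightarrow> 'a set" where
  "cspan \<equiv> module.span scaleC"

definition unitary_operator :: "('a::complex_hilbert \<Rightarrow> 'a) \<Rightarrow> bool" where
  "unitary_operator T \<longleftrightarrow>
     (\<forall>x y. T (x + y) = T x + T y) \<and> (\<forall>c x. T (c *\<^sub>C x) = c *\<^sub>C T x) \<and>
     (\<forall>x y. cinner (T x) (T y) = cinner x y) \<and> surj T"

definition riesz_basis_of :: "('i \<Rightarrow> 'a::complex_hilbert) \<Rightarrow> 'a set \<Rightarrow> bool" where
  "riesz_basis_of x M \<longleftrightarrow>
     closure (cspan (range x)) = M \<and>
     (\<exists>A B. 0 < A \<and>
        (\<forall>S c. finite S \<longrightarrow>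
           A * (\<Sum>i\<in>S. (cmod (c i))\<^sup>2) \<le> (norm (\<Sum>i\<in>S. c i *\<^sub>C x i))\<^sup>2 \<and>
           (norm (\<Sum>i\<in>S. c i *\<^sub>C x i))\<^sup>2 \<le> B * (\<Sum>i\<in>S. (cmod (c i))\<^sup>2)))"

definition riesz_sequence :: "('i \<Rightarrow> 'a::complex_hilbert) \<Rightarrow> bool" where
  "riesz_sequence x \<longleftrightarrow> riesz_basis_of x (closure (cspan (range x)))"

section \<open>Function spaces\<close>

definition ell1 :: "('i \<Rightarrow> complex) set" where
  "ell1 = {a. (\<lambda>i. cmod (a i)) summable_on UNIV}"

definition ell2 :: "('i \<Rightarrow> complex) set" where
  "ell2 = {a. (\<lambda>i. (cmod (a i))\<^sup>2) summable_on UNIV}"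

definition ell2_norm :: "('i \<Rightarrow> complex) \<Rightarrow> real" where
  "ell2_norm a = sqrt (\<Sum>\<^sub>\<infinity>i. (cmod (a i))\<^sup>2)"

definition L2_space :: "'x measure \<Rightarrow> ('x \<Rightarrow> complex) set" where
  "L2_space M = {F \<in> borel_measurable M. integrable M (\<lambda>x. (cmod (F x))\<^sup>2)}"

definition L2_norm :: "'x measure \<Rightarrow> ('x \<Rightarrow> complex) \<Rightarrow> real" where
  "L2_norm M F = sqrt (\<integral>x. (cmod (F x))\<^sup>2 \<partial>M)"

definition Linf_space :: "'x measure \<Rightarrow> ('x \<Rightarrow> complex) set" where
  "Linf_space M = {F \<in> borel_measurable M. esssup M (\<lambda>x. ereal (cmod (F x))) < \<infinity>}"

definition essinf :: "'x measure \<Rightarrow> ('x \<Rightarrow> ereal) \<Rightarrow> ereal" where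
  "essinf M f = - esssup M (\<lambda>x. - f x)"

section \<open>The dual group and the Fourier transform\<close>

text \<open>
  The pairing of \<open>n\<close> and \<open>\<xi>\<close> is \<open>\<xi> n\<close>. As the group is discrete, the topology of its
  dual (uniform convergence on compact sets) is that of pointwise convergence, that is, the
  subspace topology inherited from the product topology on the function type.
\<close>

definition dual_group :: "('n::ab_group_add \<Rightarrow> complex) set" where
  "dual_group = {\<xi>. (\<forall>m n. \<xi> (m + n) = \<xi> m * \<xi> n) \<and> (\<forall>n. cmod (\<xi> n) = 1)}"

text \<open>
  Haar measure on the compact dual: the translation-invariant Radon measure of total mass 1.
  This normalization is the one for which the Fourier transform is unitary: the function that
  is 1 at 0 and 0 elsewhere has norm 1, and its transform is the constant 1.
\<close>

definition dual_haar_measure :: "('n::ab_group_add \<Rightarrow> complex) measure \<Rightarrow> bool" where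
  "dual_haar_measure \<mu> \<longleftrightarrow>
     sets \<mu> = sets (restrict_space borel dual_group) \<and>
     emeasure \<mu> dual_group = 1 \<and>
     (\<forall>\<xi>\<in>dual_group. \<forall>A\<in>sets \<mu>. emeasure \<mu> ((\<lambda>\<eta> n. \<xi> n * \<eta> n) ` A) = emeasure \<mu> A) \<and>
     (\<forall>A\<in>sets \<mu>. emeasure \<mu> A = (SUP K\<in>{K. compact K \<and> K \<subseteq> A}. emeasure \<mu> K))"

definition fourier_ell1 ::
    "('n::ab_group_add \<Rightarrow> complex) \<Rightarrow> ('n \<Rightarrow> complex) \<Rightarrow> complex" where
  "fourier_ell1 a \<xi> = (\<Sum>\<^sub>\<infinity>n. a n * \<xi> (- n))"

text \<open>
  The extension by continuity of the Fourier transform to \<open>ell2\<close>: a representative of the limit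
  in the \<open>L2\<close>-norm of the transforms of \<open>b\<close>, as \<open>b\<close> in \<open>ell1\<close> tends to \<open>a\<close> in the
  \<open>ell2\<close>-norm. The representative is determined up to a null set only.
\<close>

definition fourier ::
    "('n::ab_group_add \<Rightarrow> complex) measure \<Rightarrow> ('n \<Rightarrow> complex) \<Rightarrow> ('n \<Rightarrow> complex) \<Rightarrow> complex" where
  "fourier \<mu> a = (SOME F. F \<in> L2_space \<mu> \<and>
     (\<forall>\<epsilon>>0. \<exists>\<delta>>0. \<forall>b\<in>ell1. ell2_norm (\<lambda>n. b n - a n) < \<delta> \<longrightarrow>
        L2_norm \<mu> (\<lambda>\<xi>. fourier_ell1 b \<xi> - F \<xi>) < \<epsilon>))"

section \<open>The semidirect product and its representations\<close>

text \<open>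
  The class \<open>group_add\<close> does not assume commutativity; the group \<open>'h\<close> is an arbitrary finite
  group with \<open>+\<close>, \<open>-\<close> and \<open>0\<close> in the place of multiplication, inverse and unit.
\<close>

definition automorphism_action :: "('h::group_add \<Rightarrow> 'n::ab_group_add \<Rightarrow> 'n) \<Rightarrow> bool" where
  "automorphism_action \<sigma> \<longleftrightarrow>
     (\<forall>h. bij (\<sigma> h) \<and> (\<forall>m n. \<sigma> h (m + n) = \<sigma> h m + \<sigma> h n)) \<and>
     (\<forall>h l. \<sigma> (h + l) = \<sigma> h \<circ> \<sigma> l)"

definition sd_mult ::
    "('h::group_add \<Rightarrow> 'n::ab_group_add \<Rightarrow> 'n) \<Rightarrow> 'n \<times> 'h \<Rightarrow> 'n \<times> 'h \<Rightarrow> 'n \<times> 'h" where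
  "sd_mult \<sigma> = (\<lambda>(n, h) (m, l). (n + \<sigma> h m, h + l))"

definition sd_one :: "'n::ab_group_add \<times> 'h::group_add" where
  "sd_one = (0, 0)"

definition sd_inv :: "('h::group_add \<Rightarrow> 'n::ab_group_add \<Rightarrow> 'n) \<Rightarrow> 'n \<times> 'h \<Rightarrow> 'n \<times> 'h" where
  "sd_inv \<sigma> = (\<lambda>(n, h). (\<sigma> (- h) (- n), - h))"

lemma automorphism_action_zero:
  assumes "automorphism_action \<sigma>"
  shows "\<sigma> 0 n = n" "\<sigma> h 0 = 0"
proof -
  have "\<sigma> (0 + 0) = \<sigma> 0 \<circ> \<sigma> 0" and "inj (\<sigma> 0)"
    using assms unfolding automorphism_action_def bij_def by blast+
  then have "\<sigma> 0 (\<sigma> 0 n) = \<sigma> 0 n" and "inj (\<sigma> 0)"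
    by (metis add_0 comp_apply, simp)
  then show "\<sigma> 0 n = n"
    by (auto dest: injD)
  have "\<sigma> h (0 + 0) = \<sigma> h 0 + \<sigma> h 0"
    using assms unfolding automorphism_action_def by blast
  then show "\<sigma> h 0 = 0"
    by simp
qed

lemma sd_group:
  assumes "automorphism_action \<sigma>"
  shows "sd_mult \<sigma> (sd_mult \<sigma> x y) z = sd_mult \<sigma> x (sd_mult \<sigma> y z)"
    and "sd_mult \<sigma> sd_one x = x" and "sd_mult \<sigma> x sd_one = x"
    and "sd_mult \<sigma> (sd_inv \<sigma> x) x = sd_one" and "sd_mult \<sigma> x (sd_inv \<sigma> x) = sd_one"
proof -
  have add: "\<sigma> h (m + n) = \<sigma> h m + \<sigma> h n" and comp: "\<sigma> (h + l) n = \<sigma> h (\<sigma> l n)" for h l m n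
    using assms by (auto simp: automorphism_action_def)
  note zero = automorphism_action_zero[OF assms]
  obtain n h m l k j where xyz: "x = (n, h)" "y = (m, l)" "z = (k, j)"
    by (metis surj_pair)
  show "sd_mult \<sigma> (sd_mult \<sigma> x y) z = sd_mult \<sigma> x (sd_mult \<sigma> y z)"
    by (simp add: xyz sd_mult_def add comp add.assoc)
  show "sd_mult \<sigma> sd_one x = x" "sd_mult \<sigma> x sd_one = x"
    by (simp_all add: xyz sd_mult_def sd_one_def zero)
  show "sd_mult \<sigma> (sd_inv \<sigma> x) x = sd_one"
    using add[of "- h" "- n" n] by (simp add: xyz sd_mult_def sd_inv_def sd_one_def zero)
  show "sd_mult \<sigma> x (sd_inv \<sigma> x) = sd_one"
    using comp[of h "- h" "- n"] by (simp add: xyz sd_mult_def sd_inv_def sd_one_def zero)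
qed

definition unitary_representation ::
    "('h::group_add \<Rightarrow> 'n::ab_group_add \<Rightarrow> 'n) \<Rightarrow> ('n \<times> 'h \<Rightarrow> 'a::complex_hilbert \<Rightarrow> 'a) \<Rightarrow> bool"
  where
  "unitary_representation \<sigma> U \<longleftrightarrow>
     (\<forall>\<gamma>. unitary_operator (U \<gamma>)) \<and> (\<forall>\<gamma> \<eta>. U (sd_mult \<sigma> \<gamma> \<eta>) = U \<gamma> \<circ> U \<eta>)"

section \<open>Transfer matrices\<close>

definition transfer_matrix ::
    "('h::{group_add, finite} \<Rightarrow> 'n::ab_group_add \<Rightarrow> 'n) \<Rightarrow> ('n \<Rightarrow> complex) measure \<Rightarrow>
      ('n \<times> 'h \<Rightarrow> complex) \<Rightarrow> ('n \<Rightarrow> complex) \<Rightarrow> ((complex, 'h) vec, 'h) vec" where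
  "transfer_matrix \<sigma> \<mu> f \<xi> =
     (\<chi> h l. fourier \<mu> (\<lambda>n. f (sd_mult \<sigma> (sd_inv \<sigma> (0, l)) (n, h))) \<xi>)"

definition conj_transpose :: "complex^'m^'n \<Rightarrow> complex^'n^'m" where
  "conj_transpose A = (\<chi> i j. cnj (A $ j $ i))"

definition bounded_entries ::
    "('n::ab_group_add \<Rightarrow> complex) measure \<Rightarrow> (('n \<Rightarrow> complex) \<Rightarrow> complex^'h^'h) \<Rightarrow> bool" where
  "bounded_entries \<mu> F \<longleftrightarrow> (\<forall>h l. (\<lambda>\<xi>. F \<xi> $ h $ l) \<in> Linf_space \<mu>)"

section \<open>Sampling in the space generated by one vector\<close>

definition generated_space :: "('g \<Rightarrow> 'a \<Rightarrow> 'a) \<Rightarrow> 'a \<Rightarrow> 'a::complex_hilbert set" where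
  "generated_space U \<phi> = closure (cspan (range (\<lambda>\<gamma>. U \<gamma> \<phi>)))"

definition synthesis ::
    "('g \<Rightarrow> 'a \<Rightarrow> 'a) \<Rightarrow> 'a \<Rightarrow> ('g \<Rightarrow> complex) \<Rightarrow> 'a::complex_hilbert" where
  "synthesis U \<phi> a = (\<Sum>\<^sub>\<infinity>\<gamma>. a \<gamma> *\<^sub>C U \<gamma> \<phi>)"

definition samples :: "('g \<Rightarrow> 'a \<Rightarrow> 'a) \<Rightarrow> 'a \<Rightarrow> 'a::complex_hilbert \<Rightarrow> 'g \<Rightarrow> complex" where
  "samples U \<psi> f \<gamma> = cinner f (U \<gamma> \<psi>)"

definition sampling_sequence ::
    "('h::group_add \<Rightarrow> 'n::ab_group_add \<Rightarrow> 'n) \<Rightarrow> ('n \<times> 'h \<Rightarrow> 'a \<Rightarrow> 'a) \<Rightarrow>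
      'a \<Rightarrow> 'a::complex_hilbert \<Rightarrow> 'n \<times> 'h \<Rightarrow> complex" where
  "sampling_sequence \<sigma> U \<phi> \<psi> \<eta> = cnj (cinner \<phi> (U (sd_inv \<sigma> \<eta>) \<psi>))"

definition inverting_sequence ::
    "('h::{group_add, finite} \<Rightarrow> 'n::ab_group_add \<Rightarrow> 'n) \<Rightarrow> ('n \<Rightarrow> complex) measure \<Rightarrow>
      ('n \<times> 'h \<Rightarrow> complex) \<Rightarrow> ('n \<times> 'h \<Rightarrow> complex) \<Rightarrow> bool" where
  "inverting_sequence \<sigma> \<mu> f g \<longleftrightarrow>
     g \<in> ell2 \<and> bounded_entries \<mu> (transfer_matrix \<sigma> \<mu> g) \<and>
     (AE \<xi> in \<mu>. transfer_matrix \<sigma> \<mu> g \<xi> ** conj_transpose (transfer_matrix \<sigma> \<mu> f \<xi>) = mat 1)"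

definition sampling_generator ::
    "('g \<Rightarrow> 'a \<Rightarrow> 'a) \<Rightarrow> 'a \<Rightarrow> 'a \<Rightarrow> 'a::complex_hilbert \<Rightarrow> bool" where
  "sampling_generator U \<phi> \<psi> \<Phi> \<longleftrightarrow>
     \<Phi> \<in> generated_space U \<phi> \<and>
     riesz_basis_of (\<lambda>\<gamma>. U \<gamma> \<Phi>) (generated_space U \<phi>) \<and>
     (\<forall>f\<in>generated_space U \<phi>. ((\<lambda>\<gamma>. samples U \<psi> f \<gamma> *\<^sub>C U \<gamma> \<Phi>) has_sum f) UNIV)"

end

theory Submission
  imports Defs
begin

text \<open>
  Let \<open>T\<close> be the isomorphism of \<open>ell2\<close> onto the space generated by \<open>\<phi>\<close>, and let \<open>C\<close> map \<open>a\<close> to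
  the samples of \<open>T a\<close>. \<open>C\<close> commutes with left translations, and taking Fourier transforms slice by
  slice over \<open>H\<close> turns it into multiplication by the matrix \<open>F\<^sup>*\<close>. The transforms of the translates
  of \<open>g\<close> are the columns of \<open>G\<close>, so for square summable \<open>g\<close> the equation \<open>G F\<^sup>* = I\<close> says that \<open>C g\<close>
  is the unit mass at the identity. If \<open>det F\<close> is bounded away from 0, Cramer's rule solves this
  equation with bounded \<open>G\<close> and shows that \<open>C\<close> is bounded below, whence \<open>T g\<close> generates a Riesz basis
  and \<open>C\<close> is injective, which gives the sampling formula and uniqueness. Conversely, a sampling
  formula says that \<open>T a\<close> is the expansion with coefficients \<open>C a\<close> in a Riesz basis; hence \<open>C\<close> is
  bounded below, and this forces the entries of \<open>G\<close> to be essentially bounded.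

  The Fourier transform on \<open>ell2\<close> rests on two facts: characters separate points (Zorn's lemma), which
  makes them orthonormal, and they are complete (Stone-Weierstrass and inner regularity).
\<close>

section \<open>The dual group\<close>

text \<open>The columns of \<open>F\<^sup>* G\<close> are the transforms of \<open>C\<close> applied
  to the translates of \<open>g\<close> by elements of \<open>H\<close>, so
  \<open>C g = delta sd_one\<close> produces an inverse on the right of \<open>F\<^sup>*\<close>.
  Since the matrices are square, it is also an inverse on the left, which is the order of factors in
  (b).

  In (b) and (c) existence carries the uniqueness: the product of det G and the conjugate of det F
  is 1, so one bounded G already forces (a), and (a) makes \<open>C\<close> injective.

  \<open>N\<close> may be uncountable and its dual need not be metrizable. Sums over
  \<open>N\<close> are limits along finite sets, replaced by sequences through
  \<open>ell2_exhaustion\<close>, and measurable sets are reached from compact ones only by the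
  regularity of Haar measure.

  \<open>fourier\<close> selects a representative that is determined up to a null set. Its
  properties are therefore expressed through the coefficients \<open>fcoef\<close>, which do not see
  null sets, and identities between transforms hold almost everywhere; as \<open>H\<close> is
  finite, all entries can be treated at once.\<close>

text \<open>
  The Stone-Weierstrass theorem of the library needs a Hausdorff type. The T0 and T1 instances come
  first because the library derives those classes for function types only from metric spaces, and
  arities have to remain coherent along the class hierarchy.
\<close>

instance "fun" :: (type, t0_space) t0_space
proof
  fix f g :: "'a \<Rightarrow> 'b"
  assume "f \<noteq> g"
  then obtain i where "f i \<noteq> g i"
    by blast
  then have "\<exists>V. open V \<and> \<not> (f i \<in> V \<longleftrightarrow> g i \<in> V)"
    using separation_t0[of "f i" "g i"] by (rule iffD1[rotated])
  then obtain V where V: "open V" "\<not> (f i \<in> V \<longleftrightarrow> g i \<in> V)"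
    by (elim exE conjE)
  have "open ((\<lambda>h::'a \<Rightarrow> 'b. h i) -` V)"
    using V(1) by (intro open_vimage continuous_on_product_coordinates)
  with V(2) show "\<exists>U. open U \<and> \<not> (f \<in> U \<longleftrightarrow> g \<in> U)"
    by (intro exI[of _ "(\<lambda>h. h i) -` V"]) auto
qed

instance "fun" :: (type, t1_space) t1_space
proof
  fix f g :: "'a \<Rightarrow> 'b"
  assume "f \<noteq> g"
  then obtain i where "f i \<noteq> g i"
    by blast
  then obtain V where V: "open V" "f i \<in> V" "g i \<notin> V"
    using t1_space by blast
  have "open ((\<lambda>h::'a \<Rightarrow> 'b. h i) -` V)"
    using V(1) by (intro open_vimage continuous_on_product_coordinates)
  with V show "\<exists>U. open U \<and> f \<in> U \<and> g \<notin> U"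
    by blast
qed

instance "fun" :: (type, t2_space) t2_space
proof
  fix f g :: "'a \<Rightarrow> 'b"
  assume "f \<noteq> g"
  then obtain i where "f i \<noteq> g i"
    by blast
  then obtain V W where VW: "open V" "open W" "f i \<in> V" "g i \<in> W" "V \<inter> W = {}"
    using separation_t2[of "f i" "g i"] by auto
  have "open ((\<lambda>h::'a \<Rightarrow> 'b. h i) -` X)" if "open X" for X
    using that by (intro open_vimage continuous_on_product_coordinates)
  with VW show "\<exists>U V. open U \<and> open V \<and> f \<in> U \<and> g \<in> V \<and> U \<inter> V = {}"
    by (intro exI[of _ "(\<lambda>h. h i) -` V"] exI[of _ "(\<lambda>h. h i) -` W"]) auto
qed

text \<open>Tychonoff's theorem for a product of unit circles: each multiplicativity condition
  involves at most three coordinates, hence cuts out a closed set.\<close>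

lemma compact_dual_group: "compact (dual_group :: ('n::ab_group_add \<Rightarrow> complex) set)"
proof -
  let ?P = "PiE UNIV (\<lambda>_. sphere 0 1) :: ('n \<Rightarrow> complex) set"
  let ?Q = "\<lambda>m n. {\<xi> :: 'n \<Rightarrow> complex. \<xi> (m + n) = \<xi> m * \<xi> n}"
  have "compactin (product_topology (\<lambda>_. euclidean) UNIV) ?P"
    unfolding compactin_PiE by simp
  then have "compact ?P"
    by (simp add: euclidean_product_topology)
  moreover have "closed (?Q m n)" for m n
    by (intro closed_Collect_eq continuous_intros continuous_on_product_coordinates)
  moreover have "dual_group = ?P \<inter> (\<Inter>m. \<Inter>n. ?Q m n)"
    by (auto simp: dual_group_def)
  ultimately show ?thesis
    by (metis (no_types, lifting) closed_INT compact_Int_closed)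
qed

section \<open>Integer multiples in an abelian group\<close>

definition zmul :: "int \<Rightarrow> 'n::ab_group_add \<Rightarrow> 'n" where
  "zmul k x = (\<Sum>i<nat k. x) - (\<Sum>i<nat (- k). x)"

lemma zmul_simps: "zmul 0 x = 0" "zmul 1 x = x"
  by (simp_all add: zmul_def)

lemma zmul_add_one: "zmul (k + 1) x = zmul k x + x"
proof (cases "k \<ge> 0")
  case True
  then show ?thesis
    by (simp add: zmul_def nat_add_distrib)
next
  case False
  then have "nat (- k) = Suc (nat (- (k + 1)))"
    by simp
  with False show ?thesis
    by (simp add: zmul_def)
qed

lemma zmul_add: "zmul (j + k) x = zmul j x + zmul k x"
proof (induction k rule: int_induct[where k = 0])
  case base
  show ?case by (simp add: zmul_simps)
next
  case (step1 i)
  then show ?case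
    using zmul_add_one[of "j + i" x] zmul_add_one[of i x] by (simp add: algebra_simps)
next
  case (step2 i)
  then show ?case
    using zmul_add_one[of "j + (i - 1)" x] zmul_add_one[of "i - 1" x] by (simp add: algebra_simps)
qed

lemma zmul_uminus: "zmul (- k) x = - zmul k x"
  by (simp add: zmul_def)

lemma zmul_mult: "zmul (j * k) x = zmul j (zmul k x)"
proof (induction j rule: int_induct[where k = 0])
  case base
  show ?case by (simp add: zmul_simps)
next
  case (step1 i)
  then show ?case
    by (simp add: zmul_add zmul_simps algebra_simps)
next
  case (step2 i)
  then show ?case
    using zmul_add[of "i * k - k" k x] zmul_add[of "i - 1" 1 "zmul k x"] by (simp add: zmul_simps algebra_simps)
qed

text \<open>
  Graphs of characters of subgroups; a union of a chain of them is again one.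
\<close>

definition partial_character :: "('n::ab_group_add \<times> complex) set \<Rightarrow> bool" where
  "partial_character G \<longleftrightarrow> (0, 1) \<in> G \<and>
     (\<forall>a z b w. (a, z) \<in> G \<longrightarrow> (b, w) \<in> G \<longrightarrow> (a + b, z * w) \<in> G) \<and>
     (\<forall>a z. (a, z) \<in> G \<longrightarrow> (- a, inverse z) \<in> G \<and> cmod z = 1) \<and>
     (\<forall>z. (0, z) \<in> G \<longrightarrow> z = 1)"

text \<open>The quotient of two values at \<open>a\<close> is a value at 0, and there only 1 is
  allowed.\<close>

lemma partial_character_unique:
  assumes "partial_character G" "(a, z) \<in> G" "(a, w) \<in> G"
  shows "z = w"
proof -
  have "(a + - a, z * inverse w) \<in> G" "cmod w = 1"
    using assms unfolding partial_character_def by blast+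
  then have "z * inverse w = 1"
    using assms unfolding partial_character_def by simp
  moreover have "w \<noteq> 0"
    using \<open>cmod w = 1\<close> by auto
  ultimately show ?thesis
    by (simp add: field_simps)
qed

lemma partial_character_zmul:
  assumes "partial_character G" "(a, z) \<in> G"
  shows "(zmul k a, z powi k) \<in> G"
proof -
  have inv: "(- a, inverse z) \<in> G" and z: "cmod z = 1"
    and add: "\<And>b u. (b, u) \<in> G \<Longrightarrow> (b + a, u * z) \<in> G"
    using assms unfolding partial_character_def by blast+
  then have "\<And>b u. (b, u) \<in> G \<Longrightarrow> (b + - a, u * inverse z) \<in> G"
    using assms(1) unfolding partial_character_def by blast
  then have diff: "\<And>b u. (b, u) \<in> G \<Longrightarrow> (b - a, u / z) \<in> G"
    by (simp add: divide_inverse)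
  from z have z0: "z \<noteq> 0" by auto
  show ?thesis
  proof (induction k rule: int_induct[where k = 0])
    case base
    show ?case using assms by (simp add: zmul_simps partial_character_def)
  next
    case (step1 i)
    then show ?case
      using add[OF step1(2)] z0 by (simp add: zmul_add zmul_simps power_int_add)
  next
    case (step2 i)
    then show ?case
      using diff[OF step2(2)] zmul_add[of "i - 1" 1 a] z0 by (simp add: zmul_simps power_int_diff)
  qed
qed

text \<open>The least positive element divides all others, since a nonzero remainder would be a
  smaller positive element. The zero subgroup has the generator 0.\<close>

lemma int_subgroup_principal:
  fixes J :: "int set"
  assumes "0 \<in> J" "\<And>i j. i \<in> J \<Longrightarrow> j \<in> J \<Longrightarrow> i - j \<in> J"
  obtains k where "k \<ge> 0" "k \<in> J" "\<And>j. j \<in> J \<Longrightarrow> k dvd j"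
proof (cases "\<exists>j\<in>J. j \<noteq> 0")
  case False
  then show ?thesis
    using that[of 0] assms(1) by fastforce
next
  case True
  have neg: "- j \<in> J" if "j \<in> J" for j
    using assms(2)[OF assms(1) that] by simp
  have add: "i + j \<in> J" if "i \<in> J" "j \<in> J" for i j
    using assms(2)[OF that(1) neg[OF that(2)]] by simp
  define P where "P n \<longleftrightarrow> n > 0 \<and> int n \<in> J" for n :: nat
  from True obtain j where j: "j \<in> J" "j \<noteq> 0" by blast
  then have "P (nat \<bar>j\<bar>)"
    using neg by (auto simp: P_def abs_if)
  then have k: "P (LEAST n. P n)"
    by (rule LeastI)
  define k where "k = int (LEAST n. P n)"
  have k': "k > 0" "k \<in> J"
    using k by (auto simp: k_def P_def)
  have mult: "q * k \<in> J" for q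
  proof (induction q rule: int_induct[where k = 0])
    case base show ?case using assms(1) by simp
  next
    case (step1 i) then show ?case using add[OF step1(2) k'(2)] by (simp add: algebra_simps)
  next
    case (step2 i) then show ?case using assms(2)[OF step2(2) k'(2)] by (simp add: algebra_simps)
  qed
  have "k dvd j" if "j \<in> J" for j
  proof (rule ccontr)
    assume "\<not> k dvd j"
    then have r: "j mod k > 0"
      using k'(1) by (simp add: dvd_eq_mod_eq_0 order_neq_le_trans)
    have "j mod k = j - (j div k) * k"
      by (simp add: minus_div_mult_eq_mod)
    then have "j mod k \<in> J"
      using assms(2)[OF that mult] by simp
    then have "P (nat (j mod k))"
      using r by (simp add: P_def)
    then have "(LEAST n. P n) \<le> nat (j mod k)"
      by (rule Least_le)
    moreover have "j mod k < k"
      using k'(1) by simp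
    ultimately show False
      using r by (simp add: k_def)
  qed
  then show ?thesis
    using that[of k] k' by simp
qed

lemma root_on_unit_circle:
  assumes "cmod w = 1" "k > 0"
  obtains z where "cmod z = 1" "z ^ k = w"
proof -
  have "cis (Arg w / k) ^ k = cis (Arg w)"
    using assms(2) by (subst Complex.DeMoivre) simp
  also have "\<dots> = w"
    using assms(1) cis_Arg[of w] by (cases "w = 0") (auto simp: sgn_eq)
  finally show ?thesis
    using that[of "cis (Arg w / k)"] by simp
qed

text \<open>The multiples of \<open>m\<close> that lie in the domain of \<open>G\<close> are those
  by multiples of one integer \<open>k\<close>. Hence the only constraint on the value
  \<open>z\<close> at \<open>m\<close> is that \<open>z powi k\<close> be the given value at
  \<open>zmul k m\<close>. The last conclusion starts the construction of a character that is not 1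
  at a prescribed point.\<close>

lemma partial_character_extend:
  fixes m :: "'n::ab_group_add"
  assumes G: "partial_character G"
  obtains G' w where "partial_character G'" "G \<subseteq> G'" "(m, w) \<in> G'"
    "m \<noteq> 0 \<Longrightarrow> G = {(0, 1)} \<Longrightarrow> w \<noteq> 1"
proof -
  have one: "(0, 1) \<in> G" and mult: "\<And>a z b w. (a, z) \<in> G \<Longrightarrow> (b, w) \<in> G \<Longrightarrow> (a + b, z * w) \<in> G"
    and inv: "\<And>a z. (a, z) \<in> G \<Longrightarrow> (- a, inverse z) \<in> G" 
    and norm: "\<And>a z. (a, z) \<in> G \<Longrightarrow> cmod z = 1"
    and ker: "\<And>z. (0, z) \<in> G \<Longrightarrow> z = 1"
    using G unfolding partial_character_def by blast+
  define J where "J = {j. \<exists>z. (zmul j m, z) \<in> G}"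
  have "0 \<in> J"
    using one by (auto simp: J_def zmul_simps)
  moreover have "i - j \<in> J" if "i \<in> J" "j \<in> J" for i j
  proof -
    obtain z w where "(zmul i m, z) \<in> G" "(zmul j m, w) \<in> G"
      using \<open>i \<in> J\<close> \<open>j \<in> J\<close> unfolding J_def by blast
    then have "(zmul i m + - zmul j m, z * inverse w) \<in> G"
      by (intro mult inv)
    moreover have "zmul i m + - zmul j m = zmul (i - j) m"
      using zmul_add[of i "- j" m] by (simp add: zmul_uminus)
    ultimately show ?thesis
      unfolding J_def by auto
  qed
  ultimately obtain k where k: "k \<ge> 0" "k \<in> J" "\<And>j. j \<in> J \<Longrightarrow> k dvd j"
    using int_subgroup_principal by metis
  then obtain w where w: "(zmul k m, w) \<in> G"
    by (auto simp: J_def)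
  obtain z where z: "cmod z = 1" "z powi k = w" "m \<noteq> 0 \<Longrightarrow> G = {(0, 1)} \<Longrightarrow> z \<noteq> 1"
  proof (cases "G = {(0, 1)}")
    case True
    show ?thesis
    proof (cases "k = 0")
      \<comment> \<open>\<open>m\<close> has infinite order, so every value on the unit circle is
        consistent; -1 differs from 1.\<close>
      case True
      then show ?thesis
        using w ker that[of "-1"] by (auto simp: zmul_simps)
    next
      case False
      then have k0: "k > 0" using k by simp
      show ?thesis
      proof (cases "k = 1")
        \<comment> \<open>Here \<open>m\<close> itself is 0 and the requirement
          \<open>z \<noteq> 1\<close> is void.\<close>
        case True
        then show ?thesis
          using w that[of 1] \<open>G = {(0,1)}\<close> by (auto simp: zmul_simps)
      next
        case False
        \<comment> \<open>\<open>m\<close> has order \<open>n > 1\<close>; a primitive root of unity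
          of this order is consistent and not 1.\<close>
        define n where "n = nat k"
        have n: "n > 1" "k = int n"
          using False k0 by (auto simp: n_def)
        have "cis (2 * pi / n) ^ n = 1"
          using n by (subst Complex.DeMoivre) simp
        moreover have "cis (2 * pi / n) \<noteq> 1"
        proof
          assume "cis (2 * pi / n) = 1"
          then have "cos (2 * pi / n) = 1"
            by (metis cis.sel(1) one_complex.sel(1))
          then obtain i :: int where i: "2 * pi / n = real_of_int i * 2 * pi"
            unfolding cos_one_2pi_int by blast
          then have "real_of_int (i * int n) = 1"
            using n by (simp add: field_simps)
          then have "i * int n = 1"
            by linarith
          then have "int n dvd 1"
            by (metis dvd_triv_right)
          then show False
            using n by simp
        qed
        ultimately show ?thesis
          using that[of "cis (2 * pi / n)"] w \<open>G = {(0,1)}\<close> n by (simp add: power_int_of_nat)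
      qed
    qed
  next
    case False
    show ?thesis
    proof (cases "k = 0")
      case True
      then show ?thesis
        using w ker that[of 1] False by (auto simp: zmul_simps)
    next
      case k0: False
      then obtain z where "cmod z = 1" "z ^ nat k = w"
        using root_on_unit_circle[OF norm[OF w], of "nat k"] k by auto
      then show ?thesis
        using that[of z] False k by (simp add: power_int_def)
    qed
  qed
  then have z0: "z \<noteq> 0" by auto
  \<comment> \<open>The domain is the subgroup generated by \<open>m\<close> and the domain of
    \<open>G\<close>. A value is attached to each representation of an element; that the choice of
    representation does not matter is the condition at 0, checked last.\<close>
  define G' where "G' = {(a + zmul j m, x * z powi j) | a x j. (a, x) \<in> G}"
  have G'I: "(a + zmul j m, x * z powi j) \<in> G'" if "(a, x) \<in> G" for a x j
    using that unfolding G'_def by blast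
  have "partial_character G'"
    unfolding partial_character_def
  proof (intro conjI allI impI)
    show "(0, 1) \<in> G'"
      using G'I[OF one, of 0] by (simp add: zmul_simps)
  next
    fix a x b y
    assume "(a, x) \<in> G'" "(b, y) \<in> G'"
    then obtain a' x' i b' y' j where *: "a = a' + zmul i m" "x = x' * z powi i" "(a', x') \<in> G"
      "b = b' + zmul j m" "y = y' * z powi j" "(b', y') \<in> G"
      unfolding G'_def by blast
    have "(a' + b' + zmul (i + j) m, x' * y' * z powi (i + j)) \<in> G'"
      using * by (intro G'I mult)
    then show "(a + b, x * y) \<in> G'"
      using z0 by (simp add: * zmul_add power_int_add algebra_simps)
  next
    fix a x
    assume "(a, x) \<in> G'"
    then obtain a' x' i where *: "a = a' + zmul i m" "x = x' * z powi i" "(a', x') \<in> G"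
      unfolding G'_def by blast
    have "(- a' + zmul (- i) m, inverse x' * z powi (- i)) \<in> G'"
      using * by (intro G'I inv)
    then show "(- a, inverse x) \<in> G'"
      by (simp add: * zmul_uminus power_int_minus algebra_simps)
    show "cmod x = 1"
      using * norm z(1) by (simp add: norm_mult norm_power_int)
  next
    fix x
    assume "(0, x) \<in> G'"
    then obtain a' x' i where *: "0 = a' + zmul i m" "x = x' * z powi i" "(a', x') \<in> G"
      unfolding G'_def by blast
    then have a': "a' = - zmul i m"
      by (metis eq_neg_iff_add_eq_0)
    then have "(zmul i m, inverse x') \<in> G"
      using inv[OF *(3)] by simp
    then have "i \<in> J"
      unfolding J_def by blast
    then obtain q where q: "i = q * k"
      using k(3) by (metis dvdE mult.commute)
    \<comment> \<open>\<open>z powi i\<close> is the value that \<open>G\<close> already has at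
      \<open>zmul i m = - a'\<close>, so \<open>x\<close> is a value of \<open>G\<close> at
      0.\<close>
    have "(zmul i m, w powi q) \<in> G"
      using partial_character_zmul[OF G w, of q] by (simp add: zmul_mult q)
    also have "w powi q = z powi i"
      by (simp add: q mult.commute power_int_mult flip: z(2))
    finally show "x = 1"
      using mult[OF *(3)] ker *(1,2) by metis
  qed
  moreover have "G \<subseteq> G'"
    using G'I[where j = 0] by (auto simp: zmul_simps)
  moreover have "(m, z) \<in> G'"
    using G'I[OF one, of 1] by (simp add: zmul_simps)
  ultimately show ?thesis
    using that z(3) by blast
qed

text \<open>The trivial character of the zero subgroup is extended to \<open>n\<close> with a value
  other than 1. Further extensions keep that value, and a maximal one is defined everywhere because
  any \<open>m\<close> could still be adjoined.\<close>

lemma dual_group_separates: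
  fixes n :: "'n::ab_group_add"
  assumes "n \<noteq> 0"
  obtains \<xi> where "\<xi> \<in> dual_group" "\<xi> n \<noteq> 1"
proof -
  have "partial_character {(0::'n, 1)}"
    by (simp add: partial_character_def)
  then obtain G w where G: "partial_character G" "(n, w) \<in> G" "w \<noteq> 1"
    using partial_character_extend[of "{(0, 1)}" n] assms by metis
  define \<A> where "\<A> = {M. partial_character M \<and> G \<subseteq> M}"
  have "\<exists>M\<in>\<A>. \<forall>X\<in>\<A>. M \<subseteq> X \<longrightarrow> X = M"
  proof (rule subset_Zorn_nonempty)
    show "\<A> \<noteq> {}"
      using G by (auto simp: \<A>_def)
  next
    fix \<C>
    assume \<C>: "\<C> \<noteq> {}" "subset.chain \<A> \<C>"
    then have sub: "\<And>X. X \<in> \<C> \<Longrightarrow> partial_character X \<and> G \<subseteq> X"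
      and lin: "\<And>X Y. X \<in> \<C> \<Longrightarrow> Y \<in> \<C> \<Longrightarrow> X \<subseteq> Y \<or> Y \<subseteq> X"
      by (auto simp: subset_chain_def \<A>_def)
    obtain X0 where "X0 \<in> \<C>"
      using \<C>(1) by blast
    then have one: "(0, 1) \<in> \<Union>\<C>"
      using sub[of X0] unfolding partial_character_def by blast
    have mult: "(a + b, z * w) \<in> \<Union>\<C>" if az: "(a, z) \<in> \<Union>\<C>" and bw: "(b, w) \<in> \<Union>\<C>" for a z b w
    proof -
      obtain X Y where XY: "X \<in> \<C>" "Y \<in> \<C>" "(a, z) \<in> X" "(b, w) \<in> Y"
        using az bw by blast
      define Z where "Z = (if X \<subseteq> Y then Y else X)"
      have "Z \<in> \<C>" "(a, z) \<in> Z" "(b, w) \<in> Z"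
        using XY lin[of X Y] by (auto simp: Z_def)
      moreover from this have "partial_character Z"
        using sub by blast
      ultimately show ?thesis
        unfolding partial_character_def by blast
    qed
    have inv: "(- a, inverse z) \<in> \<Union>\<C> \<and> cmod z = 1" if az: "(a, z) \<in> \<Union>\<C>" for a z
    proof -
      obtain X where X: "X \<in> \<C>" "(a, z) \<in> X"
        using az by blast
      then have "(- a, inverse z) \<in> X \<and> cmod z = 1"
        using sub[of X] unfolding partial_character_def by blast
      then show ?thesis
        using X by blast
    qed
    have ker: "z = 1" if z: "(0, z) \<in> \<Union>\<C>" for z
    proof -
      obtain X where X: "X \<in> \<C>" "(0, z) \<in> X"
        using z by blast
      then show ?thesis
        using sub[of X] unfolding partial_character_def by blast
    qed
    have "partial_character (\<Union>\<C>)"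
      unfolding partial_character_def using one mult inv ker by (intro conjI allI impI) auto
    moreover have "G \<subseteq> \<Union>\<C>"
      using \<C>(1) sub by blast
    ultimately show "\<Union>\<C> \<in> \<A>"
      by (simp add: \<A>_def)
  qed
  then obtain M where M: "partial_character M" "G \<subseteq> M"
    and max: "\<And>X. partial_character X \<Longrightarrow> M \<subseteq> X \<Longrightarrow> X = M"
    unfolding \<A>_def by auto
  have "\<exists>z. (m, z) \<in> M" for m
    using partial_character_extend[OF M(1), of m] max by metis
  then obtain \<xi> where \<xi>: "\<And>m. (m, \<xi> m) \<in> M"
    by metis
  have "\<xi> \<in> dual_group"
    unfolding dual_group_def
  proof (safe)
    fix a b
    have "(a + b, \<xi> a * \<xi> b) \<in> M"
      using M(1) \<xi> unfolding partial_character_def by blast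
    then show "\<xi> (a + b) = \<xi> a * \<xi> b"
      using partial_character_unique[OF M(1) \<xi>] by blast
  next
    fix a
    show "cmod (\<xi> a) = 1"
      using M(1) \<xi> unfolding partial_character_def by blast
  qed
  moreover have "\<xi> n = w"
    using partial_character_unique[OF M(1) \<xi>] M(2) G(2) by blast
  ultimately show ?thesis
    using that G(3) by blast
qed

section \<open>Square integrable functions\<close>

lemma L2_spaceD:
  assumes "F \<in> L2_space M"
  shows "F \<in> borel_measurable M" "integrable M (\<lambda>x. (cmod (F x))\<^sup>2)"
  using assms by (auto simp: L2_space_def)

lemma cmod_add_squared_le: "(cmod (a + b))\<^sup>2 \<le> 2 * (cmod a)\<^sup>2 + 2 * (cmod b)\<^sup>2"
proof -
  have "(cmod (a + b))\<^sup>2 \<le> (cmod a + cmod b)\<^sup>2"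
    by (intro power_mono norm_triangle_ineq) auto
  also have "\<dots> \<le> 2 * (cmod a)\<^sup>2 + 2 * (cmod b)\<^sup>2"
    using zero_le_power2[of "cmod a - cmod b"] by (simp add: power2_eq_square algebra_simps)
  finally show ?thesis .
qed

lemma cmod_mult_le: "cmod (a * b) \<le> (cmod a)\<^sup>2 + (cmod b)\<^sup>2"
proof -
  have "2 * (cmod a * cmod b) \<le> (cmod a)\<^sup>2 + (cmod b)\<^sup>2"
    using zero_le_power2[of "cmod a - cmod b"] by (simp add: power2_eq_square algebra_simps)
  moreover have "0 \<le> cmod a * cmod b"
    by simp
  ultimately show ?thesis
    unfolding norm_mult by linarith
qed

lemma L2_space_add:
  assumes F: "F \<in> L2_space M" and G: "G \<in> L2_space M"
  shows "(\<lambda>x. F x + G x) \<in> L2_space M"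
proof -
  note [measurable] = L2_spaceD(1)[OF F] L2_spaceD(1)[OF G]
  have "integrable M (\<lambda>x. (cmod (F x + G x))\<^sup>2)"
  proof (rule Bochner_Integration.integrable_bound)
    show "integrable M (\<lambda>x. 2 * (cmod (F x))\<^sup>2 + 2 * (cmod (G x))\<^sup>2)"
      using F G by (intro Bochner_Integration.integrable_add integrable_mult_right L2_spaceD(2))
  qed (auto intro!: cmod_add_squared_le)
  then show ?thesis
    by (simp add: L2_space_def)
qed

lemma L2_space_bounded_mult:
  assumes b: "b \<in> borel_measurable M" "AE x in M. cmod (b x) \<le> B" and F: "F \<in> L2_space M"
  shows "(\<lambda>x. b x * F x) \<in> L2_space M"
proof -
  note [measurable] = L2_spaceD(1)[OF F] b(1)
  have "integrable M (\<lambda>x. (cmod (b x * F x))\<^sup>2)"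
  proof (rule Bochner_Integration.integrable_bound)
    show "integrable M (\<lambda>x. B\<^sup>2 * (cmod (F x))\<^sup>2)"
      using F by (intro integrable_mult_right L2_spaceD(2))
    show "AE x in M. norm ((cmod (b x * F x))\<^sup>2) \<le> norm (B\<^sup>2 * (cmod (F x))\<^sup>2)"
      using b(2) by eventually_elim (auto simp: norm_mult power_mult_distrib intro!: mult_right_mono power_mono)
  qed measurable
  then show ?thesis
    by (simp add: L2_space_def)
qed

lemma L2_space_cmult: "F \<in> L2_space M \<Longrightarrow> (\<lambda>x. c * F x) \<in> L2_space M"
  by (rule L2_space_bounded_mult[where B = "cmod c"]) auto

lemma L2_space_diff:
  assumes "F \<in> L2_space M" "G \<in> L2_space M"
  shows "(\<lambda>x. F x - G x) \<in> L2_space M"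
  using L2_space_add[OF assms(1) L2_space_cmult[OF assms(2), of "-1"]] by simp

lemma L2_space_0: "(\<lambda>x. 0) \<in> L2_space M"
  by (simp add: L2_space_def)

lemma L2_space_sum: "(\<And>i. i \<in> I \<Longrightarrow> F i \<in> L2_space M) \<Longrightarrow> (\<lambda>x. \<Sum>i\<in>I. F i x) \<in> L2_space M"
  by (induction I rule: infinite_finite_induct) (auto intro: L2_space_0 L2_space_add)

lemma L2_space_cnj: "F \<in> L2_space M \<Longrightarrow> (\<lambda>x. cnj (F x)) \<in> L2_space M"
  using measurable_compose[OF _ borel_measurable_continuous_onI[of cnj], of F M]
  by (simp add: L2_space_def)

lemma L2_space_integrable_mult:
  assumes F: "F \<in> L2_space M" and G: "G \<in> L2_space M"
  shows "integrable M (\<lambda>x. F x * G x)"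
proof (rule Bochner_Integration.integrable_bound)
  note [measurable] = L2_spaceD(1)[OF F] L2_spaceD(1)[OF G]
  show "integrable M (\<lambda>x. (cmod (F x))\<^sup>2 + (cmod (G x))\<^sup>2)"
    using F G by (intro Bochner_Integration.integrable_add L2_spaceD(2))
  show "(\<lambda>x. F x * G x) \<in> borel_measurable M"
    by measurable
  show "AE x in M. norm (F x * G x) \<le> norm ((cmod (F x))\<^sup>2 + (cmod (G x))\<^sup>2)"
    using cmod_mult_le by (intro AE_I2) simp
qed

lemma (in prob_space) L2_space_bounded:
  assumes "F \<in> borel_measurable M" "AE x in M. cmod (F x) \<le> B"
  shows "F \<in> L2_space M"
proof -
  have "(\<lambda>x. 1) \<in> L2_space M"
    by (simp add: L2_space_def)
  from L2_space_bounded_mult[OF assms this] show ?thesis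
    by simp
qed

lemma (in prob_space) L2_space_integrable:
  assumes "F \<in> L2_space M"
  shows "integrable M F"
  using L2_space_integrable_mult[OF assms L2_space_bounded[of "\<lambda>_. 1" 1]] by simp

text \<open>Cauchy-Schwarz against the constant 1, in the form of a pointwise inequality between
  arithmetic and geometric mean; the weight \<open>t\<close> is chosen so that both terms contribute
  \<open>t / 2\<close>.\<close>

lemma (in prob_space) integral_cmod_le:
  assumes F: "F \<in> L2_space M" and le: "(\<integral>x. (cmod (F x))\<^sup>2 \<partial>M) \<le> t\<^sup>2" and t: "t > 0"
  shows "(\<integral>x. cmod (F x) \<partial>M) \<le> t"
proof -
  have "(\<integral>x. cmod (F x) \<partial>M) \<le> (\<integral>x. t / 2 + (cmod (F x))\<^sup>2 / (2 * t) \<partial>M)"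
  proof (rule integral_mono)
    show "integrable M (\<lambda>x. cmod (F x))"
      using L2_space_integrable[OF F] by simp
    show "integrable M (\<lambda>x. t / 2 + (cmod (F x))\<^sup>2 / (2 * t))"
      using L2_spaceD(2)[OF F] by simp
    fix x
    have "0 \<le> (t - cmod (F x))\<^sup>2 / (2 * t)"
      using t by simp
    also have "\<dots> = t / 2 + (cmod (F x))\<^sup>2 / (2 * t) - cmod (F x)"
      using t by (simp add: field_simps power2_eq_square)
    finally show "cmod (F x) \<le> t / 2 + (cmod (F x))\<^sup>2 / (2 * t)"
      by simp
  qed
  also have "\<dots> = t / 2 + (\<integral>x. (cmod (F x))\<^sup>2 \<partial>M) / (2 * t)"
    using L2_spaceD(2)[OF F] by (simp add: prob_space)
  also have "\<dots> \<le> t / 2 + t\<^sup>2 / (2 * t)"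
    using le t by (intro add_left_mono divide_right_mono) auto
  also have "\<dots> = t"
    using t by (simp add: power2_eq_square)
  finally show ?thesis .
qed

section \<open>Orthonormality of the characters\<close>

locale dual_haar =
  fixes \<mu> :: "('n::ab_group_add \<Rightarrow> complex) measure"
  assumes haar: "dual_haar_measure \<mu>"
begin

lemma sets_mu: "sets \<mu> = sets (restrict_space borel dual_group)"
  using haar by (simp add: dual_haar_measure_def)

lemma space_mu: "space \<mu> = dual_group"
  using sets_eq_imp_space_eq[OF sets_mu] by (simp add: space_restrict_space)

end

sublocale dual_haar \<subseteq> prob_space \<mu>
  by standard (use haar in \<open>simp add: space_mu dual_haar_measure_def\<close>)

context dual_haar
begin

lemma continuous_measurable:
  assumes "continuous_on UNIV (f :: _ \<Rightarrow> 'b::topological_space)"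
  shows "f \<in> borel_measurable \<mu>"
proof -
  have "f \<in> borel_measurable (restrict_space borel dual_group)"
    using assms by (intro measurable_restrict_space1 borel_measurable_continuous_onI)
  then show ?thesis
    by (simp cong: measurable_cong_sets add: sets_mu)
qed

lemma eval_measurable [measurable]: "(\<lambda>\<xi>. \<xi> n) \<in> borel_measurable \<mu>"
  by (intro continuous_measurable continuous_on_product_coordinates)

lemma eval_simps:
  assumes "\<xi> \<in> space \<mu>"
  shows "cmod (\<xi> n) = 1" "\<xi> (m + n) = \<xi> m * \<xi> n" "\<xi> 0 = 1" "\<xi> (- n) = cnj (\<xi> n)"
proof -
  have \<xi>: "\<And>m n. \<xi> (m + n) = \<xi> m * \<xi> n" "\<And>n. cmod (\<xi> n) = 1"
    using assms by (auto simp: space_mu dual_group_def)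
  show "cmod (\<xi> n) = 1" "\<xi> (m + n) = \<xi> m * \<xi> n"
    by (fact \<xi>)+
  have "\<xi> 0 * \<xi> 0 = \<xi> 0" "\<xi> 0 \<noteq> 0"
    using \<xi>(1)[of 0 0] \<xi>(2)[of 0] by auto
  then show \<xi>0: "\<xi> 0 = 1"
    by simp
  have "\<xi> n * \<xi> (- n) = 1"
    using \<xi>(1)[of n "- n"] \<xi>0 by simp
  moreover have "\<xi> n * cnj (\<xi> n) = 1"
    using \<xi>(2)[of n] by (simp add: complex_norm_square[symmetric])
  moreover have "\<xi> n \<noteq> 0"
    using \<xi>(2)[of n] by auto
  ultimately show "\<xi> (- n) = cnj (\<xi> n)"
    by (metis mult_left_cancel)
qed

lemma eval_bounded: "AE \<xi> in \<mu>. cmod (\<xi> n) \<le> 1"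
  by (intro AE_I2) (simp add: eval_simps)

lemma L2_space_eval: "(\<lambda>\<xi>. \<xi> n) \<in> L2_space \<mu>"
  by (rule L2_space_bounded[OF _ eval_bounded]) measurable

text \<open>Translation by a character \<open>\<eta>\<close> with \<open>\<eta> n \<noteq> 1\<close>
  multiplies the integral by \<open>\<eta> n\<close>, while invariance leaves it unchanged.\<close>

lemma integral_eval: "(\<integral>\<xi>. \<xi> n \<partial>\<mu>) = (if n = 0 then 1 else 0)"
proof (cases "n = 0")
  case True
  have "(\<integral>\<xi>. \<xi> n \<partial>\<mu>) = (\<integral>\<xi>. 1 \<partial>\<mu>)"
    using True by (intro Bochner_Integration.integral_cong) (auto simp: eval_simps)
  then show ?thesis
    using True prob_space by simp
next
  case False
  then obtain \<eta> where \<eta>: "\<eta> \<in> dual_group" "\<eta> n \<noteq> 1"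
    by (rule dual_group_separates)
  define \<tau> where "\<tau> \<zeta> \<xi> = (\<lambda>n. \<zeta> n * \<xi> n)" for \<zeta> \<xi> :: "'n \<Rightarrow> complex"
  have cont: "continuous_on UNIV (\<tau> \<zeta>)" for \<zeta>
    unfolding \<tau>_def
    by (intro continuous_on_coordinatewise_then_product continuous_intros continuous_on_product_coordinates)
  have dual: "\<tau> \<zeta> \<xi> \<in> dual_group" if "\<zeta> \<in> dual_group" "\<xi> \<in> dual_group" for \<zeta> \<xi>
    using that by (auto simp: dual_group_def \<tau>_def norm_mult)
  have meas: "\<tau> \<eta> \<in> measurable \<mu> \<mu>"
  proof -
    have "\<tau> \<eta> \<in> measurable \<mu> (restrict_space borel dual_group)"
      using dual[OF \<eta>(1)] by (intro measurable_restrict_space2 continuous_measurable cont) (auto simp: space_mu)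
    then show ?thesis
      by (simp cong: measurable_cong_sets add: sets_mu)
  qed
  \<comment> \<open>Invariance is given for images of sets, whereas \<open>distr\<close> works with
    preimages; the inverse character turns one into the other.\<close>
  define \<eta>' where "\<eta>' = (\<lambda>n. cnj (\<eta> n))"
  have \<eta>': "\<eta>' \<in> dual_group"
    using \<eta>(1) by (auto simp: \<eta>'_def dual_group_def)
  have "\<eta> m * cnj (\<eta> m) = 1" for m
    using \<eta>(1) by (simp add: dual_group_def complex_norm_square[symmetric])
  then have inv: "\<tau> \<eta> (\<tau> \<eta>' \<xi>) = \<xi>" "\<tau> \<eta>' (\<tau> \<eta> \<xi>) = \<xi>" for \<xi>
    by (auto simp: \<tau>_def \<eta>'_def fun_eq_iff mult.assoc[symmetric] mult.commute[of "cnj _"])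
  have "distr \<mu> \<mu> (\<tau> \<eta>) = \<mu>"
  proof (rule measure_eqI)
    fix A
    assume "A \<in> sets (distr \<mu> \<mu> (\<tau> \<eta>))"
    then have A: "A \<in> sets \<mu>"
      by simp
    then have sub: "A \<subseteq> dual_group"
      using sets.sets_into_space[OF A] by (simp add: space_mu)
    have "\<tau> \<eta> -` A \<inter> space \<mu> = \<tau> \<eta>' ` A"
    proof (intro equalityI subsetI)
      fix \<xi>
      assume "\<xi> \<in> \<tau> \<eta> -` A \<inter> space \<mu>"
      then show "\<xi> \<in> \<tau> \<eta>' ` A"
        by (intro image_eqI[of _ _ "\<tau> \<eta> \<xi>"]) (auto simp: inv)
    next
      fix \<xi>
      assume "\<xi> \<in> \<tau> \<eta>' ` A"
      then show "\<xi> \<in> \<tau> \<eta> -` A \<inter> space \<mu>"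
        using sub dual[OF \<eta>'] by (auto simp: inv space_mu)
    qed
    moreover have "emeasure \<mu> (\<tau> \<eta>' ` A) = emeasure \<mu> A"
      using haar \<eta>' A unfolding dual_haar_measure_def \<tau>_def by blast
    ultimately show "emeasure (distr \<mu> \<mu> (\<tau> \<eta>)) A = emeasure \<mu> A"
      using emeasure_distr[OF meas A] by simp
  qed simp
  then have "(\<integral>\<xi>. \<xi> n \<partial>\<mu>) = (\<integral>\<xi>. \<xi> n \<partial>distr \<mu> \<mu> (\<tau> \<eta>))"
    by simp
  also have "\<dots> = (\<integral>\<xi>. \<tau> \<eta> \<xi> n \<partial>\<mu>)"
    by (intro integral_distr meas eval_measurable)
  also have "\<dots> = \<eta> n * (\<integral>\<xi>. \<xi> n \<partial>\<mu>)"
    by (simp add: \<tau>_def)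
  finally show ?thesis
    using \<eta>(2) False by (metis mult_cancel_right1)
qed

text \<open>On the dual group \<open>\<xi> m\<close> is the conjugate of \<open>\<xi> (- m)\<close>.
  These are thus the coefficients with respect to the orthonormal functions
  \<open>\<xi> (- n)\<close> from which \<open>fourier_ell1\<close> and \<open>trig\<close> are
  built.\<close>

definition fcoef :: "(('n \<Rightarrow> complex) \<Rightarrow> complex) \<Rightarrow> 'n \<Rightarrow> complex" where
  "fcoef F m = (\<integral>\<xi>. F \<xi> * \<xi> m \<partial>\<mu>)"

definition trig :: "'n set \<Rightarrow> ('n \<Rightarrow> complex) \<Rightarrow> ('n \<Rightarrow> complex) \<Rightarrow> complex" where
  "trig S c \<xi> = (\<Sum>n\<in>S. c n * \<xi> (- n))"

lemma L2_space_trig: "trig S c \<in> L2_space \<mu>"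
  unfolding trig_def[abs_def] by (intro L2_space_sum L2_space_cmult L2_space_eval)

lemma fcoef_add:
  assumes "F \<in> L2_space \<mu>" "G \<in> L2_space \<mu>"
  shows "fcoef (\<lambda>\<xi>. F \<xi> + G \<xi>) m = fcoef F m + fcoef G m"
  unfolding fcoef_def distrib_right
  by (intro Bochner_Integration.integral_add L2_space_integrable_mult L2_space_eval assms)

lemma fcoef_diff:
  assumes "F \<in> L2_space \<mu>" "G \<in> L2_space \<mu>"
  shows "fcoef (\<lambda>\<xi>. F \<xi> - G \<xi>) m = fcoef F m - fcoef G m"
  unfolding fcoef_def left_diff_distrib
  by (intro Bochner_Integration.integral_diff L2_space_integrable_mult L2_space_eval assms)

lemma fcoef_cmult: "fcoef (\<lambda>\<xi>. c * F \<xi>) m = c * fcoef F m"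
  by (simp add: fcoef_def mult.assoc)

lemma fcoef_sum:
  assumes "\<And>i. i \<in> I \<Longrightarrow> F i \<in> L2_space \<mu>"
  shows "fcoef (\<lambda>\<xi>. \<Sum>i\<in>I. F i \<xi>) m = (\<Sum>i\<in>I. fcoef (F i) m)"
  unfolding fcoef_def sum_distrib_right
  by (intro Bochner_Integration.integral_sum L2_space_integrable_mult L2_space_eval assms)

lemma fcoef_cong_AE:
  assumes "AE \<xi> in \<mu>. F \<xi> = G \<xi>" "F \<in> L2_space \<mu>" "G \<in> L2_space \<mu>"
  shows "fcoef F m = fcoef G m"
  unfolding fcoef_def
proof (rule integral_cong_AE)
  note [measurable] = L2_spaceD(1)[OF assms(2)] L2_spaceD(1)[OF assms(3)]
  show "(\<lambda>\<xi>. F \<xi> * \<xi> m) \<in> borel_measurable \<mu>" "(\<lambda>\<xi>. G \<xi> * \<xi> m) \<in> borel_measurable \<mu>"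
    by measurable
qed (use assms(1) in auto)

lemma fcoef_shift: "fcoef (\<lambda>\<xi>. \<xi> (- k) * F \<xi>) m = fcoef F (m - k)"
  unfolding fcoef_def
proof (rule Bochner_Integration.integral_cong)
  fix \<xi>
  assume "\<xi> \<in> space \<mu>"
  then have "\<xi> (m - k) = \<xi> m * \<xi> (- k)"
    using eval_simps(2)[of \<xi> m "- k"] by simp
  then show "\<xi> (- k) * F \<xi> * \<xi> m = F \<xi> * \<xi> (m - k)"
    by simp
qed simp

lemma fcoef_eval: "fcoef (\<lambda>\<xi>. \<xi> (- n)) m = (if m = n then 1 else 0)"
proof -
  have "fcoef (\<lambda>\<xi>. \<xi> (- n)) m = (\<integral>\<xi>. \<xi> (- n + m) \<partial>\<mu>)"
    unfolding fcoef_def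
    by (rule Bochner_Integration.integral_cong, rule refl) (simp only: eval_simps(2))
  also have "\<dots> = (if - n + m = 0 then 1 else 0)"
    by (rule integral_eval)
  also have "- n + m = 0 \<longleftrightarrow> m = n"
    by (simp add: neg_eq_iff_add_eq_0[symmetric])
  finally show ?thesis .
qed

lemma fcoef_trig: "finite S \<Longrightarrow> fcoef (trig S c) m = (if m \<in> S then c m else 0)"
  unfolding trig_def[abs_def]
  by (subst fcoef_sum) (auto intro!: L2_space_cmult L2_space_eval simp: fcoef_cmult fcoef_eval if_distrib
      cong: if_cong)

lemma cmod_fcoef_le:
  assumes "F \<in> L2_space \<mu>"
  shows "cmod (fcoef F m) \<le> (\<integral>\<xi>. cmod (F \<xi>) \<partial>\<mu>)"
proof -
  have "cmod (fcoef F m) \<le> (\<integral>\<xi>. cmod (F \<xi> * \<xi> m) \<partial>\<mu>)"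
    unfolding fcoef_def by (rule integral_norm_bound)
  also have "\<dots> = (\<integral>\<xi>. cmod (F \<xi>) \<partial>\<mu>)"
    by (intro Bochner_Integration.integral_cong) (auto simp: norm_mult eval_simps)
  finally show ?thesis .
qed

lemma integral_mult_cnj_trig:
  assumes F: "F \<in> L2_space \<mu>"
  shows "(\<integral>\<xi>. F \<xi> * cnj (trig S c \<xi>) \<partial>\<mu>) = (\<Sum>n\<in>S. fcoef F n * cnj (c n))"
proof -
  have "(\<integral>\<xi>. F \<xi> * cnj (trig S c \<xi>) \<partial>\<mu>) = (\<integral>\<xi>. (\<Sum>n\<in>S. cnj (c n) * (F \<xi> * \<xi> n)) \<partial>\<mu>)"
    by (intro Bochner_Integration.integral_cong)
      (auto simp: trig_def eval_simps sum_distrib_left mult_ac)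
  also have "\<dots> = (\<Sum>n\<in>S. \<integral>\<xi>. cnj (c n) * (F \<xi> * \<xi> n) \<partial>\<mu>)"
    using F by (intro Bochner_Integration.integral_sum integrable_mult_right L2_space_integrable_mult L2_space_eval)
  also have "\<dots> = (\<Sum>n\<in>S. fcoef F n * cnj (c n))"
    by (simp add: fcoef_def mult.commute[of "cnj _"])
  finally show ?thesis .
qed

text \<open>Expanding the square and using orthonormality splits the error into the distance from
  the span and the mismatch of coefficients. The choice \<open>c = fcoef F\<close> gives Bessel's
  inequality, \<open>F = 0\<close> the norm of a trigonometric polynomial, and a Riesz-Fischer
  function its norm.\<close>

lemma integral_diff_trig_squared:
  assumes F: "F \<in> L2_space \<mu>" and S: "finite S"
  shows "(\<integral>\<xi>. (cmod (F \<xi> - trig S c \<xi>))\<^sup>2 \<partial>\<mu>) =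
    (\<integral>\<xi>. (cmod (F \<xi>))\<^sup>2 \<partial>\<mu>) - (\<Sum>n\<in>S. (cmod (fcoef F n))\<^sup>2) + (\<Sum>n\<in>S. (cmod (fcoef F n - c n))\<^sup>2)"
proof -
  let ?P = "trig S c"
  have int: "integrable \<mu> (\<lambda>\<xi>. G \<xi> * cnj (?P \<xi>))" if "G \<in> L2_space \<mu>" for G
    by (intro L2_space_integrable_mult that L2_space_cnj L2_space_trig)
  have A: "integrable \<mu> (\<lambda>\<xi>. (cmod (F \<xi>))\<^sup>2)"
    and B: "integrable \<mu> (\<lambda>\<xi>. 2 * Re (F \<xi> * cnj (?P \<xi>)))"
    and C: "integrable \<mu> (\<lambda>\<xi>. Re (?P \<xi> * cnj (?P \<xi>)))"
    using F by (intro L2_spaceD(2) integrable_mult_right integrable_Re int L2_space_trig; assumption)+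
  have id: "(cmod (a - b))\<^sup>2 = (cmod a)\<^sup>2 - 2 * Re (a * cnj b) + Re (b * cnj b)" for a b
    unfolding cmod_power2 by (simp add: algebra_simps power2_eq_square)
  have "(\<integral>\<xi>. (cmod (F \<xi> - ?P \<xi>))\<^sup>2 \<partial>\<mu>) =
    (\<integral>\<xi>. (cmod (F \<xi>))\<^sup>2 - 2 * Re (F \<xi> * cnj (?P \<xi>)) + Re (?P \<xi> * cnj (?P \<xi>)) \<partial>\<mu>)"
    by (simp only: id)
  also have "\<dots> = (\<integral>\<xi>. (cmod (F \<xi>))\<^sup>2 \<partial>\<mu>) - 2 * (\<integral>\<xi>. Re (F \<xi> * cnj (?P \<xi>)) \<partial>\<mu>) + (\<integral>\<xi>. Re (?P \<xi> * cnj (?P \<xi>)) \<partial>\<mu>)"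
    by (simp only: Bochner_Integration.integral_add[OF Bochner_Integration.integrable_diff[OF A B] C]
      Bochner_Integration.integral_diff[OF A B] integral_mult_right_zero)
  also have "(\<integral>\<xi>. Re (F \<xi> * cnj (?P \<xi>)) \<partial>\<mu>) = Re (\<Sum>n\<in>S. fcoef F n * cnj (c n))"
    by (subst integral_Re[OF int[OF F]]) (simp add: integral_mult_cnj_trig[OF F])
  also have "(\<integral>\<xi>. Re (?P \<xi> * cnj (?P \<xi>)) \<partial>\<mu>) = Re (\<Sum>n\<in>S. c n * cnj (c n))"
    using S by (subst integral_Re[OF int[OF L2_space_trig]])
      (simp add: integral_mult_cnj_trig[OF L2_space_trig] fcoef_trig)
  finally show ?thesis
    by (simp add: id sum.distrib sum_subtractf sum_distrib_left)
qed

lemma bessel_fcoef: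
  assumes F: "F \<in> L2_space \<mu>" and S: "finite S"
  shows "(\<Sum>n\<in>S. (cmod (fcoef F n))\<^sup>2) \<le> (\<integral>\<xi>. (cmod (F \<xi>))\<^sup>2 \<partial>\<mu>)"
proof -
  have "0 \<le> (\<integral>\<xi>. (cmod (F \<xi> - trig S (fcoef F) \<xi>))\<^sup>2 \<partial>\<mu>)"
    by simp
  also have "\<dots> = (\<integral>\<xi>. (cmod (F \<xi>))\<^sup>2 \<partial>\<mu>) - (\<Sum>n\<in>S. (cmod (fcoef F n))\<^sup>2)"
    using integral_diff_trig_squared[OF F S, of "fcoef F"] by simp
  finally show ?thesis
    by simp
qed

lemma fcoef_ell2:
  assumes F: "F \<in> L2_space \<mu>"
  shows "fcoef F \<in> ell2"
  unfolding ell2_def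
  by (auto intro!: nonneg_bdd_above_summable_on bdd_aboveI2[where M = "\<integral>\<xi>. (cmod (F \<xi>))\<^sup>2 \<partial>\<mu>"] bessel_fcoef[OF F])

end

section \<open>The Riesz-Fischer theorem\<close>

lemma has_sum_diff:
  fixes f g :: "'i \<Rightarrow> 'b::topological_ab_group_add"
  assumes "(f has_sum a) A" "(g has_sum b) A"
  shows "((\<lambda>x. f x - g x) has_sum (a - b)) A"
  using has_sum_add[OF assms(1), of "\<lambda>x. - g x" "- b"] assms(2) by (simp add: has_sum_uminus)

lemma ell2I:
  assumes "\<And>S. finite S \<Longrightarrow> (\<Sum>i\<in>S. (cmod (a i))\<^sup>2) \<le> B"
  shows "a \<in> ell2" "(\<Sum>\<^sub>\<infinity>i. (cmod (a i))\<^sup>2) \<le> B"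
proof -
  show a: "a \<in> ell2"
    unfolding ell2_def using assms by (auto intro!: nonneg_bdd_above_summable_on bdd_aboveI2[where M = B])
  show "(\<Sum>\<^sub>\<infinity>i. (cmod (a i))\<^sup>2) \<le> B"
    using a assms by (intro infsum_le_finite_sums) (auto simp: ell2_def)
qed

lemma ell2_has_sum:
  "a \<in> ell2 \<Longrightarrow> ((\<lambda>i. (cmod (a i))\<^sup>2) has_sum (\<Sum>\<^sub>\<infinity>i. (cmod (a i))\<^sup>2)) UNIV"
  by (simp add: ell2_def)

lemma ell2_finite_sum_le:
  "a \<in> ell2 \<Longrightarrow> finite S \<Longrightarrow> (\<Sum>i\<in>S. (cmod (a i))\<^sup>2) \<le> (\<Sum>\<^sub>\<infinity>i. (cmod (a i))\<^sup>2)"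
  by (intro finite_sum_le_infsum) (auto simp: ell2_def)

text \<open>This allows sequential arguments over an arbitrary index set. The tails are measured by
  \<open>(1 / 4) ^ k\<close> because norms are their square roots, which are then
  \<open>(1 / 2) ^ k\<close>.\<close>

lemma ell2_exhaustion:
  assumes a: "a \<in> ell2"
  obtains S :: "nat \<Rightarrow> _" where "\<And>k. finite (S k)" "incseq S"
    "\<And>k. (\<Sum>\<^sub>\<infinity>i. (cmod (a i))\<^sup>2) - (\<Sum>i\<in>S k. (cmod (a i))\<^sup>2) \<le> (1 / 4) ^ k"
proof -
  let ?t = "\<Sum>\<^sub>\<infinity>i. (cmod (a i))\<^sup>2"
  have "\<exists>T. finite T \<and> ?t - (\<Sum>i\<in>T. (cmod (a i))\<^sup>2) \<le> (1 / 4) ^ k" for k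
  proof -
    obtain T where "finite T" "dist (\<Sum>i\<in>T. (cmod (a i))\<^sup>2) ?t \<le> (1 / 4) ^ k"
      using has_sum_finite_approximation[OF ell2_has_sum[OF a], of "(1 / 4) ^ k"] by auto
    then show ?thesis
      by (intro exI[of _ T]) (auto simp: dist_real_def)
  qed
  then obtain T where T: "\<And>k. finite (T k)" "\<And>k. ?t - (\<Sum>i\<in>T k. (cmod (a i))\<^sup>2) \<le> (1 / 4) ^ k"
    by metis
  have "(\<Sum>i\<in>T k. (cmod (a i))\<^sup>2) \<le> (\<Sum>i\<in>\<Union>(T ` {..k}). (cmod (a i))\<^sup>2)" for k
    using T(1) by (intro sum_mono2) auto
  then have "?t - (\<Sum>i\<in>\<Union>(T ` {..k}). (cmod (a i))\<^sup>2) \<le> (1 / 4) ^ k" for k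
    using T(2)[of k] by (meson diff_left_mono order_trans)
  moreover have "incseq (\<lambda>k. \<Union>(T ` {..k}))"
    by (intro monoI UN_mono) auto
  ultimately show ?thesis
    using that[of "\<lambda>k. \<Union>(T ` {..k})"] T(1) by auto
qed

context dual_haar
begin

lemma integral_trig_squared:
  assumes "finite S"
  shows "(\<integral>\<xi>. (cmod (trig S c \<xi>))\<^sup>2 \<partial>\<mu>) = (\<Sum>n\<in>S. (cmod (c n))\<^sup>2)"
  using integral_diff_trig_squared[OF L2_space_0 assms, of c] by (simp add: fcoef_def)

text \<open>Partial sums along an exhaustion have a subsequence that converges almost everywhere.
  Fatou's lemma shows that its limit is also the limit in L2, so that coefficients and norm can be
  read off from the partial sums.\<close>

theorem riesz_fischer:
  assumes a: "a \<in> ell2"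
  obtains F where "F \<in> L2_space \<mu>" "fcoef F = a"
    "(\<integral>\<xi>. (cmod (F \<xi>))\<^sup>2 \<partial>\<mu>) = (\<Sum>\<^sub>\<infinity>n. (cmod (a n))\<^sup>2)"
proof -
  let ?t = "\<Sum>\<^sub>\<infinity>n. (cmod (a n))\<^sup>2"
  obtain S :: "nat \<Rightarrow> 'n set" where S: "\<And>k. finite (S k)" "incseq S"
    "\<And>k. ?t - (\<Sum>i\<in>S k. (cmod (a i))\<^sup>2) \<le> (1 / 4) ^ k"
    using ell2_exhaustion[OF a] by metis
  have quarter: "(1 / 4 :: real) ^ k = ((1 / 2) ^ k)\<^sup>2" for k :: nat
    by (simp add: power2_eq_square flip: power_mult_distrib)
  define s where "s k = trig (S k) a" for k
  have s[measurable]: "s k \<in> borel_measurable \<mu>" and sL2: "s k \<in> L2_space \<mu>" for k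
    using L2_space_trig L2_spaceD(1) by (auto simp: s_def)
  have le_t: "(\<Sum>n\<in>S k. (cmod (a n))\<^sup>2) \<le> ?t" for k
    by (intro ell2_finite_sum_le a S)
  have sdiff: "(\<integral>\<xi>. (cmod (s j \<xi> - s k \<xi>))\<^sup>2 \<partial>\<mu>) \<le> (1 / 4) ^ k" if "k \<le> j" for j k
  proof -
    have sub: "S k \<subseteq> S j"
      using S(2) that by (auto dest: incseqD)
    have "(\<integral>\<xi>. (cmod (s j \<xi> - s k \<xi>))\<^sup>2 \<partial>\<mu>) = (\<integral>\<xi>. (cmod (trig (S j - S k) a \<xi>))\<^sup>2 \<partial>\<mu>)"
      by (simp add: s_def trig_def sum_diff[OF S(1) sub])
    also have "\<dots> = (\<Sum>n\<in>S j. (cmod (a n))\<^sup>2) - (\<Sum>n\<in>S k. (cmod (a n))\<^sup>2)"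
      using S(1) by (simp add: integral_trig_squared sum_diff[OF S(1) sub])
    also have "\<dots> \<le> (1 / 4) ^ k"
      using le_t[of j] S(3)[of k] by linarith
    finally show ?thesis .
  qed
  \<comment> \<open>On a probability space closeness in L2 gives closeness in L1, the input for an
    almost everywhere Cauchy subsequence.\<close>
  have sdiff1: "(\<integral>\<xi>. cmod (s i \<xi> - s j \<xi>) \<partial>\<mu>) \<le> (1 / 2) ^ k" if "k \<le> i" "k \<le> j" for i j k
  proof -
    have *: "(\<integral>\<xi>. cmod (s i \<xi> - s j \<xi>) \<partial>\<mu>) \<le> (1 / 2) ^ k" if "k \<le> j" "j \<le> i" for i j
    proof (rule integral_cmod_le)
      have "(\<integral>\<xi>. (cmod (s i \<xi> - s j \<xi>))\<^sup>2 \<partial>\<mu>) \<le> (1 / 4) ^ j"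
        by (rule sdiff[OF that(2)])
      also have "\<dots> \<le> (1 / 4) ^ k"
        using that(1) by (intro power_decreasing) auto
      finally show "(\<integral>\<xi>. (cmod (s i \<xi> - s j \<xi>))\<^sup>2 \<partial>\<mu>) \<le> ((1 / 2) ^ k)\<^sup>2"
        by (simp only: quarter)
    qed (auto intro: L2_space_diff sL2)
    show ?thesis
      using *[of j i] *[of i j] that by (cases "j \<le> i") (auto simp: norm_minus_commute)
  qed
  have half: "(\<lambda>k. (1 / 2 :: real) ^ k) \<longlonglongrightarrow> 0"
    by (rule LIMSEQ_realpow_zero) auto
  obtain r where r: "strict_mono r" "AE \<xi> in \<mu>. Cauchy (\<lambda>i. s (r i) \<xi>)"
  proof (rule cauchy_L1_AE_cauchy_subseq[of \<mu> s])
    show "integrable \<mu> (s n)" for n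
      by (intro L2_space_integrable sL2)
    fix e :: real
    assume "e > 0"
    then obtain k where k: "(1 / 2) ^ k < e"
      using order_tendstoD(2)[OF half] by (auto simp: eventually_sequentially)
    then show "\<exists>N. \<forall>i\<ge>N. \<forall>j\<ge>N. (\<integral>\<xi>. norm (s i \<xi> - s j \<xi>) \<partial>\<mu>) < e"
      using sdiff1 by (intro exI[of _ k]) (meson le_less_trans)
  qed
  define F where "F \<xi> = lim (\<lambda>i. s (r i) \<xi>)" for \<xi>
  have F[measurable]: "F \<in> borel_measurable \<mu>"
    unfolding F_def[abs_def] by measurable
  have lim: "AE \<xi> in \<mu>. (\<lambda>i. s (r i) \<xi>) \<longlonglongrightarrow> F \<xi>"
    using r(2) by eventually_elim (simp add: F_def Cauchy_convergent_iff convergent_LIMSEQ_iff)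
  \<comment> \<open>The estimate \<open>sdiff\<close> for \<open>s (r i)\<close> and a fixed
    \<open>s k\<close>, passed to the limit in \<open>i\<close>.\<close>
  have fatou: "(\<integral>\<^sup>+\<xi>. ennreal ((cmod (F \<xi> - s k \<xi>))\<^sup>2) \<partial>\<mu>) \<le> ennreal ((1 / 4) ^ k)" for k
  proof -
    have "(\<integral>\<^sup>+\<xi>. ennreal ((cmod (F \<xi> - s k \<xi>))\<^sup>2) \<partial>\<mu>) =
        (\<integral>\<^sup>+\<xi>. liminf (\<lambda>i. ennreal ((cmod (s (r i) \<xi> - s k \<xi>))\<^sup>2)) \<partial>\<mu>)"
    proof (rule nn_integral_cong_AE, use lim in eventually_elim)
      fix \<xi>
      assume "(\<lambda>i. s (r i) \<xi>) \<longlonglongrightarrow> F \<xi>"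
      then have "(\<lambda>i. ennreal ((cmod (s (r i) \<xi> - s k \<xi>))\<^sup>2)) \<longlonglongrightarrow> ennreal ((cmod (F \<xi> - s k \<xi>))\<^sup>2)"
        by (intro tendsto_intros)
      then show "ennreal ((cmod (F \<xi> - s k \<xi>))\<^sup>2) = liminf (\<lambda>i. ennreal ((cmod (s (r i) \<xi> - s k \<xi>))\<^sup>2))"
        by (intro lim_imp_Liminf[symmetric]) auto
    qed
    also have "\<dots> \<le> liminf (\<lambda>i. \<integral>\<^sup>+\<xi>. ennreal ((cmod (s (r i) \<xi> - s k \<xi>))\<^sup>2) \<partial>\<mu>)"
      by (intro nn_integral_liminf) measurable
    also have "\<dots> \<le> liminf (\<lambda>i. ennreal ((1 / 4) ^ k))"
    proof (rule Liminf_mono)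
      show "\<forall>\<^sub>F i in sequentially. (\<integral>\<^sup>+\<xi>. ennreal ((cmod (s (r i) \<xi> - s k \<xi>))\<^sup>2) \<partial>\<mu>) \<le> ennreal ((1 / 4) ^ k)"
        using eventually_ge_at_top[of k]
      proof eventually_elim
        case (elim i)
        then have "k \<le> r i"
          using seq_suble[OF r(1), of i] by simp
        from sdiff[OF this] show ?case
          by (subst nn_integral_eq_integral)
            (auto intro!: L2_spaceD(2) L2_space_diff sL2 ennreal_leI)
      qed
    qed
    also have "\<dots> = ennreal ((1 / 4) ^ k)"
      by (simp add: Liminf_const)
    finally show ?thesis .
  qed
  have FsL2: "(\<lambda>\<xi>. F \<xi> - s k \<xi>) \<in> L2_space \<mu>" for k
    unfolding L2_space_def
    using fatou[of k] by (auto intro!: integrableI_bounded simp: le_less_trans[OF _ ennreal_less_top])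
  have Fs: "(\<integral>\<xi>. (cmod (F \<xi> - s k \<xi>))\<^sup>2 \<partial>\<mu>) \<le> (1 / 4) ^ k" for k
    using fatou[of k] by (subst (asm) nn_integral_eq_integral) (auto intro!: L2_spaceD(2) FsL2)
  have FL2: "F \<in> L2_space \<mu>"
    using L2_space_add[OF FsL2[of 0] sL2[of 0]] by simp
  have coef: "fcoef F m = a m" for m
  proof -
    have "cmod (fcoef F m - a m) \<le> 2 * (1 / 2) ^ k" for k
    proof -
      have "cmod (fcoef F m - fcoef (s k) m) \<le> (\<integral>\<xi>. cmod (F \<xi> - s k \<xi>) \<partial>\<mu>)"
        using cmod_fcoef_le[OF FsL2] by (simp add: fcoef_diff[OF FL2 sL2])
      also have "\<dots> \<le> (1 / 2) ^ k"
        using Fs[of k] by (intro integral_cmod_le FsL2) (simp_all only: quarter, simp)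
      finally have 1: "cmod (fcoef F m - fcoef (s k) m) \<le> (1 / 2) ^ k" .
      have 2: "cmod (fcoef (s k) m - a m) \<le> (1 / 2) ^ k"
      proof (cases "m \<in> S k")
        case True
        then show ?thesis
          by (simp add: s_def fcoef_trig[OF S(1)])
      next
        case False
        \<comment> \<open>A coefficient outside \<open>S k\<close> belongs to the tail, so its
          square is at most \<open>(1 / 4) ^ k\<close>.\<close>
        have "(cmod (a m))\<^sup>2 + (\<Sum>n\<in>S k. (cmod (a n))\<^sup>2) \<le> ?t"
          using ell2_finite_sum_le[OF a, of "insert m (S k)"] False S(1) by simp
        then have "(cmod (a m))\<^sup>2 \<le> ((1 / 2) ^ k)\<^sup>2"
          using S(3)[of k] unfolding quarter by linarith
        then have "cmod (a m) \<le> (1 / 2) ^ k"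
          by (rule power2_le_imp_le) simp
        then show ?thesis
          using False by (simp add: s_def fcoef_trig[OF S(1)])
      qed
      show ?thesis
        using norm_triangle_ineq[of "fcoef F m - fcoef (s k) m" "fcoef (s k) m - a m"] 1 2 by simp
    qed
    then have "cmod (fcoef F m - a m) \<le> 2 * 0"
      by (intro LIMSEQ_le_const[OF tendsto_mult_left[OF half]]) auto
    then show ?thesis
      by simp
  qed
  have "\<bar>(\<integral>\<xi>. (cmod (F \<xi>))\<^sup>2 \<partial>\<mu>) - ?t\<bar> \<le> (1 / 4) ^ k" for k
  proof -
    have "(\<integral>\<xi>. (cmod (F \<xi> - s k \<xi>))\<^sup>2 \<partial>\<mu>) = (\<integral>\<xi>. (cmod (F \<xi>))\<^sup>2 \<partial>\<mu>) - (\<Sum>n\<in>S k. (cmod (a n))\<^sup>2)"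
      unfolding s_def using integral_diff_trig_squared[OF FL2 S(1), of k a] by (simp add: coef)
    moreover have "0 \<le> (\<integral>\<xi>. (cmod (F \<xi> - s k \<xi>))\<^sup>2 \<partial>\<mu>)"
      by simp
    ultimately show ?thesis
      using Fs[of k] S(3)[of k] le_t[of k] by linarith
  qed
  moreover have "(\<lambda>k. (1 / 4 :: real) ^ k) \<longlonglongrightarrow> 0"
    by (rule LIMSEQ_realpow_zero) auto
  ultimately have "\<bar>(\<integral>\<xi>. (cmod (F \<xi>))\<^sup>2 \<partial>\<mu>) - ?t\<bar> \<le> 0"
    by (intro LIMSEQ_le_const) auto
  then show ?thesis
    using that[OF FL2] coef by auto
qed

section \<open>Completeness of the characters\<close>

text \<open>Equality is required on the dual group only: there characters are multiplicative and
  equal 1 at 0, which makes the class an algebra with constants.\<close>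

definition trigonometric :: "(('n \<Rightarrow> complex) \<Rightarrow> complex) \<Rightarrow> bool" where
  "trigonometric p \<longleftrightarrow> (\<exists>S c. finite S \<and> (\<forall>\<xi>\<in>dual_group. p \<xi> = (\<Sum>n\<in>S. c n * \<xi> n)))"

lemma trigonometric_monom: "trigonometric (\<lambda>\<xi>. c * \<xi> n)"
  unfolding trigonometric_def by (intro exI[of _ "{n}"] exI[of _ "\<lambda>_. c"]) simp

lemma trigonometric_const: "trigonometric (\<lambda>\<xi>. c)"
  unfolding trigonometric_def
  by (intro exI[of _ "{0}"] exI[of _ "\<lambda>_. c"]) (simp add: eval_simps(3) flip: space_mu)

lemma trigonometric_add:
  assumes "trigonometric p" "trigonometric q"
  shows "trigonometric (\<lambda>\<xi>. p \<xi> + q \<xi>)"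
proof -
  obtain S c where S: "finite S" "\<And>\<xi>. \<xi> \<in> dual_group \<Longrightarrow> p \<xi> = (\<Sum>n\<in>S. c n * \<xi> n)"
    using assms(1) unfolding trigonometric_def by blast
  obtain T d where T: "finite T" "\<And>\<xi>. \<xi> \<in> dual_group \<Longrightarrow> q \<xi> = (\<Sum>n\<in>T. d n * \<xi> n)"
    using assms(2) unfolding trigonometric_def by blast
  have "p \<xi> + q \<xi> = (\<Sum>n\<in>S \<union> T. ((if n \<in> S then c n else 0) + (if n \<in> T then d n else 0)) * \<xi> n)"
    if "\<xi> \<in> dual_group" for \<xi>
  proof -
    have "(\<Sum>n\<in>S. c n * \<xi> n) = (\<Sum>n\<in>S \<union> T. (if n \<in> S then c n else 0) * \<xi> n)"
      using S(1) T(1) by (intro sum.mono_neutral_cong_left) auto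
    moreover have "(\<Sum>n\<in>T. d n * \<xi> n) = (\<Sum>n\<in>S \<union> T. (if n \<in> T then d n else 0) * \<xi> n)"
      using S(1) T(1) by (intro sum.mono_neutral_cong_left) auto
    ultimately show ?thesis
      using S(2) T(2) that by (simp add: distrib_right sum.distrib)
  qed
  then show ?thesis
    using S(1) T(1) unfolding trigonometric_def
    by (intro exI[of _ "S \<union> T"] exI[of _ "\<lambda>n. (if n \<in> S then c n else 0) + (if n \<in> T then d n else 0)"]) auto
qed

lemma trigonometric_cong:
  "trigonometric p \<Longrightarrow> (\<And>\<xi>. \<xi> \<in> dual_group \<Longrightarrow> q \<xi> = p \<xi>) \<Longrightarrow> trigonometric q"
  by (simp add: trigonometric_def)

lemma trigonometric_sum:
  "finite I \<Longrightarrow> (\<And>i. i \<in> I \<Longrightarrow> trigonometric (p i)) \<Longrightarrow> trigonometric (\<lambda>\<xi>. \<Sum>i\<in>I. p i \<xi>)"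
  by (induction I rule: finite_induct) (auto intro: trigonometric_const trigonometric_add)

lemma trigonometric_mult:
  assumes "trigonometric p" "trigonometric q"
  shows "trigonometric (\<lambda>\<xi>. p \<xi> * q \<xi>)"
proof -
  obtain S c where S: "finite S" "\<And>\<xi>. \<xi> \<in> dual_group \<Longrightarrow> p \<xi> = (\<Sum>n\<in>S. c n * \<xi> n)"
    using assms(1) unfolding trigonometric_def by blast
  obtain T d where T: "finite T" "\<And>\<xi>. \<xi> \<in> dual_group \<Longrightarrow> q \<xi> = (\<Sum>n\<in>T. d n * \<xi> n)"
    using assms(2) unfolding trigonometric_def by blast
  have "trigonometric (\<lambda>\<xi>. \<Sum>m\<in>S. \<Sum>n\<in>T. (c m * d n) * \<xi> (m + n))"
    using S(1) T(1) by (intro trigonometric_sum trigonometric_monom)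
  then show ?thesis
  proof (rule trigonometric_cong)
    fix \<xi> :: "'n \<Rightarrow> complex"
    assume "\<xi> \<in> dual_group"
    then show "p \<xi> * q \<xi> = (\<Sum>m\<in>S. \<Sum>n\<in>T. (c m * d n) * \<xi> (m + n))"
      using S(2) T(2) by (simp add: sum_product eval_simps(2) mult_ac flip: space_mu)
  qed
qed

text \<open>These are the hypotheses of the real Stone-Weierstrass theorem. Points are separated by
  the real or the imaginary part of a coordinate, which is trigonometric because
  \<open>\<xi> (- n)\<close> is the conjugate of \<open>\<xi> n\<close>.\<close>

lemma function_ring_on_trigonometric:
  "function_ring_on {f. trigonometric (\<lambda>\<xi>. complex_of_real (f \<xi>))} dual_group"
proof
  show "compact (dual_group :: ('n \<Rightarrow> complex) set)"
    by (rule compact_dual_group)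
next
  fix f
  assume "f \<in> {f. trigonometric (\<lambda>\<xi>. complex_of_real (f \<xi>))}"
  then obtain S c where S: "\<And>\<xi>. \<xi> \<in> dual_group \<Longrightarrow> complex_of_real (f \<xi>) = (\<Sum>n\<in>S. c n * \<xi> n)"
    unfolding trigonometric_def by blast
  have "continuous_on dual_group (\<lambda>\<xi>. Re (\<Sum>n\<in>S. c n * \<xi> n))"
    by (intro continuous_intros continuous_on_subset[OF continuous_on_product_coordinates subset_UNIV])
  then show "continuous_on dual_group f"
    by (rule continuous_on_eq) (simp flip: S)
next
  fix \<xi> \<eta> :: "'n \<Rightarrow> complex"
  assume \<xi>\<eta>: "\<xi> \<in> dual_group" "\<eta> \<in> dual_group" "\<xi> \<noteq> \<eta>"
  then obtain n where n: "\<xi> n \<noteq> \<eta> n"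
    by blast
  have "trigonometric (\<lambda>\<xi>. (1 / 2) * \<xi> n + (1 / 2) * \<xi> (- n))"
    by (intro trigonometric_add trigonometric_monom)
  then have Re: "trigonometric (\<lambda>\<xi>. complex_of_real (Re (\<xi> n)))"
    by (rule trigonometric_cong) (auto simp: eval_simps(4) complex_eq_iff simp flip: space_mu)
  have "trigonometric (\<lambda>\<xi>. (- \<i> / 2) * \<xi> n + (\<i> / 2) * \<xi> (- n))"
    by (intro trigonometric_add trigonometric_monom)
  then have Im: "trigonometric (\<lambda>\<xi>. complex_of_real (Im (\<xi> n)))"
    by (rule trigonometric_cong) (auto simp: eval_simps(4) complex_eq_iff simp flip: space_mu)
  show "\<exists>f\<in>{f. trigonometric (\<lambda>\<xi>. complex_of_real (f \<xi>))}. f \<xi> \<noteq> f \<eta>"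
  proof (cases "Re (\<xi> n) = Re (\<eta> n)")
    case True
    then have "Im (\<xi> n) \<noteq> Im (\<eta> n)"
      using n by (simp add: complex_eq_iff)
    then show ?thesis
      using Im by (intro bexI[of _ "\<lambda>\<xi>. Im (\<xi> n)"]) auto
  next
    case False
    then show ?thesis
      using Re by (intro bexI[of _ "\<lambda>\<xi>. Re (\<xi> n)"]) auto
  qed
qed (auto intro: trigonometric_const trigonometric_add trigonometric_mult)

lemma compact_in_sets:
  assumes "compact K" "K \<subseteq> dual_group"
  shows "K \<in> sets \<mu>"
  using assms by (auto simp: sets_mu sets_restrict_space intro!: image_eqI[of _ _ K] borel_closed compact_imp_closed)

lemma inner_regular:
  assumes A: "A \<in> sets \<mu>" and e: "e > 0"
  obtains K where "compact K" "K \<subseteq> A" "K \<in> sets \<mu>" "measure \<mu> (A - K) < e"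
proof -
  have AK: "K \<in> sets \<mu>" if "compact K" "K \<subseteq> A" for K
    using that sets.sets_into_space[OF A] compact_in_sets by (auto simp: space_mu)
  have "\<exists>K. compact K \<and> K \<subseteq> A \<and> measure \<mu> A - e < measure \<mu> K"
  proof (rule ccontr)
    assume *: "\<not> ?thesis"
    \<comment> \<open>The empty set is a compact subset, so the supposed bound is nonnegative and
      can be compared in \<open>ennreal\<close>.\<close>
    then have "measure \<mu> ({} :: ('n \<Rightarrow> complex) set) \<le> measure \<mu> A - e"
      by (metis compact_empty empty_subsetI linorder_not_less)
    then have pos: "0 \<le> measure \<mu> A - e"
      by simp
    have "emeasure \<mu> A = (SUP K\<in>{K. compact K \<and> K \<subseteq> A}. emeasure \<mu> K)"
      using haar A unfolding dual_haar_measure_def by blast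
    also have "\<dots> \<le> ennreal (measure \<mu> A - e)"
      using * by (intro SUP_least) (auto simp: emeasure_eq_measure not_less intro!: ennreal_leI)
    finally show False
      using pos e by (simp add: emeasure_eq_measure)
  qed
  then obtain K where K: "compact K" "K \<subseteq> A" "measure \<mu> A - e < measure \<mu> K"
    by blast
  then have "measure \<mu> (A - K) < e"
    using finite_measure_Diff[OF A AK[OF K(1,2)] K(2)] by simp
  then show ?thesis
    using that K AK by blast
qed

text \<open>\<open>A\<close> and its complement are exhausted by compact sets \<open>K\<close> and
  \<open>L\<close> up to measure \<open>e\<close>. Stone-Weierstrass supplies a function that is
  almost 1 on \<open>K\<close> and almost 0 on \<open>L\<close>; this gives convergence in L1, and a
  subsequence converges almost everywhere.\<close>

lemma indicator_approximation:
  assumes A: "A \<in> sets \<mu>"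
  shows "\<exists>f :: nat \<Rightarrow> ('n \<Rightarrow> complex) \<Rightarrow> real. (\<forall>k. trigonometric (\<lambda>\<xi>. complex_of_real (f k \<xi>))) \<and>
    (\<forall>k. f k \<in> borel_measurable \<mu>) \<and> (\<forall>k. \<forall>\<xi>\<in>dual_group. 0 \<le> f k \<xi> \<and> f k \<xi> \<le> 1) \<and>
    (AE \<xi> in \<mu>. (\<lambda>k. f k \<xi>) \<longlonglongrightarrow> indicator A \<xi>)"
proof -
  define R where "R = {f. trigonometric (\<lambda>\<xi>. complex_of_real (f \<xi>))}"
  interpret function_ring_on R dual_group
    unfolding R_def by (rule function_ring_on_trigonometric)
  have R_meas: "f \<in> borel_measurable \<mu>" if f: "f \<in> R" for f
  proof -
    obtain S c where S: "\<And>\<xi>. \<xi> \<in> dual_group \<Longrightarrow> complex_of_real (f \<xi>) = (\<Sum>n\<in>S. c n * \<xi> n)"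
      using f unfolding R_def trigonometric_def by blast
    have "(\<lambda>\<xi>. Re (\<Sum>n\<in>S. c n * \<xi> n)) \<in> borel_measurable \<mu>"
      by measurable
    then show ?thesis
      by (rule measurable_cong[THEN iffD1, rotated]) (simp add: space_mu flip: S)
  qed
  have sub: "A \<subseteq> dual_group"
    using sets.sets_into_space[OF A] by (simp add: space_mu)
  have approx: "\<exists>f\<in>R. f ` dual_group \<subseteq> {0..1} \<and> (\<integral>\<xi>. norm (f \<xi> - indicator A \<xi>) \<partial>\<mu>) \<le> 3 * e" if e: "0 < e" "e < 1" for e
  proof -
    obtain K where K: "compact K" "K \<subseteq> A" "K \<in> sets \<mu>" "measure \<mu> (A - K) < e"
      using inner_regular[OF A e(1)] by blast
    have "dual_group - A \<in> sets \<mu>"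
      using sets.compl_sets[OF A] by (simp add: space_mu)
    then obtain L where L: "compact L" "L \<subseteq> dual_group - A" "L \<in> sets \<mu>" "measure \<mu> (dual_group - A - L) < e"
      using inner_regular[OF _ e(1)] by blast
    have "closed L" "L \<subseteq> dual_group" "closed K" "K \<subseteq> dual_group" "L \<inter> K = {}"
      using K L sub by (auto intro: compact_imp_closed)
    from two[OF this e] obtain f where f: "f \<in> R" "f ` dual_group \<subseteq> {0..1}"
      "\<And>\<xi>. \<xi> \<in> L \<Longrightarrow> f \<xi> < e" "\<And>\<xi>. \<xi> \<in> K \<Longrightarrow> f \<xi> > 1 - e"
      by blast
    note [measurable] = R_meas[OF f(1)] A K(3) L(3)
    have b: "0 \<le> f \<xi>" "f \<xi> \<le> 1" if "\<xi> \<in> dual_group" for \<xi>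
      using f(2) that by auto
    \<comment> \<open>On \<open>K\<close> and \<open>L\<close> the error is below \<open>e\<close>;
      elsewhere it is at most 1, since both functions take values between 0 and 1. The two remaining
      sets have measure below \<open>e\<close> each, which adds up to \<open>3 * e\<close>.\<close>
    have bound: "norm (f \<xi> - indicator A \<xi>) \<le> e + indicator (A - K) \<xi> + indicator (dual_group - A - L) \<xi>"
      if "\<xi> \<in> dual_group" for \<xi>
      using f(3,4)[of \<xi>] b[OF that] K(2) L(2) that e by (auto simp: indicator_def abs_if)
    have meas: "A - K \<in> sets \<mu>" "dual_group - A - L \<in> sets \<mu>"
      using \<open>dual_group - A \<in> sets \<mu>\<close> A K(3) L(3) by auto
    have "(\<integral>\<xi>. norm (f \<xi> - indicator A \<xi>) \<partial>\<mu>) \<le>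
        (\<integral>\<xi>. e + indicator (A - K) \<xi> + indicator (dual_group - A - L) \<xi> \<partial>\<mu>)"
    proof (rule integral_mono)
      show "integrable \<mu> (\<lambda>\<xi>. norm (f \<xi> - indicator A \<xi>))"
      proof (rule integrable_const_bound[where B = 1])
        show "AE \<xi> in \<mu>. norm (norm (f \<xi> - indicator A \<xi>)) \<le> 1"
        proof (rule AE_I2)
          fix \<xi>
          assume "\<xi> \<in> space \<mu>"
          then show "norm (norm (f \<xi> - indicator A \<xi>)) \<le> 1"
            using b[of \<xi>] by (cases "\<xi> \<in> A") (auto simp: space_mu)
        qed
      qed measurable
      show "integrable \<mu> (\<lambda>\<xi>. e + indicator (A - K) \<xi> + indicator (dual_group - A - L) \<xi>)"
        using meas by (intro Bochner_Integration.integrable_add) (auto simp: emeasure_eq_measure)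
    qed (use bound in \<open>simp add: space_mu\<close>)
    also have "\<dots> = e + measure \<mu> (A - K) + measure \<mu> (dual_group - A - L)"
    proof -
      have "integrable \<mu> (\<lambda>\<xi>. e)" "integrable \<mu> (indicator (A - K) :: _ \<Rightarrow> real)"
        "integrable \<mu> (indicator (dual_group - A - L) :: _ \<Rightarrow> real)"
        using meas by (auto simp: emeasure_eq_measure)
      then show ?thesis
        using meas sets.sets_into_space by (simp add: prob_space Int_absorb2)
    qed
    also have "\<dots> \<le> 3 * e"
      using K(4) L(4) by simp
    finally show ?thesis
      using f(1,2) by blast
  qed
  \<comment> \<open>The shift by 2 keeps the tolerance strictly below 1, as \<open>approx\<close>
    demands, also for \<open>k = 0\<close>.\<close>
  have "\<exists>f\<in>R. f ` dual_group \<subseteq> {0..1} \<and>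
      (\<integral>\<xi>. norm (f \<xi> - indicator A \<xi>) \<partial>\<mu>) \<le> 3 * (1 / real (k + 2))" for k
    by (rule approx) auto
  then obtain f where f: "\<And>k. f k \<in> R" "\<And>k. f k ` dual_group \<subseteq> {0..1}"
    "\<And>k. (\<integral>\<xi>. norm (f k \<xi> - indicator A \<xi>) \<partial>\<mu>) \<le> 3 * (1 / real (k + 2))"
    by metis
  note [measurable] = R_meas[OF f(1)] A
  have b: "0 \<le> f k \<xi> \<and> f k \<xi> \<le> 1" if "\<xi> \<in> dual_group" for k \<xi>
    using f(2)[of k] that by auto
  have "\<exists>r. strict_mono r \<and> (AE \<xi> in \<mu>. (\<lambda>k. f (r k) \<xi> - indicator A \<xi>) \<longlonglongrightarrow> 0)"
  proof (rule tendsto_L1_AE_subseq)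
    show "integrable \<mu> (\<lambda>\<xi>. f k \<xi> - indicator A \<xi>)" for k
    proof (rule integrable_const_bound[where B = 1])
      show "AE \<xi> in \<mu>. norm (f k \<xi> - indicator A \<xi>) \<le> 1"
      proof (rule AE_I2)
        fix \<xi>
        assume "\<xi> \<in> space \<mu>"
        then show "norm (f k \<xi> - indicator A \<xi>) \<le> 1"
          using b[of \<xi> k] by (cases "\<xi> \<in> A") (auto simp: space_mu)
      qed
    qed measurable
    have "(\<lambda>k. 3 * (1 / real (k + 2))) \<longlonglongrightarrow> 3 * 0"
      by (intro tendsto_intros LIMSEQ_ignore_initial_segment[where f = "\<lambda>k. 1 / real k"] lim_1_over_n)
    then have null: "(\<lambda>k. 3 * (1 / real (k + 2))) \<longlonglongrightarrow> 0"
      by (simp only: mult_zero_right)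
    show "(\<lambda>k. \<integral>\<xi>. norm (f k \<xi> - indicator A \<xi>) \<partial>\<mu>) \<longlonglongrightarrow> 0"
    proof (rule Lim_null_comparison[OF always_eventually null], rule allI)
      fix k
      have "0 \<le> (\<integral>\<xi>. norm (f k \<xi> - indicator A \<xi>) \<partial>\<mu>)"
        by (rule integral_nonneg_AE) simp
      then show "norm (\<integral>\<xi>. norm (f k \<xi> - indicator A \<xi>) \<partial>\<mu>) \<le> 3 * (1 / real (k + 2))"
        using f(3)[of k] by (simp only: real_norm_def abs_of_nonneg)
    qed
  qed
  then obtain r where r: "AE \<xi> in \<mu>. (\<lambda>k. f (r k) \<xi> - indicator A \<xi>) \<longlonglongrightarrow> 0"
    by blast
  show ?thesis
  proof (intro exI[of _ "\<lambda>k. f (r k)"] conjI allI ballI)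
    show "AE \<xi> in \<mu>. (\<lambda>k. f (r k) \<xi>) \<longlonglongrightarrow> indicator A \<xi>"
      using r by eventually_elim (rule LIM_zero_cancel)
  qed (use f(1) b R_meas in \<open>auto simp: R_def\<close>)
qed

text \<open>\<open>F\<close> is orthogonal to all trigonometric polynomials. By dominated
  convergence along \<open>indicator_approximation\<close> its integral over every measurable set
  vanishes.\<close>

lemma fcoef_eq_0_imp_AE_0:
  assumes F: "F \<in> L2_space \<mu>" and 0: "\<And>m. fcoef F m = 0"
  shows "AE \<xi> in \<mu>. F \<xi> = 0"
proof (rule density_unique_banach)
  note [measurable] = L2_spaceD(1)[OF F]
  show "integrable \<mu> F"
    by (rule L2_space_integrable[OF F])
  fix A
  assume A[measurable]: "A \<in> sets \<mu>"
  obtain f :: "nat \<Rightarrow> ('n \<Rightarrow> complex) \<Rightarrow> real"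
    where f: "\<forall>k. trigonometric (\<lambda>\<xi>. complex_of_real (f k \<xi>))" and meas: "\<forall>k. f k \<in> borel_measurable \<mu>"
    and b: "\<forall>k. \<forall>\<xi>\<in>dual_group. 0 \<le> f k \<xi> \<and> f k \<xi> \<le> 1"
    and lim: "AE \<xi> in \<mu>. (\<lambda>k. f k \<xi>) \<longlonglongrightarrow> indicator A \<xi>"
    using indicator_approximation[OF A] by (elim exE conjE)
  have [measurable]: "f k \<in> borel_measurable \<mu>" for k
    using meas by blast
  have "(\<integral>\<xi>. f k \<xi> *\<^sub>R F \<xi> \<partial>\<mu>) = 0" for k
  proof -
    obtain S c where S: "\<And>\<xi>. \<xi> \<in> dual_group \<Longrightarrow> complex_of_real (f k \<xi>) = (\<Sum>n\<in>S. c n * \<xi> n)"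
      using f unfolding trigonometric_def by blast
    have "(\<integral>\<xi>. f k \<xi> *\<^sub>R F \<xi> \<partial>\<mu>) = (\<integral>\<xi>. (\<Sum>n\<in>S. c n * (F \<xi> * \<xi> n)) \<partial>\<mu>)"
      by (intro Bochner_Integration.integral_cong)
        (auto simp: scaleR_conv_of_real space_mu S sum_distrib_left mult_ac)
    also have "\<dots> = (\<Sum>n\<in>S. \<integral>\<xi>. c n * (F \<xi> * \<xi> n) \<partial>\<mu>)"
      by (intro Bochner_Integration.integral_sum integrable_mult_right L2_space_integrable_mult F L2_space_eval)
    also have "\<dots> = (\<Sum>n\<in>S. c n * fcoef F n)"
      by (simp add: fcoef_def)
    finally show ?thesis
      by (simp add: 0)
  qed
  moreover have "(\<lambda>k. \<integral>\<xi>. f k \<xi> *\<^sub>R F \<xi> \<partial>\<mu>) \<longlonglongrightarrow> (\<integral>\<xi>. indicator A \<xi> *\<^sub>R F \<xi> \<partial>\<mu>)"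
  proof (rule integral_dominated_convergence)
    show "integrable \<mu> (\<lambda>\<xi>. cmod (F \<xi>))"
      using L2_space_integrable[OF F] by simp
    show "AE \<xi> in \<mu>. (\<lambda>k. f k \<xi> *\<^sub>R F \<xi>) \<longlonglongrightarrow> indicator A \<xi> *\<^sub>R F \<xi>"
      using lim by eventually_elim (intro tendsto_intros)
    show "AE \<xi> in \<mu>. norm (f k \<xi> *\<^sub>R F \<xi>) \<le> cmod (F \<xi>)" for k
      using b by (intro AE_I2) (auto simp: space_mu mult_left_le_one_le)
  qed measurable
  ultimately have "(\<integral>\<xi>. indicator A \<xi> *\<^sub>R F \<xi> \<partial>\<mu>) = 0"
    by (simp add: LIMSEQ_const_iff)
  then show "set_lebesgue_integral \<mu> A F = set_lebesgue_integral \<mu> A (\<lambda>\<xi>. 0)"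
    by (simp add: set_lebesgue_integral_def)
qed simp

lemma fcoef_inject:
  assumes F: "F \<in> L2_space \<mu>" and G: "G \<in> L2_space \<mu>" and eq: "\<And>m. fcoef F m = fcoef G m"
  shows "AE \<xi> in \<mu>. F \<xi> = G \<xi>"
  using fcoef_eq_0_imp_AE_0[OF L2_space_diff[OF F G]] by (simp add: fcoef_diff[OF F G] eq)

text \<open>The Riesz-Fischer function with the coefficients of \<open>F\<close> has the right norm,
  and completeness identifies it with \<open>F\<close>.\<close>

lemma parseval_norm:
  assumes F: "F \<in> L2_space \<mu>"
  shows "(\<integral>\<xi>. (cmod (F \<xi>))\<^sup>2 \<partial>\<mu>) = (\<Sum>\<^sub>\<infinity>n. (cmod (fcoef F n))\<^sup>2)"
proof -
  obtain G where G: "G \<in> L2_space \<mu>" "fcoef G = fcoef F"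
    "(\<integral>\<xi>. (cmod (G \<xi>))\<^sup>2 \<partial>\<mu>) = (\<Sum>\<^sub>\<infinity>n. (cmod (fcoef F n))\<^sup>2)"
    using riesz_fischer[OF fcoef_ell2[OF F]] by metis
  note [measurable] = L2_spaceD(1)[OF F] L2_spaceD(1)[OF G(1)]
  have "AE \<xi> in \<mu>. F \<xi> = G \<xi>"
    using G by (intro fcoef_inject F) auto
  then have "(\<integral>\<xi>. (cmod (F \<xi>))\<^sup>2 \<partial>\<mu>) = (\<integral>\<xi>. (cmod (G \<xi>))\<^sup>2 \<partial>\<mu>)"
    by (intro integral_cong_AE) auto
  then show ?thesis
    using G(3) by simp
qed


lemma parseval:
  assumes F: "F \<in> L2_space \<mu>" and G: "G \<in> L2_space \<mu>"
  shows "((\<lambda>n. fcoef F n * cnj (fcoef G n)) has_sum (\<integral>\<xi>. F \<xi> * cnj (G \<xi>) \<partial>\<mu>)) UNIV"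
proof -
  \<comment> \<open>Polarization identity. The factors 1 and -1 are written out so that all four
    squares are instances of one expression in \<open>c\<close>.\<close>
  define q where "q z w = (complex_of_real ((cmod (z + 1 * w))\<^sup>2) - complex_of_real ((cmod (z + (- 1) * w))\<^sup>2)
    + \<i> * complex_of_real ((cmod (z + \<i> * w))\<^sup>2) - \<i> * complex_of_real ((cmod (z + (- \<i>) * w))\<^sup>2)) / 4" for z w
  have q: "z * cnj w = q z w" for z w
    by (simp add: q_def complex_eq_iff cmod_power2) (simp add: power2_eq_square algebra_simps)
  have FG: "(\<lambda>\<xi>. F \<xi> + c * G \<xi>) \<in> L2_space \<mu>" for c
    by (intro L2_space_add F L2_space_cmult G)
  define N where "N c = complex_of_real (\<integral>\<xi>. (cmod (F \<xi> + c * G \<xi>))\<^sup>2 \<partial>\<mu>)" for c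
  have sum: "((\<lambda>n. complex_of_real ((cmod (fcoef F n + c * fcoef G n))\<^sup>2)) has_sum N c) UNIV" for c
  proof -
    have "((\<lambda>n. (cmod (fcoef F n + c * fcoef G n))\<^sup>2) has_sum (\<integral>\<xi>. (cmod (F \<xi> + c * G \<xi>))\<^sup>2 \<partial>\<mu>)) UNIV"
      using ell2_has_sum[OF fcoef_ell2[OF FG, of c]]
      by (simp add: parseval_norm[OF FG] fcoef_add[OF F L2_space_cmult[OF G]] fcoef_cmult)
    then show ?thesis
      unfolding N_def by (rule has_sum_of_real)
  qed
  have int: "has_bochner_integral \<mu> (\<lambda>\<xi>. complex_of_real ((cmod (F \<xi> + c * G \<xi>))\<^sup>2)) (N c)" for c
    unfolding N_def using L2_spaceD(2)[OF FG, of c]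
    by (intro has_bochner_integral_of_real has_bochner_integral_integrable)
  have "((\<lambda>n. q (fcoef F n) (fcoef G n)) has_sum ((N 1 - N (- 1) + \<i> * N \<i> - \<i> * N (- \<i>)) / 4)) UNIV"
    unfolding q_def by (intro has_sum_divide_const has_sum_diff has_sum_add has_sum_cmult_right sum)
  moreover have "has_bochner_integral \<mu> (\<lambda>\<xi>. q (F \<xi>) (G \<xi>)) ((N 1 - N (- 1) + \<i> * N \<i> - \<i> * N (- \<i>)) / 4)"
    unfolding q_def by (intro has_bochner_integral_divide_zero has_bochner_integral_diff has_bochner_integral_add
        has_bochner_integral_mult_right int)
  ultimately show ?thesis
    by (simp add: q has_bochner_integral_integral_eq)
qed

section \<open>The Fourier transform on square summable functions\<close>

text \<open>Weierstrass M-test. The prescribed set \<open>S\<close> keeps chosen coefficients in the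
  approximating sum; \<open>fcoef_fourier_ell1\<close> uses a singleton.\<close>

lemma fourier_ell1_approx:
  assumes b: "b \<in> ell1" and S: "finite S" and e: "e > 0"
  obtains T where "finite T" "S \<subseteq> T" "\<And>\<xi>. \<xi> \<in> dual_group \<Longrightarrow> cmod (fourier_ell1 b \<xi> - trig T b \<xi>) < e"
proof -
  have "uniform_limit dual_group (\<lambda>X \<xi>. \<Sum>n\<in>X. b n * \<xi> (- n)) (\<lambda>\<xi>. \<Sum>\<^sub>\<infinity>n. b n * \<xi> (- n))
      (finite_subsets_at_top UNIV)"
    using b by (intro Weierstrass_m_test_general[where M = "\<lambda>n. cmod (b n)"])
      (auto simp: ell1_def norm_mult eval_simps(1) simp flip: space_mu)
  from uniform_limitD[OF this e] obtain X where X: "finite X"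
    "\<And>Y. finite Y \<Longrightarrow> X \<subseteq> Y \<Longrightarrow> \<forall>\<xi>\<in>dual_group. dist (\<Sum>n\<in>Y. b n * \<xi> (- n)) (\<Sum>\<^sub>\<infinity>n. b n * \<xi> (- n)) < e"
    unfolding eventually_finite_subsets_at_top by auto
  have "\<forall>\<xi>\<in>dual_group. dist (\<Sum>n\<in>S \<union> X. b n * \<xi> (- n)) (\<Sum>\<^sub>\<infinity>n. b n * \<xi> (- n)) < e"
    using S X by auto
  then show ?thesis
    using that[of "S \<union> X"] S X(1) by (auto simp: fourier_ell1_def trig_def dist_norm norm_minus_commute)
qed

lemma fourier_ell1_L2:
  assumes b: "b \<in> ell1"
  shows "fourier_ell1 b \<in> L2_space \<mu>"
proof -
  have "\<exists>T. finite T \<and> (\<forall>\<xi>\<in>dual_group. cmod (fourier_ell1 b \<xi> - trig T b \<xi>) < 1 / real (Suc k))" for k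
    by (rule fourier_ell1_approx[OF b finite.emptyI, of "1 / real (Suc k)"]) auto
  then obtain T where T: "\<forall>k. finite (T k) \<and> (\<forall>\<xi>\<in>dual_group. cmod (fourier_ell1 b \<xi> - trig (T k) b \<xi>) < 1 / real (Suc k))"
    by metis
  have meas: "fourier_ell1 b \<in> borel_measurable \<mu>"
  proof (rule borel_measurable_LIMSEQ_metric)
    show "trig (T k) b \<in> borel_measurable \<mu>" for k
      by (rule L2_spaceD(1)[OF L2_space_trig])
    fix \<xi>
    assume "\<xi> \<in> space \<mu>"
    then have "norm (trig (T k) b \<xi> - fourier_ell1 b \<xi>) \<le> 1 / real (Suc k)" for k
      using T by (simp add: space_mu norm_minus_commute less_imp_le)
    then have "(\<lambda>k. trig (T k) b \<xi> - fourier_ell1 b \<xi>) \<longlonglongrightarrow> 0"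
      by (intro Lim_null_comparison[OF always_eventually LIMSEQ_Suc[OF lim_1_over_n]]) simp
    then show "(\<lambda>k. trig (T k) b \<xi>) \<longlonglongrightarrow> fourier_ell1 b \<xi>"
      by (rule LIM_zero_cancel)
  qed
  have "cmod (fourier_ell1 b \<xi>) \<le> (\<Sum>\<^sub>\<infinity>n. cmod (b n))" if "\<xi> \<in> space \<mu>" for \<xi>
    unfolding fourier_ell1_def using b that
    by (intro order_trans[OF norm_infsum_bound]) (auto simp: ell1_def norm_mult eval_simps(1))
  then show ?thesis
    by (intro L2_space_bounded[OF meas] AE_I2)
qed

lemma fcoef_fourier_ell1:
  assumes b: "b \<in> ell1"
  shows "fcoef (fourier_ell1 b) m = b m"
proof -
  have "cmod (fcoef (fourier_ell1 b) m - b m) \<le> e" if e: "e > 0" for e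
  proof (rule fourier_ell1_approx[OF b, of "{m}" e])
    fix T
    assume T: "finite T" "{m} \<subseteq> T" "\<And>\<xi>. \<xi> \<in> dual_group \<Longrightarrow> cmod (fourier_ell1 b \<xi> - trig T b \<xi>) < e"
    have L2: "(\<lambda>\<xi>. fourier_ell1 b \<xi> - trig T b \<xi>) \<in> L2_space \<mu>"
      by (intro L2_space_diff fourier_ell1_L2[OF b] L2_space_trig)
    have "cmod (fcoef (fourier_ell1 b) m - b m) = cmod (fcoef (\<lambda>\<xi>. fourier_ell1 b \<xi> - trig T b \<xi>) m)"
      using T(1,2) by (simp add: fcoef_diff[OF fourier_ell1_L2[OF b] L2_space_trig] fcoef_trig)
    also have "\<dots> \<le> (\<integral>\<xi>. cmod (fourier_ell1 b \<xi> - trig T b \<xi>) \<partial>\<mu>)"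
      by (rule cmod_fcoef_le[OF L2])
    also have "\<dots> \<le> (\<integral>\<xi>. e \<partial>\<mu>)"
      using L2_space_integrable[OF L2] T(3) by (intro integral_mono) (auto simp: space_mu less_imp_le)
    also have "\<dots> = e"
      by (simp add: prob_space)
    finally show ?thesis .
  qed (use e in auto)
  then have "cmod (fcoef (fourier_ell1 b) m - b m) \<le> 0"
    by (rule field_le_epsilon[where y = 0, simplified])
  then show ?thesis
    by simp
qed

text \<open>By this isometry a function with coefficients \<open>a\<close> satisfies the condition
  in the definition of \<open>fourier\<close>, with \<delta> equal to \<epsilon>.\<close>

lemma L2_norm_fourier_ell1_diff:
  assumes b: "b \<in> ell1" and F: "F \<in> L2_space \<mu>"
  shows "L2_norm \<mu> (\<lambda>\<xi>. fourier_ell1 b \<xi> - F \<xi>) = ell2_norm (\<lambda>n. b n - fcoef F n)"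
  unfolding L2_norm_def ell2_norm_def
  by (subst parseval_norm[OF L2_space_diff[OF fourier_ell1_L2[OF b] F]])
    (simp add: fcoef_diff[OF fourier_ell1_L2[OF b] F] fcoef_fourier_ell1[OF b])

lemma ell2_norm_truncate:
  fixes a :: "'i \<Rightarrow> complex"
  assumes a: "a \<in> ell2" and e: "e > 0"
  obtains S where "finite S" "ell2_norm (\<lambda>n. (if n \<in> S then a n else 0) - a n) < e"
proof -
  let ?t = "\<Sum>\<^sub>\<infinity>n. (cmod (a n))\<^sup>2"
  obtain S where S: "finite S" "dist (\<Sum>i\<in>S. (cmod (a i))\<^sup>2) ?t \<le> e\<^sup>2 / 2"
    using has_sum_finite_approximation[OF ell2_has_sum[OF a], of "e\<^sup>2 / 2"] e by auto
  have "((\<lambda>n. (cmod (a n))\<^sup>2 - (if n \<in> S then (cmod (a n))\<^sup>2 else 0)) has_sum (?t - (\<Sum>i\<in>S. (cmod (a i))\<^sup>2))) UNIV"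
    by (intro has_sum_diff ell2_has_sum[OF a] has_sum_finite_neutralI[OF S(1)]) auto
  then have "((\<lambda>n. (cmod ((if n \<in> S then a n else 0) - a n))\<^sup>2) has_sum (?t - (\<Sum>i\<in>S. (cmod (a i))\<^sup>2))) UNIV"
    by (rule has_sum_cong[THEN iffD1, rotated]) auto
  then have "(\<Sum>\<^sub>\<infinity>n. (cmod ((if n \<in> S then a n else 0) - a n))\<^sup>2) = ?t - (\<Sum>i\<in>S. (cmod (a i))\<^sup>2)"
    by (rule infsumI)
  also have "\<dots> \<le> e\<^sup>2 / 2"
    using S(2) unfolding dist_real_def by linarith
  also have "\<dots> < e\<^sup>2"
    using e by simp
  finally have "ell2_norm (\<lambda>n. (if n \<in> S then a n else 0) - a n) < e"
    unfolding ell2_norm_def using e by (intro real_less_lsqrt) (auto intro: infsum_nonneg)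
  then show ?thesis
    using that S(1) by blast
qed

text \<open>The choice made by \<open>fourier\<close> needs two arguments: the Riesz-Fischer
  function has the defining property, and any function with that property has the coefficients
  \<open>a\<close>, by comparison with finite truncations of \<open>a\<close>.\<close>

theorem fourier_L2:
  assumes a: "a \<in> ell2"
  shows "fourier \<mu> a \<in> L2_space \<mu>" "fcoef (fourier \<mu> a) = a"
proof -
  define P where "P F \<longleftrightarrow> F \<in> L2_space \<mu> \<and>
     (\<forall>\<epsilon>>0. \<exists>\<delta>>0. \<forall>b\<in>ell1. ell2_norm (\<lambda>n. b n - a n) < \<delta> \<longrightarrow>
        L2_norm \<mu> (\<lambda>\<xi>. fourier_ell1 b \<xi> - F \<xi>) < \<epsilon>)" for F
  obtain F where F: "F \<in> L2_space \<mu>" "fcoef F = a"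
    using riesz_fischer[OF a] by metis
  have norm_F: "L2_norm \<mu> (\<lambda>\<xi>. fourier_ell1 b \<xi> - F \<xi>) = ell2_norm (\<lambda>n. b n - a n)" if "b \<in> ell1" for b
    using L2_norm_fourier_ell1_diff[OF that F(1)] by (simp add: F(2))
  have "P F"
    unfolding P_def using F(1) norm_F by auto
  then have "P (fourier \<mu> a)"
    unfolding fourier_def P_def[symmetric] by (rule someI[of P])
  then show G: "fourier \<mu> a \<in> L2_space \<mu>"
    by (simp add: P_def)
  let ?G = "fourier \<mu> a"
  show "fcoef ?G = a"
  proof
    fix m
    have "cmod (fcoef ?G m - a m) \<le> e" if e: "e > 0" for e
    proof -
      obtain d where d: "d > 0" "\<And>b. b \<in> ell1 \<Longrightarrow> ell2_norm (\<lambda>n. b n - a n) < d \<Longrightarrow>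
          L2_norm \<mu> (\<lambda>\<xi>. fourier_ell1 b \<xi> - ?G \<xi>) < e / 2"
        using \<open>P ?G\<close> e unfolding P_def by (metis half_gt_zero)
      \<comment> \<open>The bound \<open>d\<close> brings the transform of the truncation close to
        \<open>?G\<close>, and \<open>e / 2\<close> brings it close to \<open>F\<close>.\<close>
      obtain S where S: "finite S" "ell2_norm (\<lambda>n. (if n \<in> S then a n else 0) - a n) < min d (e / 2)"
        using ell2_norm_truncate[OF a, of "min d (e / 2)"] d(1) e by auto
      define b where "b n = (if n \<in> S then a n else 0)" for n
      have b: "b \<in> ell1"
        unfolding ell1_def using S(1)
        by (auto intro!: finite_nonzero_values_imp_summable_on elim: finite_subset[rotated] simp: b_def)
      have m: "cmod (fcoef H m) \<le> L2_norm \<mu> H" if "H \<in> L2_space \<mu>" for H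
        unfolding L2_norm_def using bessel_fcoef[OF that, of "{m}"] by (intro real_le_rsqrt) simp
      have "cmod (fcoef ?G m - a m) \<le> cmod (b m - fcoef ?G m) + cmod (b m - a m)"
        using norm_triangle_ineq4[of "b m - a m" "b m - fcoef ?G m"] by simp
      also have "cmod (b m - fcoef ?G m) \<le> L2_norm \<mu> (\<lambda>\<xi>. fourier_ell1 b \<xi> - ?G \<xi>)"
        using m[OF L2_space_diff[OF fourier_ell1_L2[OF b] G]]
        by (simp add: fcoef_diff[OF fourier_ell1_L2[OF b] G] fcoef_fourier_ell1[OF b])
      also have "\<dots> \<le> e / 2"
        using d(2)[OF b] S(2) by (simp add: b_def)
      also have "cmod (b m - a m) \<le> L2_norm \<mu> (\<lambda>\<xi>. fourier_ell1 b \<xi> - F \<xi>)"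
        using m[OF L2_space_diff[OF fourier_ell1_L2[OF b] F(1)]]
        by (simp add: fcoef_diff[OF fourier_ell1_L2[OF b] F(1)] fcoef_fourier_ell1[OF b] F(2))
      also have "\<dots> \<le> e / 2"
        using norm_F[OF b] S(2) by (simp add: b_def)
      finally show ?thesis
        by simp
    qed
    then have "cmod (fcoef ?G m - a m) \<le> 0"
      by (rule field_le_epsilon[where y = 0, simplified])
    then show "fcoef ?G m = a m"
      by simp
  qed
qed

lemma AE_fourier_fcoef:
  assumes F: "F \<in> L2_space \<mu>"
  shows "AE \<xi> in \<mu>. fourier \<mu> (fcoef F) \<xi> = F \<xi>"
  using fourier_L2[OF fcoef_ell2[OF F]] by (intro fcoef_inject F) auto

end

section \<open>Square summable families\<close>

lemma ell2_eq_0: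
  assumes "a \<in> ell2" "(\<Sum>\<^sub>\<infinity>i. (cmod (a i))\<^sup>2) \<le> 0"
  shows "a i = 0"
proof -
  have "(\<Sum>i\<in>{i}. (cmod (a i))\<^sup>2) \<le> 0"
    by (rule order_trans[OF ell2_finite_sum_le[OF assms(1)] assms(2)]) simp
  then show ?thesis
    by simp
qed

lemma ell2_bounded_comparison:
  assumes "a \<in> ell2" "b \<in> ell2" "\<And>i. (cmod (c i))\<^sup>2 \<le> s * (cmod (a i))\<^sup>2 + t * (cmod (b i))\<^sup>2"
  shows "c \<in> ell2"
proof -
  have "(\<lambda>i. s * (cmod (a i))\<^sup>2 + t * (cmod (b i))\<^sup>2) summable_on UNIV"
    using assms(1,2) by (intro summable_on_add summable_on_cmult_right) (auto simp: ell2_def)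
  then show ?thesis
    unfolding ell2_def using assms(3) by (auto intro: summable_on_comparison_test)
qed

lemma ell2_add: "a \<in> ell2 \<Longrightarrow> b \<in> ell2 \<Longrightarrow> (\<lambda>i. a i + b i) \<in> ell2"
  by (rule ell2_bounded_comparison[where s = 2 and t = 2 and a = a and b = b]) (auto intro: cmod_add_squared_le)

lemma ell2_cmult: "a \<in> ell2 \<Longrightarrow> (\<lambda>i. c * a i) \<in> ell2"
  by (rule ell2_bounded_comparison[where s = "(cmod c)\<^sup>2" and t = 0 and b = a])
    (auto simp: norm_mult power_mult_distrib)

lemma ell2_diff: "a \<in> ell2 \<Longrightarrow> b \<in> ell2 \<Longrightarrow> (\<lambda>i. a i - b i) \<in> ell2"
  using ell2_add[of a "\<lambda>i. (-1) * b i"] ell2_cmult[of b "-1"] by simp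

lemma ell2_finite_support:
  assumes "finite S" "\<And>i. i \<notin> S \<Longrightarrow> a i = 0"
  shows "a \<in> ell2"
proof -
  have "finite {i. (cmod (a i))\<^sup>2 \<noteq> 0}"
    using assms(2) by (intro finite_subset[OF _ assms(1)]) auto
  then show ?thesis
    by (simp add: ell2_def finite_nonzero_values_imp_summable_on)
qed

lemma infsum_finite_support:
  fixes f :: "'i \<Rightarrow> 'b::{topological_comm_monoid_add,t2_space}"
  assumes "finite S" "\<And>i. i \<notin> S \<Longrightarrow> f i = 0"
  shows "infsum f UNIV = sum f S"
  using assms by (intro infsumI has_sum_finite_neutralI[OF assms(1)]) auto

lemma ell2_sum:
  "finite S \<Longrightarrow> (\<And>j. j \<in> S \<Longrightarrow> a j \<in> ell2) \<Longrightarrow> (\<lambda>i. \<Sum>j\<in>S. a j i) \<in> ell2"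
  by (induction S rule: finite_induct) (auto intro: ell2_add ell2_finite_support)

lemma ell2_reindex:
  assumes "inj g" "a \<in> ell2"
  shows "(\<lambda>i. a (g i)) \<in> ell2"
proof -
  have "(\<lambda>i. (cmod (a i))\<^sup>2) summable_on range g"
    using assms(2) by (auto simp: ell2_def intro: summable_on_subset_banach)
  then show ?thesis
    using assms(1) by (simp add: ell2_def summable_on_reindex o_def)
qed

text \<open>The limit is taken in each coordinate. Distances pass to the limit on finite index sets,
  and \<open>ell2I\<close> turns the uniform bound into one for the full sum.\<close>

lemma ell2_complete:
  fixes a :: "nat \<Rightarrow> 'i \<Rightarrow> complex"
  assumes a: "\<And>k. a k \<in> ell2"
    and cauchy: "\<And>e. e > 0 \<Longrightarrow> \<exists>N. \<forall>k\<ge>N. \<forall>j\<ge>N. (\<Sum>\<^sub>\<infinity>i. (cmod (a k i - a j i))\<^sup>2) \<le> e"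
  obtains b where "b \<in> ell2" "(\<lambda>k. \<Sum>\<^sub>\<infinity>i. (cmod (a k i - b i))\<^sup>2) \<longlonglongrightarrow> 0"
proof -
  have "Cauchy (\<lambda>k. a k i)" for i
  proof (rule metric_CauchyI)
    fix e :: real
    assume e: "e > 0"
    then obtain N where N: "\<And>j k. j \<ge> N \<Longrightarrow> k \<ge> N \<Longrightarrow> (\<Sum>\<^sub>\<infinity>i. (cmod (a k i - a j i))\<^sup>2) \<le> (e / 2)\<^sup>2"
      using cauchy[of "(e / 2)\<^sup>2"] by auto
    have "dist (a k i) (a j i) < e" if "k \<ge> N" "j \<ge> N" for j k
    proof -
      have "(cmod (a k i - a j i))\<^sup>2 \<le> (e / 2)\<^sup>2"
        using ell2_finite_sum_le[OF ell2_diff[OF a[of k] a[of j]], of "{i}"] N[OF that(2,1)] by simp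
      then have "cmod (a k i - a j i) \<le> e / 2"
        by (rule power2_le_imp_le) (use e in simp)
      then show ?thesis
        using e by (simp add: dist_norm)
    qed
    then show "\<exists>M. \<forall>m\<ge>M. \<forall>n\<ge>M. dist (a m i) (a n i) < e"
      by blast
  qed
  then have "\<exists>l. (\<lambda>k. a k i) \<longlonglongrightarrow> l" for i
    by (simp add: Cauchy_convergent_iff convergent_def)
  then obtain b where b: "\<And>i. (\<lambda>k. a k i) \<longlonglongrightarrow> b i"
    by metis
  have bound: "\<exists>N. \<forall>k\<ge>N. (\<lambda>i. a k i - b i) \<in> ell2 \<and> (\<Sum>\<^sub>\<infinity>i. (cmod (a k i - b i))\<^sup>2) \<le> e" if e: "e > 0" for e
  proof -
    obtain N where N: "\<And>j k. j \<ge> N \<Longrightarrow> k \<ge> N \<Longrightarrow> (\<Sum>\<^sub>\<infinity>i. (cmod (a k i - a j i))\<^sup>2) \<le> e"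
      using cauchy[OF e] by auto
    have "(\<Sum>i\<in>S. (cmod (a k i - b i))\<^sup>2) \<le> e" if "k \<ge> N" "finite S" for k S
    proof (rule LIMSEQ_le_const2)
      show "(\<lambda>j. \<Sum>i\<in>S. (cmod (a k i - a j i))\<^sup>2) \<longlonglongrightarrow> (\<Sum>i\<in>S. (cmod (a k i - b i))\<^sup>2)"
        by (intro tendsto_intros b)
      have "(\<Sum>i\<in>S. (cmod (a k i - a j i))\<^sup>2) \<le> e" if "j \<ge> N" for j
        using ell2_finite_sum_le[OF ell2_diff[OF a[of k] a[of j]] \<open>finite S\<close>] N[OF that \<open>k \<ge> N\<close>] by linarith
      then show "\<exists>N. \<forall>j\<ge>N. (\<Sum>i\<in>S. (cmod (a k i - a j i))\<^sup>2) \<le> e"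
        by blast
    qed
    then show ?thesis
      using ell2I[of "\<lambda>i. a _ i - b i" e] by blast
  qed
  obtain N where "(\<lambda>i. a N i - b i) \<in> ell2"
    using bound[of 1] by auto
  from ell2_diff[OF a[of N] this] have "b \<in> ell2"
    by simp
  moreover have "(\<lambda>k. \<Sum>\<^sub>\<infinity>i. (cmod (a k i - b i))\<^sup>2) \<longlonglongrightarrow> 0"
  proof (rule LIMSEQ_I)
    fix r :: real
    assume "r > 0"
    then obtain N where "\<forall>k\<ge>N. (\<Sum>\<^sub>\<infinity>i. (cmod (a k i - b i))\<^sup>2) \<le> r / 2"
      using bound[of "r / 2"] by auto
    moreover have "0 \<le> (\<Sum>\<^sub>\<infinity>i. (cmod (a k i - b i))\<^sup>2)" for k
      by (intro infsum_nonneg) simp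
    ultimately show "\<exists>N. \<forall>k\<ge>N. norm ((\<Sum>\<^sub>\<infinity>i. (cmod (a k i - b i))\<^sup>2) - 0) < r"
      using \<open>r > 0\<close> by (intro exI[of _ N]) (auto intro: le_less_trans)
  qed
  ultimately show ?thesis
    by (rule that)
qed

section \<open>Complex Hilbert spaces\<close>

interpretation cvs: vector_space "scaleC :: complex \<Rightarrow> 'a::complex_hilbert \<Rightarrow> 'a"
  by (rule vector_space_scaleC)

lemma cinner_add_right: "cinner x (y + z) = cinner x y + cinner x z"
  by (subst (1 2 3) cinner_commute) (simp add: cinner_add_left)

lemma cinner_scaleC_right: "cinner x (c *\<^sub>C y) = cnj c * cinner x y"
  by (subst (1 2) cinner_commute) (simp add: cinner_scaleC_left)

lemma cinner_zero_right [simp]: "cinner x 0 = 0"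
  using cinner_scaleC_right[of x 0 0] by simp

lemma cinner_sum_right: "cinner x (\<Sum>i\<in>S. f i) = (\<Sum>i\<in>S. cinner x (f i))"
  by (induction S rule: infinite_finite_induct) (auto simp: cinner_add_right)

lemma norm_scaleC: "norm (c *\<^sub>C x) = cmod c * norm x" for x :: "'a::complex_hilbert"
proof -
  have "(norm (c *\<^sub>C x))\<^sup>2 = Re (c * cnj c * cinner x x)"
    by (simp only: power2_norm_eq_inner Re_cinner[symmetric] cinner_scaleC_left cinner_scaleC_right mult_ac)
  also have "c * cnj c = of_real ((cmod c)\<^sup>2)"
    by (rule complex_norm_square[symmetric])
  also have "Re (of_real ((cmod c)\<^sup>2) * cinner x x) = (cmod c * norm x)\<^sup>2"
    by (simp add: power_mult_distrib power2_norm_eq_inner Re_cinner)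
  finally show ?thesis
    by (simp add: power2_eq_iff_nonneg)
qed

lemma scaleC_scaleR: "c *\<^sub>C r *\<^sub>R x = r *\<^sub>R c *\<^sub>C x" for x :: "'a::complex_hilbert"
  by (simp add: scaleC_of_real[symmetric] scaleC_scaleC mult.commute)

lemma bounded_linear_scaleC: "bounded_linear (\<lambda>x. c *\<^sub>C (x :: 'a::complex_hilbert))"
  by (rule bounded_linear_intro[where K = "cmod c"])
    (auto simp: scaleC_add_right scaleC_scaleR norm_scaleC)

lemma cmod_cinner_le: "cmod (cinner x y) \<le> norm x * norm y"
proof -
  \<comment> \<open>Rotation by the phase reduces the claim to the real inequality. If the product
    is 0, then \<open>z\<close> is 0; in both cases its modulus is at most 1.\<close>
  define z where "z = cnj (sgn (cinner x y))"
  have "z * cinner x y = of_real (cmod (cinner x y))"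
    by (simp add: z_def sgn_eq mult.commute complex_norm_square[symmetric] power2_eq_square)
  then have "cmod (cinner x y) = Re (cinner (z *\<^sub>C x) y)"
    by (simp add: cinner_scaleC_left)
  also have "\<dots> \<le> norm (z *\<^sub>C x) * norm y"
    unfolding Re_cinner by (rule norm_cauchy_schwarz)
  also have "\<dots> \<le> norm x * norm y"
    by (intro mult_right_mono) (auto simp: norm_scaleC z_def norm_sgn)
  finally show ?thesis .
qed

lemma bounded_linear_cinner: "bounded_linear (\<lambda>x. cinner x y)"
proof (rule bounded_linear_intro[where K = "norm y"])
  show "cinner (r *\<^sub>R x) y = r *\<^sub>R cinner x y" for r x
    using cinner_scaleC_left[of "of_real r" x y] by (simp add: scaleC_of_real scaleR_conv_of_real)
qed (auto simp: cinner_add_left cmod_cinner_le)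

lemma cinner_sum_left: "cinner (\<Sum>i\<in>S. h i) z = (\<Sum>i\<in>S. cinner (h i) z)"
  by (rule linear_sum[OF bounded_linear.linear[OF bounded_linear_cinner]])

section \<open>Bessel and Riesz sequences\<close>

locale bessel_sequence =
  fixes x :: "'i \<Rightarrow> 'a::complex_hilbert" and B :: real
  assumes upper: "finite S \<Longrightarrow> (norm (\<Sum>i\<in>S. c i *\<^sub>C x i))\<^sup>2 \<le> B * (\<Sum>i\<in>S. (cmod (c i))\<^sup>2)"
begin

definition synth :: "('i \<Rightarrow> complex) \<Rightarrow> 'a" where
  "synth a = (\<Sum>\<^sub>\<infinity>i. a i *\<^sub>C x i)"

lemma B_nonneg: "0 \<le> B"
proof -
  have "0 \<le> (norm (\<Sum>i\<in>{undefined}. 1 *\<^sub>C x i))\<^sup>2"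
    by simp
  also have "\<dots> \<le> B * (\<Sum>i\<in>{undefined :: 'i}. (cmod 1)\<^sup>2)"
    by (rule upper) simp
  finally show ?thesis
    by simp
qed

text \<open>The upper bound controls a finite sum outside \<open>S k\<close> by the tail of
  \<open>a\<close>. So the partial sums along the exhaustion converge, and every finite sum over a
  superset of \<open>S k\<close> is close to their limit.\<close>

lemma has_sum_synth:
  assumes a: "a \<in> ell2"
  shows "((\<lambda>i. a i *\<^sub>C x i) has_sum synth a) UNIV"
proof -
  let ?t = "\<Sum>\<^sub>\<infinity>i. (cmod (a i))\<^sup>2"
  obtain S :: "nat \<Rightarrow> 'i set" where S: "\<And>k. finite (S k)" "incseq S"
    "\<And>k. ?t - (\<Sum>i\<in>S k. (cmod (a i))\<^sup>2) \<le> (1 / 4) ^ k"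
    using ell2_exhaustion[OF a] by metis
  define v where "v T = (\<Sum>i\<in>T. a i *\<^sub>C x i)" for T
  define r where "r k = sqrt (B * (1 / 4) ^ k)" for k
  have dist_v: "dist (v T) (v (S k)) \<le> r k" if T: "finite T" "S k \<subseteq> T" for T k
  proof -
    have "(norm (v T - v (S k)))\<^sup>2 = (norm (\<Sum>i\<in>T - S k. a i *\<^sub>C x i))\<^sup>2"
      by (simp add: v_def sum_diff[OF T])
    also have "\<dots> \<le> B * (\<Sum>i\<in>T - S k. (cmod (a i))\<^sup>2)"
      using T by (intro upper) auto
    also have "(\<Sum>i\<in>T - S k. (cmod (a i))\<^sup>2) = (\<Sum>i\<in>T. (cmod (a i))\<^sup>2) - (\<Sum>i\<in>S k. (cmod (a i))\<^sup>2)"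
      by (rule sum_diff[OF T])
    also have "\<dots> \<le> (1 / 4) ^ k"
      using ell2_finite_sum_le[OF a T(1)] S(3)[of k] by linarith
    finally show ?thesis
      using B_nonneg by (simp add: r_def dist_norm real_le_rsqrt mult_left_mono)
  qed
  have "(\<lambda>k. B * (1 / 4) ^ k) \<longlonglongrightarrow> B * 0"
    by (intro tendsto_intros LIMSEQ_realpow_zero) auto
  then have "(\<lambda>k. sqrt (B * (1 / 4) ^ k)) \<longlonglongrightarrow> sqrt (B * 0)"
    by (rule tendsto_real_sqrt)
  then have r0: "r \<longlonglongrightarrow> 0"
    by (simp add: r_def[abs_def])
  have r_small: "\<exists>k. r k < e" if "e > 0" for e
    using order_tendstoD(2)[OF r0 that] by (auto simp: eventually_sequentially)
  have "Cauchy (\<lambda>k. v (S k))"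
  proof (rule metric_CauchyI)
    fix e :: real
    assume "e > 0"
    then obtain k where k: "r k < e / 2"
      using r_small[of "e / 2"] by auto
    have "dist (v (S m)) (v (S n)) < e" if "m \<ge> k" "n \<ge> k" for m n
      using dist_v[OF S(1), of k m] dist_v[OF S(1), of k n] incseqD[OF S(2)] that k
        dist_triangle2[of "v (S m)" "v (S n)" "v (S k)"] by fastforce
    then show "\<exists>M. \<forall>m\<ge>M. \<forall>n\<ge>M. dist (v (S m)) (v (S n)) < e"
      by blast
  qed
  then obtain l where l: "(\<lambda>k. v (S k)) \<longlonglongrightarrow> l"
    by (auto simp: Cauchy_convergent_iff convergent_def)
  have dist_l: "dist l (v (S k)) \<le> r k" for k
  proof (rule LIMSEQ_le_const2)
    show "(\<lambda>j. dist (v (S j)) (v (S k))) \<longlonglongrightarrow> dist l (v (S k))"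
      by (intro tendsto_intros l)
    show "\<exists>N. \<forall>j\<ge>N. dist (v (S j)) (v (S k)) \<le> r k"
      using dist_v[OF S(1)] incseqD[OF S(2)] by blast
  qed
  have "((\<lambda>i. a i *\<^sub>C x i) has_sum l) UNIV"
    unfolding has_sum_def tendsto_iff eventually_finite_subsets_at_top
  proof (intro allI impI)
    fix e :: real
    assume "e > 0"
    then obtain k where k: "r k < e / 2"
      using r_small[of "e / 2"] by auto
    have "dist (v Y) l < e" if "finite Y" "S k \<subseteq> Y" for Y
      using dist_v[OF that] dist_l[of k] k dist_triangle2[of "v Y" l "v (S k)"] by linarith
    then show "\<exists>X. finite X \<and> X \<subseteq> UNIV \<and> (\<forall>Y. finite Y \<and> X \<subseteq> Y \<and> Y \<subseteq> UNIV \<longrightarrow> dist (\<Sum>i\<in>Y. a i *\<^sub>C x i) l < e)"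
      using S(1)[of k] by (auto simp: v_def)
  qed
  then show ?thesis
    unfolding synth_def by (metis infsumI)
qed

lemma norm_synth_le:
  assumes a: "a \<in> ell2"
  shows "(norm (synth a))\<^sup>2 \<le> B * (\<Sum>\<^sub>\<infinity>i. (cmod (a i))\<^sup>2)"
proof (rule tendsto_upperbound)
  show "((\<lambda>S. (norm (\<Sum>i\<in>S. a i *\<^sub>C x i))\<^sup>2) \<longlongrightarrow> (norm (synth a))\<^sup>2) (finite_subsets_at_top UNIV)"
    using has_sum_synth[OF a] unfolding has_sum_def by (intro tendsto_intros)
  show "\<forall>\<^sub>F S in finite_subsets_at_top UNIV. (norm (\<Sum>i\<in>S. a i *\<^sub>C x i))\<^sup>2 \<le> B * (\<Sum>\<^sub>\<infinity>i. (cmod (a i))\<^sup>2)"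
    using upper ell2_finite_sum_le[OF a] B_nonneg
    by (intro eventually_finite_subsets_at_top_weakI) (meson mult_left_mono order_trans)
qed simp

lemma synth_diff:
  assumes "a \<in> ell2" "b \<in> ell2"
  shows "synth (\<lambda>i. a i - b i) = synth a - synth b"
  unfolding synth_def[of "\<lambda>i. a i - b i"]
  using has_sum_diff[OF has_sum_synth[OF assms(1)] has_sum_synth[OF assms(2)]]
  by (intro infsumI) (simp add: cvs.scale_left_diff_distrib)

lemma synth_add:
  assumes "a \<in> ell2" "b \<in> ell2"
  shows "synth (\<lambda>i. a i + b i) = synth a + synth b"
  unfolding synth_def[of "\<lambda>i. a i + b i"]
  using has_sum_add[OF has_sum_synth[OF assms(1)] has_sum_synth[OF assms(2)]]
  by (intro infsumI) (simp add: scaleC_add_left)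

lemma synth_cmult:
  assumes "a \<in> ell2"
  shows "synth (\<lambda>i. c * a i) = c *\<^sub>C synth a"
  unfolding synth_def[of "\<lambda>i. c * a i"]
  using has_sum_bounded_linear[OF bounded_linear_scaleC has_sum_synth[OF assms], of c]
  by (intro infsumI) (simp add: scaleC_scaleC)

lemma synth_finite_support:
  assumes "finite S"
  shows "synth (\<lambda>i. if i \<in> S then c i else 0) = (\<Sum>i\<in>S. c i *\<^sub>C x i)"
  unfolding synth_def using assms by (subst infsum_finite_support[OF assms]) auto

lemma synth_sum:
  "finite S \<Longrightarrow> (\<And>j. j \<in> S \<Longrightarrow> a j \<in> ell2) \<Longrightarrow> synth (\<lambda>i. \<Sum>j\<in>S. a j i) = (\<Sum>j\<in>S. synth (a j))"
proof (induction S rule: finite_induct)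
  case empty
  show ?case
    by (simp add: synth_def)
next
  case (insert j S)
  then show ?case
    using ell2_sum[of S a] by (simp add: synth_add)
qed

lemma synth_in_closure:
  assumes a: "a \<in> ell2"
  shows "synth a \<in> closure (cspan (range x))"
proof (rule Lim_in_closed_set[OF closed_closure])
  show "((\<lambda>S. \<Sum>i\<in>S. a i *\<^sub>C x i) \<longlongrightarrow> synth a) (finite_subsets_at_top UNIV)"
    using has_sum_synth[OF a] unfolding has_sum_def .
  have "(\<Sum>i\<in>S. a i *\<^sub>C x i) \<in> cspan (range x)" for S
    by (intro cvs.span_sum cvs.span_scale cvs.span_base) auto
  then show "\<forall>\<^sub>F S in finite_subsets_at_top UNIV. (\<Sum>i\<in>S. a i *\<^sub>C x i) \<in> closure (cspan (range x))"
    using closure_subset by (intro always_eventually) blast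
qed simp

lemma cinner_synth:
  assumes a: "a \<in> ell2"
  shows "((\<lambda>i. a i * cinner (x i) y) has_sum cinner (synth a) y) UNIV"
  using has_sum_bounded_linear[OF bounded_linear_cinner has_sum_synth[OF a], of y]
  by (simp add: cinner_scaleC_left)

text \<open>Pairing \<open>y\<close> with the combination that has its own coefficients yields
  \<open>?s\<^sup>2 \<le> (norm y)\<^sup>2 * (B * ?s)\<close>, from which one factor
  \<open>?s\<close> cancels.\<close>

lemma analysis_ell2: "(\<lambda>i. cinner y (x i)) \<in> ell2"
proof (rule ell2I)
  fix S :: "'i set"
  assume S: "finite S"
  let ?c = "\<lambda>i. cinner y (x i)"
  let ?s = "\<Sum>i\<in>S. (cmod (?c i))\<^sup>2"
  have "of_real ?s = cinner y (\<Sum>i\<in>S. ?c i *\<^sub>C x i)"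
    by (simp only: of_real_sum cinner_sum_right cinner_scaleC_right complex_norm_square mult.commute)
  then have "cmod (of_real ?s) \<le> norm y * norm (\<Sum>i\<in>S. ?c i *\<^sub>C x i)"
    using cmod_cinner_le[of y "\<Sum>i\<in>S. ?c i *\<^sub>C x i"] by simp
  moreover have nonneg: "0 \<le> ?s"
    by (intro sum_nonneg) auto
  ultimately have "?s \<le> norm y * norm (\<Sum>i\<in>S. ?c i *\<^sub>C x i)"
    by (simp only: norm_of_real abs_of_nonneg)
  then have "?s\<^sup>2 \<le> (norm y * norm (\<Sum>i\<in>S. ?c i *\<^sub>C x i))\<^sup>2"
    by (rule power_mono[OF _ nonneg])
  also have "\<dots> \<le> (norm y)\<^sup>2 * (B * ?s)"
    unfolding power_mult_distrib by (intro mult_left_mono upper S) auto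
  finally have "?s * ?s \<le> ((norm y)\<^sup>2 * B) * ?s"
    by (simp add: power2_eq_square mult_ac)
  then show "?s \<le> (norm y)\<^sup>2 * B"
    using nonneg B_nonneg mult_right_le_imp_le[of ?s ?s "(norm y)\<^sup>2 * B"] by (cases "?s = 0") auto
qed

end

locale riesz_system = bessel_sequence x B for x :: "'i \<Rightarrow> 'a::complex_hilbert" and B +
  fixes A :: real
  assumes A_pos: "0 < A"
    and lower: "finite S \<Longrightarrow> A * (\<Sum>i\<in>S. (cmod (c i))\<^sup>2) \<le> (norm (\<Sum>i\<in>S. c i *\<^sub>C x i))\<^sup>2"
begin

lemma norm_synth_ge:
  assumes a: "a \<in> ell2"
  shows "A * (\<Sum>\<^sub>\<infinity>i. (cmod (a i))\<^sup>2) \<le> (norm (synth a))\<^sup>2"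
proof (rule tendsto_le)
  show "((\<lambda>S. (norm (\<Sum>i\<in>S. a i *\<^sub>C x i))\<^sup>2) \<longlongrightarrow> (norm (synth a))\<^sup>2) (finite_subsets_at_top UNIV)"
    using has_sum_synth[OF a] unfolding has_sum_def by (intro tendsto_intros)
  show "((\<lambda>S. A * (\<Sum>i\<in>S. (cmod (a i))\<^sup>2)) \<longlongrightarrow> A * (\<Sum>\<^sub>\<infinity>i. (cmod (a i))\<^sup>2)) (finite_subsets_at_top UNIV)"
    using ell2_has_sum[OF a] unfolding has_sum_def by (intro tendsto_intros)
  show "\<forall>\<^sub>F S in finite_subsets_at_top UNIV. A * (\<Sum>i\<in>S. (cmod (a i))\<^sup>2) \<le> (norm (\<Sum>i\<in>S. a i *\<^sub>C x i))\<^sup>2"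
    by (intro eventually_finite_subsets_at_top_weakI lower)
qed simp

text \<open>Finite partial sums over sets containing \<open>i\<close> have squared norm at least
  \<open>A * (cmod (c i))\<^sup>2\<close>, and they tend to 0.\<close>

lemma has_sum_0_imp_0:
  assumes "((\<lambda>i. c i *\<^sub>C x i) has_sum 0) UNIV"
  shows "c i = 0"
proof -
  have "A * (cmod (c i))\<^sup>2 \<le> (norm (0 :: 'a))\<^sup>2"
  proof (rule tendsto_lowerbound)
    show "((\<lambda>S. (norm (\<Sum>i\<in>S. c i *\<^sub>C x i))\<^sup>2) \<longlongrightarrow> (norm (0 :: 'a))\<^sup>2) (finite_subsets_at_top UNIV)"
      using assms unfolding has_sum_def by (intro tendsto_intros)
    have "A * (cmod (c i))\<^sup>2 \<le> (norm (\<Sum>i\<in>S. c i *\<^sub>C x i))\<^sup>2" if "finite S" "i \<in> S" for S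
    proof -
      have "(cmod (c i))\<^sup>2 \<le> (\<Sum>i\<in>S. (cmod (c i))\<^sup>2)"
        using that by (intro member_le_sum) auto
      then show ?thesis
        using lower[OF that(1), of c] A_pos by (meson less_imp_le mult_left_mono order_trans)
    qed
    then show "\<forall>\<^sub>F S in finite_subsets_at_top UNIV. A * (cmod (c i))\<^sup>2 \<le> (norm (\<Sum>i\<in>S. c i *\<^sub>C x i))\<^sup>2"
      unfolding eventually_finite_subsets_at_top by (intro exI[of _ "{i}"]) auto
  qed simp
  then show ?thesis
    using A_pos by (simp add: mult_le_0_iff)
qed

lemma cspan_imp_synth:
  assumes "f \<in> cspan (range x)"
  shows "\<exists>a\<in>ell2. f = synth a"
  using assms
proof (induction rule: cvs.span_induct_alt)
  case base
  have "(\<lambda>i. 0) \<in> ell2"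
    by (rule ell2_finite_support[of "{}"]) auto
  then show ?case
    by (intro bexI[of _ "\<lambda>i. 0"]) (auto simp: synth_def)
next
  case (step c y z)
  then obtain i a where i: "y = x i" and a: "a \<in> ell2" "z = synth a"
    by blast
  let ?d = "\<lambda>j. if j \<in> {i} then c else 0"
  have d: "?d \<in> ell2"
    by (rule ell2_finite_support[of "{i}"]) auto
  have "c *\<^sub>C y + z = synth (\<lambda>j. ?d j + a j)"
    unfolding synth_add[OF d a(1)] using synth_finite_support[of "{i}" "\<lambda>_. c"] by (simp add: i a(2))
  then show ?case
    using ell2_add[OF d a(1)] by blast
qed

text \<open>By the lower bound the coefficients of a convergent sequence of combinations form a
  Cauchy sequence in \<open>ell2\<close>; by the upper bound synthesis is continuous at their
  limit.\<close>

lemma closure_imp_synth: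
  assumes f: "f \<in> closure (cspan (range x))"
  obtains a where "a \<in> ell2" "f = synth a"
proof -
  obtain g where g: "\<And>k. g k \<in> cspan (range x)" "g \<longlonglongrightarrow> f"
    using f unfolding closure_sequential by blast
  then have "\<forall>k. \<exists>a. a \<in> ell2 \<and> g k = synth a"
    using cspan_imp_synth by blast
  from choice[OF this] obtain a where a: "\<And>k. a k \<in> ell2" "\<And>k. g k = synth (a k)"
    by blast
  obtain b where b: "b \<in> ell2" "(\<lambda>k. \<Sum>\<^sub>\<infinity>i. (cmod (a k i - b i))\<^sup>2) \<longlonglongrightarrow> 0"
  proof (rule ell2_complete[OF a(1)])
    fix e :: real
    assume e: "e > 0"
    have "Cauchy g"
      using g(2) by (rule LIMSEQ_imp_Cauchy)
    then obtain N where N: "\<And>j k. j \<ge> N \<Longrightarrow> k \<ge> N \<Longrightarrow> dist (g k) (g j) < sqrt (A * e)"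
      using e A_pos unfolding Cauchy_def by (metis mult_pos_pos real_sqrt_gt_zero)
    have "(\<Sum>\<^sub>\<infinity>i. (cmod (a k i - a j i))\<^sup>2) \<le> e" if "k \<ge> N" "j \<ge> N" for j k
    proof -
      have "A * (\<Sum>\<^sub>\<infinity>i. (cmod (a k i - a j i))\<^sup>2) \<le> (norm (g k - g j))\<^sup>2"
        using norm_synth_ge[OF ell2_diff[OF a(1)[of k] a(1)[of j]]] by (simp add: synth_diff a)
      also have "\<dots> \<le> (sqrt (A * e))\<^sup>2"
        using N[OF that(2,1)] by (intro power_mono) (auto simp: dist_norm)
      also have "\<dots> = A * e"
        using A_pos e by simp
      finally show ?thesis
        using A_pos by simp
    qed
    then show "\<exists>N. \<forall>k\<ge>N. \<forall>j\<ge>N. (\<Sum>\<^sub>\<infinity>i. (cmod (a k i - a j i))\<^sup>2) \<le> e"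
      by blast
  qed
  have "(\<lambda>k. (norm (g k - synth b))\<^sup>2) \<longlonglongrightarrow> 0"
  proof (rule Lim_null_comparison)
    show "\<forall>\<^sub>F k in sequentially. norm ((norm (g k - synth b))\<^sup>2) \<le> B * (\<Sum>\<^sub>\<infinity>i. (cmod (a k i - b i))\<^sup>2)"
      using norm_synth_le[OF ell2_diff[OF a(1) b(1)]] by (intro always_eventually) (simp add: synth_diff a b)
    show "(\<lambda>k. B * (\<Sum>\<^sub>\<infinity>i. (cmod (a k i - b i))\<^sup>2)) \<longlonglongrightarrow> 0"
      using tendsto_mult_left[OF b(2), of B] by simp
  qed
  then have "(\<lambda>k. norm (g k - synth b)) \<longlonglongrightarrow> 0"
    using tendsto_real_sqrt[of _ 0] by fastforce
  then have "g \<longlonglongrightarrow> synth b"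
    by (simp add: LIM_zero_iff tendsto_norm_zero_iff)
  then have "f = synth b"
    using g(2) LIMSEQ_unique by blast
  then show ?thesis
    using that b(1) by blast
qed

end

section \<open>Essentially bounded matrices\<close>

lemma Linf_space_iff:
  "F \<in> Linf_space M \<longleftrightarrow> F \<in> borel_measurable M \<and> (\<exists>B. AE x in M. cmod (F x) \<le> B)"
proof (intro iffI conjI)
  assume F: "F \<in> Linf_space M"
  then show "F \<in> borel_measurable M"
    by (simp add: Linf_space_def)
  obtain B where B: "esssup M (\<lambda>x. ereal (cmod (F x))) < ereal B"
    using F less_PInf_Ex_of_nat[of "esssup M (\<lambda>x. ereal (cmod (F x)))"] by (auto simp: Linf_space_def)
  have "AE x in M. cmod (F x) \<le> B"
    using esssup_AE[of "\<lambda>x. ereal (cmod (F x))" M]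
  proof eventually_elim
    case (elim x)
    then have "ereal (cmod (F x)) \<le> ereal B"
      using B by order
    then show ?case
      by simp
  qed
  then show "\<exists>B. AE x in M. cmod (F x) \<le> B"
    by blast
next
  assume "F \<in> borel_measurable M \<and> (\<exists>B. AE x in M. cmod (F x) \<le> B)"
  then obtain B where F: "F \<in> borel_measurable M" "AE x in M. cmod (F x) \<le> B"
    by blast
  have "esssup M (\<lambda>x. ereal (cmod (F x))) \<le> ereal B"
    using F by (intro esssup_I) auto
  also have "\<dots> < \<infinity>"
    by simp
  finally show "F \<in> Linf_space M"
    using F(1) by (simp add: Linf_space_def)
qed

text \<open>The bound is taken to be at least 1 so that it also covers the column of entries at most
  1 that Cramer's rule inserts in \<open>matrix_lower_bound\<close>.\<close>

lemma bounded_entriesD: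
  fixes F :: "('n::ab_group_add \<Rightarrow> complex) \<Rightarrow> complex^'h^'h"
  assumes "bounded_entries \<mu> F"
  obtains B where "B \<ge> 1" "AE \<xi> in \<mu>. \<forall>h l. cmod (F \<xi> $ h $ l) \<le> B"
proof -
  have "\<exists>B. AE \<xi> in \<mu>. cmod (F \<xi> $ fst p $ snd p) \<le> B" for p
    using assms by (simp add: bounded_entries_def Linf_space_iff)
  then obtain B where B: "\<And>p. AE \<xi> in \<mu>. cmod (F \<xi> $ fst p $ snd p) \<le> B p"
    by metis
  define b where "b = Max (insert 1 (range B))"
  have b: "b \<ge> 1" "B p \<le> b" for p
    unfolding b_def by (intro Max_ge; simp)+
  have "AE \<xi> in \<mu>. cmod (F \<xi> $ fst p $ snd p) \<le> b" for p
    using B[of p] by eventually_elim (use b(2) order_trans in blast)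
  then have "AE \<xi> in \<mu>. \<forall>p. cmod (F \<xi> $ fst p $ snd p) \<le> b"
    by (rule eventually_all_finite)
  then have "AE \<xi> in \<mu>. \<forall>h l. cmod (F \<xi> $ h $ l) \<le> b"
    by eventually_elim (metis fst_conv snd_conv)
  then show ?thesis
    by (rule that[OF b(1)])
qed

lemma essinf_pos_iff:
  assumes f: "f \<in> borel_measurable M"
  shows "essinf M (\<lambda>x. ereal (f x)) > 0 \<longleftrightarrow> (\<exists>\<delta>>0. AE x in M. \<delta> \<le> f x)"
proof
  assume "essinf M (\<lambda>x. ereal (f x)) > 0"
  then obtain \<delta> where d: "0 < ereal \<delta>" "ereal \<delta> < essinf M (\<lambda>x. ereal (f x))"
    using ereal_dense2 by blast
  have "AE x in M. - ereal (f x) \<le> esssup M (\<lambda>x. - ereal (f x))"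
    by (rule esssup_AE)
  then have "AE x in M. \<delta> \<le> f x"
  proof eventually_elim
    case (elim x)
    then have "essinf M (\<lambda>x. ereal (f x)) \<le> ereal (f x)"
      unfolding essinf_def by (metis ereal_minus_le_minus ereal_uminus_uminus)
    then have "ereal \<delta> < ereal (f x)"
      using d(2) by order
    then show ?case
      by simp
  qed
  then show "\<exists>\<delta>>0. AE x in M. \<delta> \<le> f x"
    using d(1) by auto
next
  assume "\<exists>\<delta>>0. AE x in M. \<delta> \<le> f x"
  then obtain \<delta> where d: "\<delta> > 0" "AE x in M. \<delta> \<le> f x"
    by blast
  have "esssup M (\<lambda>x. - ereal (f x)) \<le> - ereal \<delta>"
    using f d(2) by (intro esssup_I) auto
  then have "ereal \<delta> \<le> essinf M (\<lambda>x. ereal (f x))"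
    unfolding essinf_def by (metis ereal_minus_le_minus ereal_uminus_uminus)
  then show "essinf M (\<lambda>x. ereal (f x)) > 0"
    using d(1) by (metis ereal_less(2) order_less_le_trans)
qed

lemma cmod_det_le:
  fixes A :: "complex^'h^'h"
  assumes "\<And>i j. cmod (A $ i $ j) \<le> B"
  shows "cmod (det A) \<le> fact (CARD('h)) * B ^ CARD('h)"
proof -
  let ?P = "{p. p permutes (UNIV :: 'h set)}"
  have "cmod (det A) \<le> (\<Sum>p\<in>?P. cmod (of_int (sign p) * (\<Prod>i\<in>UNIV. A $ i $ p i)))"
    unfolding det_def by (rule norm_sum)
  also have "\<dots> \<le> (\<Sum>p\<in>?P. B ^ CARD('h))"
  proof (rule sum_mono)
    fix p
    have "cmod (\<Prod>i\<in>UNIV. A $ i $ p i) \<le> (\<Prod>i\<in>(UNIV :: 'h set). B)"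
      unfolding prod_norm[symmetric] using assms by (intro prod_mono) auto
    then show "cmod (of_int (sign p) * (\<Prod>i\<in>UNIV. A $ i $ p i)) \<le> B ^ CARD('h)"
      by (simp add: norm_mult sign_def)
  qed
  also have "\<dots> = fact (CARD('h)) * B ^ CARD('h)"
    by (simp add: card_permutations[OF refl])
  finally show ?thesis .
qed

text \<open>If the entries of \<open>A *v x\<close> are at most 1, Cramer's rule bounds
  \<open>x\<close> by a quotient of determinants, with the Leibniz bound \<open>D\<close> above and
  \<open>\<delta>\<close> below. Scaling gives the general case. \<open>K\<close> does not depend on
  the matrix, hence is uniform on the dual group.\<close>

lemma matrix_lower_bound:
  fixes B \<delta> :: real
  assumes "B \<ge> 1" "\<delta> > 0"
  obtains K where "K \<ge> 0" "\<And>(A :: complex^'h^'h) x k. (\<And>i j. cmod (A $ i $ j) \<le> B) \<Longrightarrow> \<delta> \<le> cmod (det A) \<Longrightarrow>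
    cmod (x $ k) \<le> K * (\<Sum>l\<in>UNIV. cmod ((A *v x) $ l))"
proof
  define D where "D = fact (CARD('h)) * B ^ CARD('h)"
  show "0 \<le> D / \<delta>"
    using assms by (simp add: D_def)
  fix A :: "complex^'h^'h" and x k
  assume A: "\<And>i j. cmod (A $ i $ j) \<le> B" and d: "\<delta> \<le> cmod (det A)"
  have det: "det A \<noteq> 0"
    using d assms(2) by auto
  define b where "b = A *v x"
  define s where "s = (\<Sum>l\<in>UNIV. cmod (b $ l))"
  have b_le: "cmod (b $ l) \<le> s" for l
    unfolding s_def by (intro member_le_sum) auto
  have bound: "cmod (y $ k) \<le> D / \<delta>" if y: "\<And>l. cmod ((A *v y) $ l) \<le> 1" for y
  proof -
    have "y $ k = det (\<chi> i j. if j = k then (A *v y) $ i else A $ i $ j) / det A"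
      using cramer[OF det, of y "A *v y"] by (simp add: vec_eq_iff)
    then have "cmod (y $ k) = cmod (det (\<chi> i j. if j = k then (A *v y) $ i else A $ i $ j)) / cmod (det A)"
      by (simp add: norm_divide)
    also have "\<dots> \<le> D / \<delta>"
    proof (rule frac_le)
      show "cmod (det (\<chi> i j. if j = k then (A *v y) $ i else A $ i $ j)) \<le> D"
        unfolding D_def using A y assms(1) order_trans[OF y assms(1)] by (intro cmod_det_le) auto
    qed (use assms d in \<open>auto simp: D_def\<close>)
    finally show ?thesis .
  qed
  show "cmod (x $ k) \<le> D / \<delta> * (\<Sum>l\<in>UNIV. cmod ((A *v x) $ l))"
  \<comment> \<open>Scaling by \<open>s\<close> needs \<open>s \<noteq> 0\<close>; otherwise
    invertibility gives \<open>x = 0\<close>.\<close>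
  proof (cases "s = 0")
    case True
    then have "b = 0"
      using b_le by (simp add: vec_eq_iff)
    moreover obtain A' where "A' ** A = mat 1"
      using det invertible_det_nz[of A] by (auto simp: invertible_def)
    ultimately have "x = 0"
      unfolding b_def by (metis matrix_vector_mul_assoc matrix_vector_mul_lid matrix_vector_mult_0_right)
    then show ?thesis
      by simp
  next
    case False
    then have s: "s > 0"
      using b_le[of undefined] norm_ge_zero[of "b $ undefined"] by linarith
    define y where "y = (\<chi> l. x $ l / of_real s)"
    have "(A *v y) $ l = b $ l / of_real s" for l
      by (simp add: b_def y_def matrix_vector_mult_def sum_divide_distrib)
    then have "cmod ((A *v y) $ l) \<le> 1" for l
      using b_le[of l] s by (simp add: norm_divide)
    from bound[of y, OF this] have "cmod (x $ k) / s \<le> D / \<delta>"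
      using s by (simp add: y_def norm_divide)
    then show ?thesis
      using s unfolding b_def[symmetric] s_def[symmetric] by (simp add: pos_divide_le_eq)
  qed
qed

lemma det_conj_transpose:
  fixes A :: "complex^'h^'h"
  shows "det (conj_transpose A) = cnj (det A)"
proof -
  have "det (conj_transpose A) = det (transpose (conj_transpose A))"
    by simp
  also have "transpose (conj_transpose A) = (\<chi> i j. cnj (A $ i $ j))"
    by (simp add: vec_eq_iff conj_transpose_def transpose_def)
  also have "det \<dots> = cnj (det A)"
    by (simp add: det_def)
  finally show ?thesis .
qed

lemma conj_transpose_mult_nth: "(conj_transpose Z *v v) $ l = (\<Sum>h\<in>UNIV. cnj (Z $ h $ l) * v $ h)"
  by (simp add: conj_transpose_def matrix_vector_mult_def)

lemma measurable_det:
  fixes F :: "'x \<Rightarrow> complex^'h^'h"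
  assumes [measurable]: "\<And>i j. (\<lambda>x. F x $ i $ j) \<in> borel_measurable M"
  shows "(\<lambda>x. det (F x)) \<in> borel_measurable M"
  unfolding det_def by measurable

section \<open>Sums over slices of a product with a finite set\<close>

lemma has_sum_slices:
  fixes g :: "'m \<times> 'h::finite \<Rightarrow> 'b::topological_comm_monoid_add"
  assumes "\<And>h. ((\<lambda>n. g (n, h)) has_sum s h) UNIV"
  shows "(g has_sum (\<Sum>h\<in>UNIV. s h)) UNIV"
proof -
  have "(g has_sum s h) (range (\<lambda>n. (n, h)))" for h
    using assms[of h] by (subst has_sum_reindex) (auto simp: inj_def o_def)
  then have "(g has_sum (\<Sum>h\<in>UNIV. s h)) (\<Union>h\<in>UNIV. range (\<lambda>n. (n, h)))"
    by (intro sum_has_sum) auto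
  also have "(\<Union>h\<in>UNIV. range (\<lambda>n. (n, h))) = (UNIV :: ('m \<times> 'h) set)"
    by auto
  finally show ?thesis .
qed

lemma ell2_slice: "a \<in> ell2 \<Longrightarrow> (\<lambda>n. a (n, h)) \<in> ell2"
  by (rule ell2_reindex[of "\<lambda>n. (n, h)"]) (auto simp: inj_def)

lemma ell2_slices:
  fixes a :: "'m \<times> 'h::finite \<Rightarrow> complex"
  assumes "\<And>h. (\<lambda>n. a (n, h)) \<in> ell2"
  shows "a \<in> ell2"
  unfolding ell2_def using has_sum_slices[OF ell2_has_sum[OF assms]]
  by (auto simp: summable_on_def)

lemma infsum_slices:
  fixes a :: "'m \<times> 'h::finite \<Rightarrow> complex"
  assumes "a \<in> ell2"
  shows "(\<Sum>\<^sub>\<infinity>p. (cmod (a p))\<^sup>2) = (\<Sum>h\<in>UNIV. \<Sum>\<^sub>\<infinity>n. (cmod (a (n, h)))\<^sup>2)"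
  using ell2_has_sum[OF ell2_slice[OF assms]]
  by (intro infsumI has_sum_slices[where g = "\<lambda>p. (cmod (a p))\<^sup>2"])

section \<open>Unitary representations of semidirect products\<close>

lemma unitary_operatorD:
  assumes "unitary_operator V"
  shows "bounded_linear V" "V (c *\<^sub>C x) = c *\<^sub>C V x" "cinner (V x) (V y) = cinner x y" "surj V"
proof -
  have V: "\<And>x y. V (x + y) = V x + V y" "\<And>c x. V (c *\<^sub>C x) = c *\<^sub>C V x"
    "\<And>x y. cinner (V x) (V y) = cinner x y"
    using assms by (auto simp: unitary_operator_def)
  then show "V (c *\<^sub>C x) = c *\<^sub>C V x" "cinner (V x) (V y) = cinner x y" "surj V"
    using assms by (auto simp: unitary_operator_def)
  have "norm (V x) = norm x" for x
    by (simp add: norm_eq_sqrt_inner Re_cinner[symmetric] V(3))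
  moreover have "V (r *\<^sub>R x) = r *\<^sub>R V x" for r x
    using V(2)[of "of_real r" x] by (simp add: scaleC_of_real)
  ultimately show "bounded_linear V"
    by (intro bounded_linear_intro[where K = 1] V(1)) auto
qed

locale semidirect_representation =
  fixes \<sigma> :: "'h::{group_add, finite} \<Rightarrow> 'n::ab_group_add \<Rightarrow> 'n"
    and U :: "'n \<times> 'h \<Rightarrow> 'a::complex_hilbert \<Rightarrow> 'a"
  assumes action: "automorphism_action \<sigma>"
    and rep: "unitary_representation \<sigma> U"
begin

abbreviation mult (infixl \<open>\<odot>\<close> 70) where "mult \<equiv> sd_mult \<sigma>"
abbreviation inv_sd where "inv_sd \<equiv> sd_inv \<sigma>"

lemmas group = sd_group[OF action]

lemma inv_mult_cancel: "inv_sd \<gamma> \<odot> (\<gamma> \<odot> \<eta>) = \<eta>" "\<gamma> \<odot> (inv_sd \<gamma> \<odot> \<eta>) = \<eta>"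
  by (simp_all add: group flip: group(1))

lemma bij_mult: "bij (mult \<gamma>)"
  by (rule o_bij[of "mult (inv_sd \<gamma>)"]) (auto simp: inv_mult_cancel)

lemma U_unitary: "unitary_operator (U \<gamma>)"
  and U_mult: "U (\<gamma> \<odot> \<eta>) x = U \<gamma> (U \<eta> x)"
  using rep unfolding unitary_representation_def by (blast, metis comp_apply)

lemmas U_linear = unitary_operatorD(1)[OF U_unitary]
lemmas U_scaleC = unitary_operatorD(2)[OF U_unitary]
lemmas U_cinner = unitary_operatorD(3)[OF U_unitary]

text \<open>Multiplicativity makes \<open>U sd_one\<close> idempotent, and a surjective idempotent
  is the identity.\<close>

lemma U_one: "U sd_one x = x"
proof -
  obtain y where "x = U sd_one y"
    using unitary_operatorD(4)[OF U_unitary, of sd_one] by (metis surjD)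
  then show ?thesis
    by (simp add: group(2) flip: U_mult)
qed

lemma cinner_U: "cinner (U \<gamma> x) (U \<eta> y) = cinner x (U (inv_sd \<gamma> \<odot> \<eta>) y)"
proof -
  have "U \<eta> y = U \<gamma> (U (inv_sd \<gamma> \<odot> \<eta>) y)"
    by (simp add: inv_mult_cancel flip: U_mult)
  then show ?thesis
    by (simp add: U_cinner)
qed

lemma cinner_U_left: "cinner (U \<gamma> x) (U \<eta> y) = cinner (U (inv_sd \<eta> \<odot> \<gamma>) x) y"
proof -
  have "U \<gamma> x = U \<eta> (U (inv_sd \<eta> \<odot> \<gamma>) x)"
    by (simp add: inv_mult_cancel flip: U_mult)
  then show ?thesis
    by (simp add: U_cinner)
qed

text \<open>The left regular representation. It describes \<open>U \<gamma>\<close> on coefficients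
  (\<open>U_synth\<close>), and the translates by \<open>(0, l)\<close> yield the columns of a
  transfer matrix.\<close>

definition translate :: "'n \<times> 'h \<Rightarrow> ('n \<times> 'h \<Rightarrow> complex) \<Rightarrow> 'n \<times> 'h \<Rightarrow> complex" where
  "translate \<gamma> a \<eta> = a (inv_sd \<gamma> \<odot> \<eta>)"

lemma translate_ell2: "a \<in> ell2 \<Longrightarrow> translate \<gamma> a \<in> ell2"
  unfolding translate_def[abs_def] by (rule ell2_reindex[OF bij_is_inj[OF bij_mult]])

lemma translate_one: "translate (0, 0) a = a"
proof
  fix \<eta>
  have "inv_sd (0, 0) = (0, 0)"
    by (simp add: sd_inv_def automorphism_action_zero[OF action])
  then show "translate (0, 0) a \<eta> = a \<eta>"
    using group(2)[of \<eta>] by (simp add: translate_def sd_one_def)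
qed

text \<open>As \<open>(m, l)\<close> is the product of \<open>(m, 0)\<close> and
  \<open>(0, l)\<close>, the \<open>N\<close>-part of a translation is a plain shift of each slice,
  which becomes multiplication by a character after the transform.\<close>

lemma inv_mult_eq: "inv_sd (m, l) \<odot> (n, h) = inv_sd (0, l) \<odot> (n - m, h)"
proof -
  have add: "\<sigma> k (a + b) = \<sigma> k a + \<sigma> k b" for k a b
    using action by (simp add: automorphism_action_def)
  have "\<sigma> (- l) (- m) + \<sigma> (- l) n = \<sigma> (- l) (n - m)"
    using add[of "- l" "- m" n] by simp
  then show ?thesis
    by (simp add: sd_mult_def sd_inv_def automorphism_action_zero[OF action])
qed

lemma translate_shift: "translate (m, l) a (n, h) = translate (0, l) a (n - m, h)"
  unfolding translate_def by (rule arg_cong[OF inv_mult_eq])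

lemma transfer_matrix_nth: "transfer_matrix \<sigma> \<mu> a \<xi> $ h $ l = fourier \<mu> (\<lambda>n. translate (0, l) a (n, h)) \<xi>"
  by (simp add: transfer_matrix_def translate_def)

definition delta :: "'n \<times> 'h \<Rightarrow> 'n \<times> 'h \<Rightarrow> complex" where
  "delta \<gamma> \<eta> = (if \<eta> = \<gamma> then 1 else 0)"

lemma delta_ell2: "delta \<gamma> \<in> ell2"
  by (rule ell2_finite_support[of "{\<gamma>}"]) (auto simp: delta_def)

lemma translate_delta: "translate \<gamma> (delta sd_one) = delta \<gamma>"
proof
  fix \<eta>
  have "inv_sd \<gamma> \<odot> \<eta> = sd_one \<longleftrightarrow> \<eta> = \<gamma>"
    using inv_mult_cancel(2)[of \<gamma> \<eta>] group(3)[of \<gamma>] group(4)[of \<gamma>] by metis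
  then show "translate \<gamma> (delta sd_one) \<eta> = delta \<gamma> \<eta>"
    by (simp add: translate_def delta_def)
qed

end

section \<open>The sampling operator as a matrix multiplier\<close>

context dual_haar
begin

definition hatv :: "('n \<times> 'h::finite \<Rightarrow> complex) \<Rightarrow> ('n \<Rightarrow> complex) \<Rightarrow> complex^'h" where
  "hatv a \<xi> = (\<chi> h. fourier \<mu> (\<lambda>n. a (n, h)) \<xi>)"

lemma hatv_L2:
  fixes a :: "'n \<times> 'h::finite \<Rightarrow> complex"
  assumes "a \<in> ell2"
  shows "(\<lambda>\<xi>. hatv a \<xi> $ h) \<in> L2_space \<mu>" "fcoef (\<lambda>\<xi>. hatv a \<xi> $ h) n = a (n, h)"
  using fourier_L2[OF ell2_slice[OF assms, of h]] by (auto simp: hatv_def)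

lemma parseval_hatv:
  fixes a :: "'n \<times> 'h::finite \<Rightarrow> complex"
  assumes "a \<in> ell2"
  shows "(\<Sum>\<^sub>\<infinity>p. (cmod (a p))\<^sup>2) = (\<Sum>h\<in>UNIV. \<integral>\<xi>. (cmod (hatv a \<xi> $ h))\<^sup>2 \<partial>\<mu>)"
  by (simp add: infsum_slices[OF assms] parseval_norm[OF hatv_L2(1)[OF assms]] hatv_L2(2)[OF assms])

lemma hatv_inject:
  fixes a b :: "'n \<times> 'h::finite \<Rightarrow> complex"
  assumes a: "a \<in> ell2" and b: "b \<in> ell2" and eq: "AE \<xi> in \<mu>. hatv a \<xi> = hatv b \<xi>"
  shows "a = b"
proof
  fix p :: "'n \<times> 'h"
  obtain n h where p: "p = (n, h)"
    by (cases p)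
  have "AE \<xi> in \<mu>. hatv a \<xi> $ h = hatv b \<xi> $ h"
    using eq by eventually_elim simp
  from fcoef_cong_AE[OF this hatv_L2(1)[OF a] hatv_L2(1)[OF b], of n] show "a p = b p"
    by (simp add: hatv_L2(2) a b p)
qed

text \<open>It serves to identify the transform of a given sequence, as in \<open>C_fourier\<close>
  and \<open>hatv_delta\<close>, and to construct a sequence with a given transform, as in
  \<open>hatv_onto\<close>.\<close>

lemma AE_hatv_eq:
  fixes V :: "('n \<Rightarrow> complex) \<Rightarrow> complex^'h"
  assumes V: "\<And>h. (\<lambda>\<xi>. V \<xi> $ h) \<in> L2_space \<mu>" and a: "\<And>n h. a (n, h) = fcoef (\<lambda>\<xi>. V \<xi> $ h) n"
  shows "a \<in> ell2" "AE \<xi> in \<mu>. hatv a \<xi> = V \<xi>"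
proof -
  show "a \<in> ell2"
    by (rule ell2_slices) (simp add: a fcoef_ell2[OF V])
  have "AE \<xi> in \<mu>. hatv a \<xi> $ h = V \<xi> $ h" for h
    using AE_fourier_fcoef[OF V[of h]] by (simp add: hatv_def a)
  then have "AE \<xi> in \<mu>. \<forall>h. hatv a \<xi> $ h = V \<xi> $ h"
    by (rule eventually_all_finite)
  then show "AE \<xi> in \<mu>. hatv a \<xi> = V \<xi>"
    by eventually_elim (simp add: vec_eq_iff)
qed

lemma hatv_onto:
  fixes V :: "('n \<Rightarrow> complex) \<Rightarrow> complex^'h"
  assumes V: "\<And>h. (\<lambda>\<xi>. V \<xi> $ h) \<in> L2_space \<mu>"
  obtains a where "a \<in> ell2" "AE \<xi> in \<mu>. hatv a \<xi> = V \<xi>"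
  using AE_hatv_eq[OF V, of "\<lambda>(n, h). fcoef (\<lambda>\<xi>. V \<xi> $ h) n"] that by simp

text \<open>Parseval turns a pointwise bound into one in \<open>ell2\<close>. One factor
  \<open>CARD('h)\<close> comes from Cauchy-Schwarz for the sum over \<open>h\<close>, the other
  from summing over \<open>l\<close>. The lemma gives upper and lower bounds for
  \<open>C\<close>.\<close>

lemma infsum_le_if_hatv_le:
  fixes a b :: "'n \<times> 'h::finite \<Rightarrow> complex"
  assumes a: "a \<in> ell2" and b: "b \<in> ell2"
    and le: "AE \<xi> in \<mu>. \<forall>l. cmod (hatv b \<xi> $ l) \<le> K * (\<Sum>h\<in>UNIV. cmod (hatv a \<xi> $ h))"
  shows "(\<Sum>\<^sub>\<infinity>p. (cmod (b p))\<^sup>2) \<le> (K * CARD('h))\<^sup>2 * (\<Sum>\<^sub>\<infinity>p. (cmod (a p))\<^sup>2)"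
proof -
  define k where "k = K\<^sup>2 * CARD('h)"
  have "(\<integral>\<xi>. (cmod (hatv b \<xi> $ l))\<^sup>2 \<partial>\<mu>) \<le> (\<integral>\<xi>. k * (\<Sum>h\<in>UNIV. (cmod (hatv a \<xi> $ h))\<^sup>2) \<partial>\<mu>)" for l
  proof (rule integral_mono_AE)
    show "integrable \<mu> (\<lambda>\<xi>. (cmod (hatv b \<xi> $ l))\<^sup>2)"
      by (intro L2_spaceD(2) hatv_L2(1) b)
    show "integrable \<mu> (\<lambda>\<xi>. k * (\<Sum>h\<in>UNIV. (cmod (hatv a \<xi> $ h))\<^sup>2))"
      by (intro integrable_mult_right Bochner_Integration.integrable_sum L2_spaceD(2) hatv_L2(1) a)
    show "AE \<xi> in \<mu>. (cmod (hatv b \<xi> $ l))\<^sup>2 \<le> k * (\<Sum>h\<in>UNIV. (cmod (hatv a \<xi> $ h))\<^sup>2)"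
      using le
    proof eventually_elim
      case (elim \<xi>)
      let ?v = "\<lambda>h. cmod (hatv a \<xi> $ h)"
      have "(cmod (hatv b \<xi> $ l))\<^sup>2 \<le> (K * (\<Sum>h\<in>UNIV. ?v h))\<^sup>2"
        using elim by (intro power_mono) auto
      also have "\<dots> = K\<^sup>2 * (\<Sum>h\<in>UNIV. ?v h)\<^sup>2"
        by (simp add: power_mult_distrib)
      also have "\<dots> \<le> K\<^sup>2 * ((\<Sum>h\<in>UNIV. (?v h)\<^sup>2) * CARD('h))"
        by (intro mult_left_mono sum_squared_le_sum_of_squares) auto
      finally show ?case
        by (simp add: k_def mult_ac)
    qed
  qed
  also have "(\<integral>\<xi>. k * (\<Sum>h\<in>UNIV. (cmod (hatv a \<xi> $ h))\<^sup>2) \<partial>\<mu>) = k * (\<Sum>\<^sub>\<infinity>p. (cmod (a p))\<^sup>2)"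
    unfolding parseval_hatv[OF a] integral_mult_right_zero
    by (intro arg_cong[where f = "\<lambda>s. k * s"] Bochner_Integration.integral_sum L2_spaceD(2) hatv_L2(1) a)
  finally have "(\<Sum>l\<in>UNIV. \<integral>\<xi>. (cmod (hatv b \<xi> $ l))\<^sup>2 \<partial>\<mu>) \<le> (\<Sum>l\<in>(UNIV :: 'h set). k * (\<Sum>\<^sub>\<infinity>p. (cmod (a p))\<^sup>2))"
    by (intro sum_mono)
  then show ?thesis
    by (simp add: parseval_hatv[OF b] k_def power_mult_distrib power2_eq_square[of "real _"] mult_ac)
qed

end

locale sampling_setup =
  dual_haar \<mu> + semidirect_representation \<sigma> U + riesz_system "\<lambda>\<gamma>. U \<gamma> \<phi>" B A
  for \<mu> :: "('n::ab_group_add \<Rightarrow> complex) measure"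
    and \<sigma> :: "'h::{group_add, finite} \<Rightarrow> 'n \<Rightarrow> 'n"
    and U :: "'n \<times> 'h \<Rightarrow> 'a::complex_hilbert \<Rightarrow> 'a"
    and \<phi> :: 'a and A B :: real +
  fixes \<psi> :: 'a
  assumes bounded: "bounded_entries \<mu> (transfer_matrix \<sigma> \<mu> (sampling_sequence \<sigma> U \<phi> \<psi>))"
begin

definition f :: "'n \<times> 'h \<Rightarrow> complex" where
  "f = sampling_sequence \<sigma> U \<phi> \<psi>"

abbreviation F :: "('n \<Rightarrow> complex) \<Rightarrow> ((complex, 'h) vec, 'h) vec" where
  "F \<equiv> transfer_matrix \<sigma> \<mu> f"

definition C :: "('n \<times> 'h \<Rightarrow> complex) \<Rightarrow> 'n \<times> 'h \<Rightarrow> complex" where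
  "C a = samples U \<psi> (synth a)"

lemma transfer_matrix_hatv: "transfer_matrix \<sigma> \<mu> a \<xi> $ h $ l = hatv (translate (0, l) a) \<xi> $ h"
  by (simp add: transfer_matrix_nth hatv_def)

lemma f_eq: "f \<gamma> = cnj (cinner (U \<gamma> \<phi>) \<psi>)"
  using cinner_U[of \<gamma> \<phi> sd_one \<psi>] by (simp add: f_def sampling_sequence_def U_one group(3))

lemma f_ell2: "f \<in> ell2"
proof -
  have "f = (\<lambda>\<gamma>. cinner \<psi> (U \<gamma> \<phi>))"
    by (rule ext) (simp add: f_eq cinner_commute[of \<psi>])
  then show ?thesis
    using analysis_ell2[of \<psi>] by simp
qed

lemma U_synth:
  assumes a: "a \<in> ell2"
  shows "U \<gamma> (synth a) = synth (translate \<gamma> a)"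
proof -
  have "((\<lambda>\<eta>. a \<eta> *\<^sub>C U (\<gamma> \<odot> \<eta>) \<phi>) has_sum U \<gamma> (synth a)) UNIV"
    using has_sum_bounded_linear[OF U_linear has_sum_synth[OF a], of \<gamma>] by (simp add: U_scaleC U_mult)
  then have "((\<lambda>\<eta>. translate \<gamma> a (\<gamma> \<odot> \<eta>) *\<^sub>C U (\<gamma> \<odot> \<eta>) \<phi>) has_sum U \<gamma> (synth a)) UNIV"
    by (simp add: translate_def inv_mult_cancel)
  then have "((\<lambda>\<eta>. translate \<gamma> a \<eta> *\<^sub>C U \<eta> \<phi>) has_sum U \<gamma> (synth a)) UNIV"
    by (subst (asm) has_sum_reindex_bij_betw[OF bij_mult])
  then show ?thesis
    unfolding synth_def[of "translate \<gamma> a"] by (simp add: infsumI)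
qed

lemma C_translate:
  assumes "a \<in> ell2"
  shows "C (translate \<gamma> a) = translate \<gamma> (C a)"
  by (rule ext) (simp add: C_def samples_def translate_def cinner_U flip: U_synth[OF assms])

lemma C_has_sum:
  assumes a: "a \<in> ell2"
  shows "((\<lambda>\<eta>. a \<eta> * cnj (translate \<gamma> f \<eta>)) has_sum C a \<gamma>) UNIV"
  using cinner_synth[OF a, of "U \<gamma> \<psi>"]
  by (simp add: C_def samples_def translate_def f_eq cinner_U_left)

lemma C_diff:
  assumes "a \<in> ell2" "b \<in> ell2"
  shows "C (\<lambda>i. a i - b i) = (\<lambda>i. C a i - C b i)"
proof -
  have "cinner (x - y) z = cinner x z - cinner y z" for x y z :: 'a
    using bounded_linear.linear[OF bounded_linear_cinner, of z] by (rule linear_diff)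
  then show ?thesis
    by (simp add: C_def samples_def[abs_def] synth_diff assms)
qed

lemma F_measurable [measurable]: "(\<lambda>\<xi>. F \<xi> $ h $ l) \<in> borel_measurable \<mu>"
  using bounded by (simp add: bounded_entries_def Linf_space_iff f_def)

definition M :: real where
  "M = (SOME M. 1 \<le> M \<and> (AE \<xi> in \<mu>. \<forall>h l. cmod (F \<xi> $ h $ l) \<le> M))"

lemma M: "1 \<le> M" "AE \<xi> in \<mu>. \<forall>h l. cmod (F \<xi> $ h $ l) \<le> M"
proof -
  obtain b where "1 \<le> b" "AE \<xi> in \<mu>. \<forall>h l. cmod (F \<xi> $ h $ l) \<le> b"
    using bounded_entriesD[OF bounded] unfolding f_def by blast
  then have "\<exists>M. 1 \<le> M \<and> (AE \<xi> in \<mu>. \<forall>h l. cmod (F \<xi> $ h $ l) \<le> M)"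
    by blast
  from someI_ex[OF this] show "1 \<le> M" "AE \<xi> in \<mu>. \<forall>h l. cmod (F \<xi> $ h $ l) \<le> M"
    unfolding M_def by blast+
qed

lemma conj_transpose_F_measurable [measurable]:
  "(\<lambda>\<xi>. conj_transpose (F \<xi>) $ l $ h) \<in> borel_measurable \<mu>"
proof -
  have "AE \<xi> in \<mu>. cmod (F \<xi> $ h $ l) \<le> M"
    using M(2) by eventually_elim simp
  then have "(\<lambda>\<xi>. cnj (F \<xi> $ h $ l)) \<in> borel_measurable \<mu>"
    by (intro L2_spaceD(1) L2_space_cnj L2_space_bounded[OF F_measurable])
  then show ?thesis
    by (simp add: conj_transpose_def)
qed

lemma L2_space_F_mult:
  assumes "V \<in> L2_space \<mu>"
  shows "(\<lambda>\<xi>. cnj (F \<xi> $ h $ l) * V \<xi>) \<in> L2_space \<mu>"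
proof (rule L2_space_bounded_mult[OF _ _ assms])
  show "AE \<xi> in \<mu>. cmod (cnj (F \<xi> $ h $ l)) \<le> M"
    using M(2) by eventually_elim simp
  show "(\<lambda>\<xi>. cnj (F \<xi> $ h $ l)) \<in> borel_measurable \<mu>"
    using conj_transpose_F_measurable[of l h] by (simp add: conj_transpose_def)
qed

lemma L2_space_F_mult_vec:
  assumes "\<And>h. (\<lambda>\<xi>. V \<xi> $ h) \<in> L2_space \<mu>"
  shows "(\<lambda>\<xi>. (conj_transpose (F \<xi>) *v V \<xi>) $ l) \<in> L2_space \<mu>"
  unfolding conj_transpose_mult_nth by (intro L2_space_sum L2_space_F_mult assms)

text \<open>\<open>C a (m, l)\<close> pairs \<open>a\<close> with the translate of \<open>f\<close>
  by \<open>(m, l)\<close>. Slice by slice, Parseval replaces \<open>a\<close> by its transform and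
  the translate by column \<open>l\<close> of \<open>F\<close> times \<open>\<xi> (- m)\<close>; the
  conjugate of this factor is \<open>\<xi> m\<close>, so the integral is a coefficient at
  \<open>m\<close>.\<close>

lemma C_fcoef:
  assumes a: "a \<in> ell2"
  shows "C a (m, l) = fcoef (\<lambda>\<xi>. (conj_transpose (F \<xi>) *v hatv a \<xi>) $ l) m"
proof -
  let ?P = "\<lambda>h \<xi>. hatv a \<xi> $ h" and ?Q = "\<lambda>h \<xi>. \<xi> (- m) * F \<xi> $ h $ l"
  have tf: "translate (0, l) f \<in> ell2"
    by (intro translate_ell2 f_ell2)
  have F_L2: "(\<lambda>\<xi>. F \<xi> $ h $ l) \<in> L2_space \<mu>" and F_coef: "fcoef (\<lambda>\<xi>. F \<xi> $ h $ l) n = translate (0, l) f (n, h)" for h n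
    using hatv_L2[OF tf, of h] by (simp_all add: transfer_matrix_hatv)
  have Q: "?Q h \<in> L2_space \<mu>" for h
    by (rule L2_space_bounded_mult[OF eval_measurable eval_bounded F_L2])
  have "((\<lambda>n. a (n, h) * cnj (translate (m, l) f (n, h))) has_sum (\<integral>\<xi>. ?P h \<xi> * cnj (?Q h \<xi>) \<partial>\<mu>)) UNIV" for h
    using parseval[OF hatv_L2(1)[OF a] Q, of h]
    unfolding hatv_L2(2)[OF a] fcoef_shift F_coef translate_shift[of m] .
  then have "((\<lambda>\<eta>. a \<eta> * cnj (translate (m, l) f \<eta>)) has_sum (\<Sum>h\<in>UNIV. \<integral>\<xi>. ?P h \<xi> * cnj (?Q h \<xi>) \<partial>\<mu>)) UNIV"
    by (rule has_sum_slices)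
  then have "C a (m, l) = (\<Sum>h\<in>UNIV. \<integral>\<xi>. ?P h \<xi> * cnj (?Q h \<xi>) \<partial>\<mu>)"
    using C_has_sum[OF a] has_sum_unique by blast
  also have "\<dots> = (\<Sum>h\<in>UNIV. fcoef (\<lambda>\<xi>. cnj (F \<xi> $ h $ l) * hatv a \<xi> $ h) m)"
    unfolding fcoef_def
  proof (intro sum.cong refl Bochner_Integration.integral_cong)
    fix h \<xi>
    assume "\<xi> \<in> space \<mu>"
    then show "?P h \<xi> * cnj (?Q h \<xi>) = cnj (F \<xi> $ h $ l) * hatv a \<xi> $ h * \<xi> m"
      by (simp add: eval_simps(4))
  qed
  also have "\<dots> = fcoef (\<lambda>\<xi>. \<Sum>h\<in>UNIV. cnj (F \<xi> $ h $ l) * hatv a \<xi> $ h) m"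
    by (intro fcoef_sum[symmetric] L2_space_F_mult hatv_L2(1)[OF a])
  finally show ?thesis
    by (simp only: conj_transpose_mult_nth)
qed

lemma C_fourier:
  assumes a: "a \<in> ell2"
  shows "C a \<in> ell2" "AE \<xi> in \<mu>. hatv (C a) \<xi> = conj_transpose (F \<xi>) *v hatv a \<xi>"
  using AE_hatv_eq[OF L2_space_F_mult_vec[OF hatv_L2(1)[OF a]] C_fcoef[OF a]] by blast+

lemma C_bounded:
  obtains K where "K > 0" "\<And>a. a \<in> ell2 \<Longrightarrow> (\<Sum>\<^sub>\<infinity>p. (cmod (C a p))\<^sup>2) \<le> K * (\<Sum>\<^sub>\<infinity>p. (cmod (a p))\<^sup>2)"
proof
  show "0 < (M * CARD('h))\<^sup>2"
    using M(1) by simp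
  fix a :: "'n \<times> 'h \<Rightarrow> complex"
  assume a: "a \<in> ell2"
  show "(\<Sum>\<^sub>\<infinity>p. (cmod (C a p))\<^sup>2) \<le> (M * CARD('h))\<^sup>2 * (\<Sum>\<^sub>\<infinity>p. (cmod (a p))\<^sup>2)"
  proof (rule infsum_le_if_hatv_le[OF a C_fourier(1)[OF a]])
    show "AE \<xi> in \<mu>. \<forall>l. cmod (hatv (C a) \<xi> $ l) \<le> M * (\<Sum>h\<in>UNIV. cmod (hatv a \<xi> $ h))"
      using C_fourier(2)[OF a] M(2)
    proof eventually_elim
      case (elim \<xi>)
      have "cmod (hatv (C a) \<xi> $ l) \<le> (\<Sum>h\<in>UNIV. M * cmod (hatv a \<xi> $ h))" for l
        unfolding elim(1) conj_transpose_mult_nth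
        by (rule sum_norm_le) (use elim(2) in \<open>auto simp: norm_mult intro!: mult_right_mono\<close>)
      then show ?case
        by (simp add: sum_distrib_left)
    qed
  qed
qed

lemma hatv_delta: "AE \<xi> in \<mu>. hatv (delta (0, l)) \<xi> = axis l 1"
proof (rule AE_hatv_eq(2))
  show "(\<lambda>\<xi>. axis l 1 $ h) \<in> L2_space \<mu>" for h
    by (rule L2_space_bounded[where B = "cmod (axis l 1 $ h)"]) auto
  show "delta (0, l) (n, h) = fcoef (\<lambda>\<xi>. axis l 1 $ h) n" for n h
    by (simp add: delta_def fcoef_def axis_def integral_eval)
qed

lemma AE_column:
  assumes "g \<in> ell2" "C g = delta sd_one"
  shows "AE \<xi> in \<mu>. conj_transpose (F \<xi>) *v hatv (translate (0, l) g) \<xi> = axis l 1"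
proof -
  have "C (translate (0, l) g) = delta (0, l)"
    by (simp only: C_translate assms translate_delta)
  then show ?thesis
    using C_fourier(2)[OF translate_ell2[OF assms(1)], of "(0, l)"] hatv_delta[of l] by auto
qed

lemma AE_inverse_if_C_eq_delta:
  assumes g: "g \<in> ell2" and C: "C g = delta sd_one"
  shows "AE \<xi> in \<mu>. conj_transpose (F \<xi>) ** transfer_matrix \<sigma> \<mu> g \<xi> = mat 1"
proof -
  have "AE \<xi> in \<mu>. conj_transpose (F \<xi>) *v hatv (translate (0, l) g) \<xi> = axis l 1" for l
    by (rule AE_column[OF g C])
  then have "AE \<xi> in \<mu>. \<forall>l. conj_transpose (F \<xi>) *v hatv (translate (0, l) g) \<xi> = axis l 1"
    by (rule eventually_all_finite)
  then show ?thesis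
  proof eventually_elim
    case (elim \<xi>)
    show ?case
    proof (clarsimp simp: vec_eq_iff)
      fix k l
      have "(conj_transpose (F \<xi>) ** transfer_matrix \<sigma> \<mu> g \<xi>) $ k $ l = (conj_transpose (F \<xi>) *v hatv (translate (0, l) g) \<xi>) $ k"
        by (simp add: matrix_matrix_mult_def matrix_vector_mult_def transfer_matrix_hatv)
      also have "\<dots> = axis l 1 $ k"
        by (simp add: elim)
      finally show "(conj_transpose (F \<xi>) ** transfer_matrix \<sigma> \<mu> g \<xi>) $ k $ l = mat 1 $ k $ l"
        by (simp add: axis_def mat_def)
    qed
  qed
qed

text \<open>After the factors are interchanged, the column with index 0 is enough: it is the
  transform of \<open>C g\<close>, as translation by the unit does nothing.\<close>

lemma C_eq_delta_if_AE_inverse: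
  assumes g: "g \<in> ell2" and inv: "AE \<xi> in \<mu>. transfer_matrix \<sigma> \<mu> g \<xi> ** conj_transpose (F \<xi>) = mat 1"
  shows "C g = delta sd_one"
proof (rule hatv_inject[OF C_fourier(1)[OF g] delta_ell2])
  have zero: "hatv g \<xi> = transfer_matrix \<sigma> \<mu> g \<xi> *v axis 0 1" for \<xi>
    by (simp add: vec_eq_iff matrix_vector_mult_def transfer_matrix_hatv translate_one axis_def if_distrib
        cong: if_cong)
  show "AE \<xi> in \<mu>. hatv (C g) \<xi> = hatv (delta sd_one) \<xi>"
    using C_fourier(2)[OF g] hatv_delta[of 0] inv
  proof eventually_elim
    case (elim \<xi>)
    have "hatv (C g) \<xi> = (conj_transpose (F \<xi>) ** transfer_matrix \<sigma> \<mu> g \<xi>) *v axis 0 1"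
      by (simp add: elim(1) zero matrix_vector_mul_assoc)
    also have "conj_transpose (F \<xi>) ** transfer_matrix \<sigma> \<mu> g \<xi> = mat 1"
      using elim(3) by (simp add: matrix_left_right_inverse)
    finally show ?case
      using elim(2) by (simp add: sd_one_def)
  qed
qed

section \<open>Invertibility of the transfer matrix\<close>

lemma det_lower_bound:
  assumes "\<delta> > 0" and det: "AE \<xi> in \<mu>. \<delta> \<le> cmod (det (F \<xi>))"
  obtains K where "K \<ge> 0" "AE \<xi> in \<mu>. det (conj_transpose (F \<xi>)) \<noteq> 0 \<and>
    (\<forall>v k. cmod (v $ k) \<le> K * (\<Sum>l\<in>UNIV. cmod ((conj_transpose (F \<xi>) *v v) $ l)))"
proof -
  obtain K where K: "K \<ge> 0" "\<And>(A :: ((complex, 'h) vec, 'h) vec) x k. (\<And>i j. cmod (A $ i $ j) \<le> M) \<Longrightarrow> \<delta> \<le> cmod (det A) \<Longrightarrow>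
    cmod (x $ k) \<le> K * (\<Sum>l\<in>UNIV. cmod ((A *v x) $ l))"
    using matrix_lower_bound[OF M(1) assms(1), where 'h = 'h] by metis
  have "AE \<xi> in \<mu>. det (conj_transpose (F \<xi>)) \<noteq> 0 \<and>
    (\<forall>v k. cmod (v $ k) \<le> K * (\<Sum>l\<in>UNIV. cmod ((conj_transpose (F \<xi>) *v v) $ l)))"
    using det M(2)
  proof eventually_elim
    case (elim \<xi>)
    have "cmod (conj_transpose (F \<xi>) $ i $ j) \<le> M" for i j
      using elim(2) by (simp add: conj_transpose_def)
    moreover have "\<delta> \<le> cmod (det (conj_transpose (F \<xi>)))"
      using elim(1) by (simp add: det_conj_transpose)
    ultimately show ?case
      using K(2)[of "conj_transpose (F \<xi>)"] assms(1) by auto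
  qed
  then show ?thesis
    by (rule that[OF K(1)])
qed

text \<open>The link between (a) and (c): it follows from a lower bound on the determinant as well
  as from a sampling generator, and it makes G bounded.\<close>

definition C_lower :: "real \<Rightarrow> bool" where
  "C_lower k \<longleftrightarrow> k > 0 \<and> (\<forall>a\<in>ell2. (\<Sum>\<^sub>\<infinity>p. (cmod (a p))\<^sup>2) \<le> k * (\<Sum>\<^sub>\<infinity>p. (cmod (C a p))\<^sup>2))"

lemma C_inject:
  assumes k: "C_lower k" and a: "a \<in> ell2" and b: "b \<in> ell2" and eq: "C a = C b"
  shows "a = b"
proof
  fix p
  have "\<forall>a\<in>ell2. (\<Sum>\<^sub>\<infinity>p. (cmod (a p))\<^sup>2) \<le> k * (\<Sum>\<^sub>\<infinity>p. (cmod (C a p))\<^sup>2)"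
    using k by (simp add: C_lower_def)
  from bspec[OF this ell2_diff[OF a b]] have "(\<Sum>\<^sub>\<infinity>p. (cmod (a p - b p))\<^sup>2) \<le> 0"
    by (simp add: C_diff[OF a b] eq)
  then show "a p = b p"
    using ell2_eq_0[OF ell2_diff[OF a b], of p] by simp
qed

lemma C_lower_if_det:
  assumes "\<delta> > 0" "AE \<xi> in \<mu>. \<delta> \<le> cmod (det (F \<xi>))"
  obtains k where "C_lower k"
proof -
  obtain K where K: "K \<ge> 0" "AE \<xi> in \<mu>. det (conj_transpose (F \<xi>)) \<noteq> 0 \<and>
    (\<forall>v k. cmod (v $ k) \<le> K * (\<Sum>l\<in>UNIV. cmod ((conj_transpose (F \<xi>) *v v) $ l)))"
    by (rule det_lower_bound[OF assms])
  \<comment> \<open>The added 1 makes the constant positive even if \<open>K\<close> is 0.\<close>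
  have "(\<Sum>\<^sub>\<infinity>p. (cmod (a p))\<^sup>2) \<le> ((K * CARD('h))\<^sup>2 + 1) * (\<Sum>\<^sub>\<infinity>p. (cmod (C a p))\<^sup>2)" if a: "a \<in> ell2" for a
  proof -
    have "(\<Sum>\<^sub>\<infinity>p. (cmod (a p))\<^sup>2) \<le> (K * CARD('h))\<^sup>2 * (\<Sum>\<^sub>\<infinity>p. (cmod (C a p))\<^sup>2)"
    proof (rule infsum_le_if_hatv_le[OF C_fourier(1)[OF a] a])
      show "AE \<xi> in \<mu>. \<forall>l. cmod (hatv a \<xi> $ l) \<le> K * (\<Sum>h\<in>UNIV. cmod (hatv (C a) \<xi> $ h))"
        using C_fourier(2)[OF a] K(2) by eventually_elim simp
    qed
    also have "\<dots> \<le> ((K * CARD('h))\<^sup>2 + 1) * (\<Sum>\<^sub>\<infinity>p. (cmod (C a p))\<^sup>2)"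
      by (intro mult_right_mono infsum_nonneg) auto
    finally show ?thesis .
  qed
  then show ?thesis
    using that[of "(K * CARD('h))\<^sup>2 + 1"] by (simp add: C_lower_def add_nonneg_pos)
qed

text \<open>Only the column for the unit of \<open>H\<close> has to be solved for; it determines
  \<open>g\<close>, and translation takes care of the others. The solution is bounded, hence square
  integrable for a probability measure.\<close>

lemma C_eq_delta_solvable:
  assumes "\<delta> > 0" "AE \<xi> in \<mu>. \<delta> \<le> cmod (det (F \<xi>))"
  obtains g where "g \<in> ell2" "C g = delta sd_one"
proof -
  obtain K where K: "K \<ge> 0" "AE \<xi> in \<mu>. det (conj_transpose (F \<xi>)) \<noteq> 0 \<and>
    (\<forall>v k. cmod (v $ k) \<le> K * (\<Sum>l\<in>UNIV. cmod ((conj_transpose (F \<xi>) *v v) $ l)))"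
    by (rule det_lower_bound[OF assms])
  define e :: "(complex, 'h) vec" where "e = axis 0 1"
  \<comment> \<open>Cramer's formula, rather than a pointwise choice of solutions, makes
    \<open>w\<close> measurable.\<close>
  define w where "w \<xi> = (\<chi> k. det (\<chi> i j. if j = k then e $ i else conj_transpose (F \<xi>) $ i $ j) /
    det (conj_transpose (F \<xi>)))" for \<xi>
  have solves: "AE \<xi> in \<mu>. conj_transpose (F \<xi>) *v w \<xi> = e"
    using K(2) by eventually_elim (simp add: cramer w_def)
  have w_L2: "(\<lambda>\<xi>. w \<xi> $ k) \<in> L2_space \<mu>" for k
  proof (rule L2_space_bounded)
    have "(\<lambda>\<xi>. det (\<chi> i j. if j = k then e $ i else conj_transpose (F \<xi>) $ i $ j)) \<in> borel_measurable \<mu>"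
      by (rule measurable_det) simp
    moreover have "(\<lambda>\<xi>. det (conj_transpose (F \<xi>))) \<in> borel_measurable \<mu>"
      by (rule measurable_det) simp
    ultimately show "(\<lambda>\<xi>. w \<xi> $ k) \<in> borel_measurable \<mu>"
      by (simp add: w_def)
    show "AE \<xi> in \<mu>. cmod (w \<xi> $ k) \<le> K * (\<Sum>l\<in>UNIV. cmod (e $ l))"
      using solves K(2)
    proof eventually_elim
      case (elim \<xi>)
      from elim(2) have "cmod (w \<xi> $ k) \<le> K * (\<Sum>l\<in>UNIV. cmod ((conj_transpose (F \<xi>) *v w \<xi>) $ l))"
        by blast
      then show ?case
        by (simp only: elim(1))
    qed
  qed
  obtain g where g: "g \<in> ell2" "AE \<xi> in \<mu>. hatv g \<xi> = w \<xi>"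
    by (rule hatv_onto[OF w_L2])
  have "C g = delta sd_one"
  proof (rule hatv_inject[OF C_fourier(1)[OF g(1)] delta_ell2])
    show "AE \<xi> in \<mu>. hatv (C g) \<xi> = hatv (delta sd_one) \<xi>"
      using C_fourier(2)[OF g(1)] g(2) solves hatv_delta[of 0]
      by eventually_elim (simp add: e_def sd_one_def)
  qed
  with g(1) show ?thesis
    by (rule that)
qed

lemma transfer_matrix_measurable:
  "g \<in> ell2 \<Longrightarrow> (\<lambda>\<xi>. transfer_matrix \<sigma> \<mu> g \<xi> $ h $ l) \<in> borel_measurable \<mu>"
  unfolding transfer_matrix_hatv by (intro L2_spaceD(1) hatv_L2(1) translate_ell2)

lemma bounded_entriesI:
  assumes g: "g \<in> ell2" and b: "\<And>l. AE \<xi> in \<mu>. \<forall>h. cmod (hatv (translate (0, l) g) \<xi> $ h) \<le> b"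
  shows "bounded_entries \<mu> (transfer_matrix \<sigma> \<mu> g)"
  unfolding bounded_entries_def Linf_space_iff
proof (intro allI conjI transfer_matrix_measurable g)
  fix h l
  have "AE \<xi> in \<mu>. cmod (transfer_matrix \<sigma> \<mu> g \<xi> $ h $ l) \<le> b"
    using b[of l] by eventually_elim (simp add: transfer_matrix_hatv)
  then show "\<exists>b. AE \<xi> in \<mu>. cmod (transfer_matrix \<sigma> \<mu> g \<xi> $ h $ l) \<le> b"
    by blast
qed

text \<open>
  Testing the lower bound of \<open>C\<close> on the columns of \<open>G\<close> cut off to the set where they are large
  shows that this set is null.
\<close>

lemma bounded_entries_if_C_lower:
  assumes k: "C_lower k" and g: "g \<in> ell2" and C: "C g = delta sd_one"
  shows "bounded_entries \<mu> (transfer_matrix \<sigma> \<mu> g)"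
proof (rule bounded_entriesI[OF g])
  fix l
  define c where "c = hatv (translate (0, l) g)"
  have c_L2: "(\<lambda>\<xi>. c \<xi> $ h) \<in> L2_space \<mu>" for h
    unfolding c_def by (intro hatv_L2(1) translate_ell2 g)
  note [measurable] = L2_spaceD(1)[OF c_L2]
  define s where "s \<xi> = (\<Sum>h\<in>UNIV. (cmod (c \<xi> $ h))\<^sup>2)" for \<xi>
  have s_int: "integrable \<mu> s"
    unfolding s_def[abs_def] by (intro Bochner_Integration.integrable_sum L2_spaceD(2) c_L2)
  \<comment> \<open>The threshold is the constant of \<open>C_lower\<close>; with it the integral of
    \<open>s \<xi> - k\<close> over \<open>X\<close> will turn out to be at most 0.\<close>
  define X where "X = {\<xi> \<in> space \<mu>. k < s \<xi>}"
  have X[measurable]: "X \<in> sets \<mu>"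
    unfolding X_def s_def by measurable
  define V where "V \<xi> = (\<chi> h. indicator X \<xi> * c \<xi> $ h)" for \<xi>
  have "(\<lambda>\<xi>. V \<xi> $ h) \<in> L2_space \<mu>" for h
    unfolding V_def vec_lambda_beta
    by (rule L2_space_bounded_mult[OF _ _ c_L2, where B = 1]) (auto simp: indicator_def)
  from hatv_onto[of V, OF this] obtain a where a: "a \<in> ell2" "AE \<xi> in \<mu>. hatv a \<xi> = V \<xi>"
    by blast
  have sq: "(cmod (indicator X \<xi> * z))\<^sup>2 = indicator X \<xi> * (cmod z)\<^sup>2" for \<xi> :: "'n \<Rightarrow> complex" and z
    by (simp add: indicator_def)
  \<comment> \<open>The cut-off is a scalar factor at each point and passes through the matrix,
    which maps the full column to the unit vector \<open>axis l 1\<close>.\<close>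
  have Ca: "AE \<xi> in \<mu>. hatv (C a) \<xi> = (\<chi> i. indicator X \<xi> * axis l 1 $ i)"
    using C_fourier(2)[OF a(1)] a(2) AE_column[OF g C, of l]
  proof eventually_elim
    case (elim \<xi>)
    have "(conj_transpose (F \<xi>) *v V \<xi>) $ i = indicator X \<xi> * (conj_transpose (F \<xi>) *v c \<xi>) $ i" for i
      by (simp add: matrix_vector_mult_def V_def sum_distrib_left mult_ac)
    then show ?case
      using elim by (simp add: vec_eq_iff c_def)
  qed
  have X_mult: "integrable \<mu> (\<lambda>\<xi>. indicator X \<xi> * q \<xi>)" if "integrable \<mu> q" for q :: "_ \<Rightarrow> real"
    using integrable_real_mult_indicator[OF X that] by (simp add: mult.commute)
  have "(\<Sum>\<^sub>\<infinity>p. (cmod (a p))\<^sup>2) = (\<integral>\<xi>. indicator X \<xi> * s \<xi> \<partial>\<mu>)"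
  proof -
    have "(\<integral>\<xi>. (cmod (hatv a \<xi> $ h))\<^sup>2 \<partial>\<mu>) = (\<integral>\<xi>. indicator X \<xi> * (cmod (c \<xi> $ h))\<^sup>2 \<partial>\<mu>)" for h
    proof (rule integral_cong_AE)
      show "(\<lambda>\<xi>. (cmod (hatv a \<xi> $ h))\<^sup>2) \<in> borel_measurable \<mu>"
        using L2_spaceD(2)[OF hatv_L2(1)[OF a(1)]] by (rule borel_measurable_integrable)
      show "AE \<xi> in \<mu>. (cmod (hatv a \<xi> $ h))\<^sup>2 = indicator X \<xi> * (cmod (c \<xi> $ h))\<^sup>2"
        using a(2) by eventually_elim (simp only: V_def vec_lambda_beta sq)
    qed measurable
    then have "(\<Sum>\<^sub>\<infinity>p. (cmod (a p))\<^sup>2) = (\<Sum>h\<in>UNIV. \<integral>\<xi>. indicator X \<xi> * (cmod (c \<xi> $ h))\<^sup>2 \<partial>\<mu>)"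
      by (simp add: parseval_hatv[OF a(1)])
    also have "\<dots> = (\<integral>\<xi>. (\<Sum>h\<in>UNIV. indicator X \<xi> * (cmod (c \<xi> $ h))\<^sup>2) \<partial>\<mu>)"
      by (intro Bochner_Integration.integral_sum[symmetric] X_mult L2_spaceD(2)[OF c_L2])
    finally show ?thesis
      by (simp add: s_def sum_distrib_left)
  qed
  moreover have "(\<Sum>\<^sub>\<infinity>p. (cmod (C a p))\<^sup>2) = (\<integral>\<xi>. indicator X \<xi> \<partial>\<mu>)"
  proof -
    have "(\<integral>\<xi>. (cmod (hatv (C a) \<xi> $ i))\<^sup>2 \<partial>\<mu>) = (\<integral>\<xi>. indicator X \<xi> * (cmod (axis l 1 $ i))\<^sup>2 \<partial>\<mu>)" for i
    proof (rule integral_cong_AE)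
      show "(\<lambda>\<xi>. (cmod (hatv (C a) \<xi> $ i))\<^sup>2) \<in> borel_measurable \<mu>"
        using L2_spaceD(2)[OF hatv_L2(1)[OF C_fourier(1)[OF a(1)]]] by (rule borel_measurable_integrable)
      show "AE \<xi> in \<mu>. (cmod (hatv (C a) \<xi> $ i))\<^sup>2 = indicator X \<xi> * (cmod (axis l 1 $ i))\<^sup>2"
        using Ca by eventually_elim (simp only: vec_lambda_beta sq)
    qed measurable
    then have "(\<Sum>\<^sub>\<infinity>p. (cmod (C a p))\<^sup>2) = (\<Sum>i\<in>(UNIV :: 'h set). (\<integral>\<xi>. indicator X \<xi> \<partial>\<mu>) * (cmod (axis l 1 $ i))\<^sup>2)"
      by (simp add: parseval_hatv[OF C_fourier(1)[OF a(1)]])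
    also have "\<dots> = (\<integral>\<xi>. indicator X \<xi> \<partial>\<mu>) * (\<Sum>i\<in>UNIV. if i = l then 1 else 0)"
      unfolding sum_distrib_left by (intro sum.cong) (auto simp: axis_def)
    also have "\<dots> = (\<integral>\<xi>. indicator X \<xi> \<partial>\<mu>)"
      by simp
    finally show ?thesis .
  qed
  moreover have "(\<Sum>\<^sub>\<infinity>p. (cmod (a p))\<^sup>2) \<le> k * (\<Sum>\<^sub>\<infinity>p. (cmod (C a p))\<^sup>2)"
    using k a(1) by (simp add: C_lower_def)
  moreover have Xs_int: "integrable \<mu> (\<lambda>\<xi>. indicator X \<xi> * s \<xi>)" and X_int: "integrable \<mu> (\<lambda>\<xi>. indicator X \<xi> :: real)"
    using X_mult[OF s_int] X by (auto simp: emeasure_eq_measure)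
  \<comment> \<open>The squared norm of \<open>a\<close> is the integral of \<open>s\<close> over
    \<open>X\<close>, and that of \<open>C a\<close> is the measure of \<open>X\<close>. The
    integrand is positive on \<open>X\<close>, so \<open>X\<close> must be null.\<close>
  ultimately have "(\<integral>\<xi>. indicator X \<xi> * s \<xi> - k * indicator X \<xi> \<partial>\<mu>) \<le> 0"
    by simp
  moreover have nonneg: "0 \<le> indicator X \<xi> * s \<xi> - k * indicator X \<xi>" for \<xi>
    by (simp add: X_def indicator_def)
  moreover have "0 \<le> (\<integral>\<xi>. indicator X \<xi> * s \<xi> - k * indicator X \<xi> \<partial>\<mu>)"
    using nonneg by (intro integral_nonneg_AE AE_I2)
  ultimately have "AE \<xi> in \<mu>. indicator X \<xi> * s \<xi> - k * indicator X \<xi> = 0"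
    using Xs_int X_int by (subst integral_nonneg_eq_0_iff_AE[symmetric]) auto
  then show "AE \<xi> in \<mu>. \<forall>h. cmod (hatv (translate (0, l) g) \<xi> $ h) \<le> sqrt k"
    using AE_space
  proof eventually_elim
    case (elim \<xi>)
    then have "s \<xi> \<le> k"
      by (auto simp: X_def indicator_def split: if_splits)
    have "cmod (c \<xi> $ h) \<le> sqrt k" for h
    proof (rule real_le_rsqrt)
      have "(cmod (c \<xi> $ h))\<^sup>2 \<le> s \<xi>"
        unfolding s_def by (intro member_le_sum) auto
      then show "(cmod (c \<xi> $ h))\<^sup>2 \<le> k"
        using \<open>s \<xi> \<le> k\<close> by simp
    qed
    then show ?case
      by (simp add: c_def)
  qed
qed

lemma inverting_sequence_iff:
  "inverting_sequence \<sigma> \<mu> f g \<longleftrightarrow> g \<in> ell2 \<and> bounded_entries \<mu> (transfer_matrix \<sigma> \<mu> g) \<and> C g = delta sd_one"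
proof
  assume "inverting_sequence \<sigma> \<mu> f g"
  then show "g \<in> ell2 \<and> bounded_entries \<mu> (transfer_matrix \<sigma> \<mu> g) \<and> C g = delta sd_one"
    using C_eq_delta_if_AE_inverse[of g] by (simp add: inverting_sequence_def)
next
  assume g: "g \<in> ell2 \<and> bounded_entries \<mu> (transfer_matrix \<sigma> \<mu> g) \<and> C g = delta sd_one"
  then have "AE \<xi> in \<mu>. conj_transpose (F \<xi>) ** transfer_matrix \<sigma> \<mu> g \<xi> = mat 1"
    by (intro AE_inverse_if_C_eq_delta) auto
  then have "AE \<xi> in \<mu>. transfer_matrix \<sigma> \<mu> g \<xi> ** conj_transpose (F \<xi>) = mat 1"
    by eventually_elim (simp add: matrix_left_right_inverse)
  then show "inverting_sequence \<sigma> \<mu> f g"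
    using g by (simp add: inverting_sequence_def)
qed

text \<open>The product of det G and the conjugate of det F is 1, and bounded entries bound det G by
  the Leibniz formula.\<close>

lemma det_if_inverting:
  assumes "inverting_sequence \<sigma> \<mu> f g"
  obtains \<delta> where "\<delta> > 0" "AE \<xi> in \<mu>. \<delta> \<le> cmod (det (F \<xi>))"
proof -
  obtain b where b: "b \<ge> 1" "AE \<xi> in \<mu>. \<forall>h l. cmod (transfer_matrix \<sigma> \<mu> g \<xi> $ h $ l) \<le> b"
    using assms unfolding inverting_sequence_def by (blast elim: bounded_entriesD)
  define D where "D = fact (CARD('h)) * b ^ CARD('h)"
  have D: "D > 0"
    using b(1) by (simp add: D_def)
  have "AE \<xi> in \<mu>. transfer_matrix \<sigma> \<mu> g \<xi> ** conj_transpose (F \<xi>) = mat 1"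
    using assms by (simp add: inverting_sequence_def)
  then have "AE \<xi> in \<mu>. 1 / D \<le> cmod (det (F \<xi>))"
    using b(2)
  proof eventually_elim
    case (elim \<xi>)
    have "det (transfer_matrix \<sigma> \<mu> g \<xi>) * cnj (det (F \<xi>)) = 1"
      using elim(1) det_mul[of "transfer_matrix \<sigma> \<mu> g \<xi>" "conj_transpose (F \<xi>)"] by (simp add: det_conj_transpose)
    then have "1 = cmod (det (transfer_matrix \<sigma> \<mu> g \<xi>)) * cmod (det (F \<xi>))"
      by (metis complex_mod_cnj norm_mult norm_one)
    also have "\<dots> \<le> D * cmod (det (F \<xi>))"
      unfolding D_def using elim(2) by (intro mult_right_mono cmod_det_le) auto
    finally show ?case
      using D by (simp add: field_simps)
  qed
  then show ?thesis
    using that[of "1 / D"] D by simp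
qed

section \<open>Sampling\<close>

lemma generated_space_eq: "generated_space U \<phi> = synth ` ell2"
  using synth_in_closure closure_imp_synth unfolding generated_space_def by blast

text \<open>The vectors \<open>U \<gamma> (synth g)\<close> are biorthogonal to the
  \<open>U \<eta> \<psi>\<close>, so sampling returns the coefficients of a combination of them. As
  \<open>C\<close> is bounded above and below, the Riesz bounds carry over from
  \<open>\<phi>\<close>.\<close>

lemma sampling_generator_synth:
  assumes k: "C_lower k" and g: "g \<in> ell2" and C: "C g = delta sd_one"
  shows "sampling_generator U \<phi> \<psi> (synth g)"
proof -
  define y where "y \<gamma> = U \<gamma> (synth g)" for \<gamma>
  have y: "y \<gamma> = synth (translate \<gamma> g)" for \<gamma>
    by (simp add: y_def U_synth[OF g])
  have y_sample: "cinner (y \<gamma>) (U \<eta> \<psi>) = delta \<gamma> \<eta>" for \<gamma> \<eta>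
  proof -
    have "C (translate \<gamma> g) = delta \<gamma>"
      by (simp only: C_translate[OF g] C translate_delta)
    from fun_cong[OF this, of \<eta>] show ?thesis
      by (simp add: y C_def samples_def)
  qed
  obtain K where K: "K > 0" "\<And>a. a \<in> ell2 \<Longrightarrow> (\<Sum>\<^sub>\<infinity>p. (cmod (C a p))\<^sup>2) \<le> K * (\<Sum>\<^sub>\<infinity>p. (cmod (a p))\<^sup>2)"
    using C_bounded by blast
  have k': "k > 0" "\<And>a. a \<in> ell2 \<Longrightarrow> (\<Sum>\<^sub>\<infinity>p. (cmod (a p))\<^sup>2) \<le> k * (\<Sum>\<^sub>\<infinity>p. (cmod (C a p))\<^sup>2)"
    using k by (auto simp: C_lower_def)
  have combination: "\<exists>b\<in>ell2. (\<Sum>\<gamma>\<in>S. c \<gamma> *\<^sub>C y \<gamma>) = synth b \<and> (\<Sum>\<^sub>\<infinity>p. (cmod (C b p))\<^sup>2) = (\<Sum>\<gamma>\<in>S. (cmod (c \<gamma>))\<^sup>2)"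
    if S: "finite S" for S c
  proof
    let ?b = "\<lambda>p. \<Sum>\<gamma>\<in>S. c \<gamma> * translate \<gamma> g p"
    show "?b \<in> ell2"
      by (intro ell2_sum S ell2_cmult translate_ell2 g)
    have b: "synth ?b = (\<Sum>\<gamma>\<in>S. c \<gamma> *\<^sub>C y \<gamma>)"
      by (subst synth_sum[OF S]) (auto intro!: ell2_cmult translate_ell2 g simp: synth_cmult translate_ell2[OF g] y)
    have "C ?b \<eta> = (if \<eta> \<in> S then c \<eta> else 0)" for \<eta>
      using S by (simp add: C_def samples_def b cinner_sum_left cinner_scaleC_left y_sample delta_def if_distrib cong: if_cong)
    then have "(\<Sum>\<^sub>\<infinity>p. (cmod (C ?b p))\<^sup>2) = (\<Sum>\<gamma>\<in>S. (cmod (c \<gamma>))\<^sup>2)"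
      by (subst infsum_finite_support[OF S]) auto
    with b show "(\<Sum>\<gamma>\<in>S. c \<gamma> *\<^sub>C y \<gamma>) = synth ?b \<and> (\<Sum>\<^sub>\<infinity>p. (cmod (C ?b p))\<^sup>2) = (\<Sum>\<gamma>\<in>S. (cmod (c \<gamma>))\<^sup>2)"
      by simp
  qed
  interpret y: riesz_system y "B * k" "A / K"
  proof
    fix S :: "('n \<times> 'h) set" and c
    assume S: "finite S"
    obtain b where b: "b \<in> ell2" "(\<Sum>\<gamma>\<in>S. c \<gamma> *\<^sub>C y \<gamma>) = synth b"
      "(\<Sum>\<^sub>\<infinity>p. (cmod (C b p))\<^sup>2) = (\<Sum>\<gamma>\<in>S. (cmod (c \<gamma>))\<^sup>2)"
      using combination[OF S, of c] by blast
    have "(norm (synth b))\<^sup>2 \<le> B * (\<Sum>\<^sub>\<infinity>p. (cmod (b p))\<^sup>2)"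
      by (rule norm_synth_le[OF b(1)])
    also have "\<dots> \<le> B * (k * (\<Sum>\<^sub>\<infinity>p. (cmod (C b p))\<^sup>2))"
      by (intro mult_left_mono k' b(1) B_nonneg)
    finally show "(norm (\<Sum>\<gamma>\<in>S. c \<gamma> *\<^sub>C y \<gamma>))\<^sup>2 \<le> B * k * (\<Sum>\<gamma>\<in>S. (cmod (c \<gamma>))\<^sup>2)"
      by (simp add: b mult.assoc)
    have "A / K * (\<Sum>\<^sub>\<infinity>p. (cmod (C b p))\<^sup>2) \<le> A / K * (K * (\<Sum>\<^sub>\<infinity>p. (cmod (b p))\<^sup>2))"
      using A_pos K(1) by (intro mult_left_mono K(2) b(1)) auto
    also have "\<dots> = A * (\<Sum>\<^sub>\<infinity>p. (cmod (b p))\<^sup>2)"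
      using K(1) by simp
    also have "\<dots> \<le> (norm (synth b))\<^sup>2"
      by (rule norm_synth_ge[OF b(1)])
    finally show "A / K * (\<Sum>\<gamma>\<in>S. (cmod (c \<gamma>))\<^sup>2) \<le> (norm (\<Sum>\<gamma>\<in>S. c \<gamma> *\<^sub>C y \<gamma>))\<^sup>2"
      by (simp add: b)
  qed (use A_pos K(1) in simp)
  \<comment> \<open>This inclusion comes first because it gives \<open>y.synth (C a)\<close>
    coefficients with respect to \<open>\<phi>\<close>; the converse inclusion follows from
    \<open>expansion\<close>.\<close>
  have sub: "closure (cspan (range y)) \<subseteq> generated_space U \<phi>"
  proof (rule closure_minimal)
    show "closed (generated_space U \<phi>)"
      by (simp add: generated_space_def)
    show "cspan (range y) \<subseteq> generated_space U \<phi>"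
    proof
      fix z
      assume "z \<in> cspan (range y)"
      then show "z \<in> generated_space U \<phi>"
      proof (induction rule: cvs.span_induct_alt)
        case base
        have "0 = synth (\<lambda>_. 0)"
          by (simp add: synth_def)
        moreover have "(\<lambda>_. 0) \<in> ell2"
          by (rule ell2_finite_support[of "{}"]) auto
        ultimately show ?case
          unfolding generated_space_eq by blast
      next
        case (step c v w)
        then obtain \<gamma> b where *: "v = synth (translate \<gamma> g)" "b \<in> ell2" "w = synth b"
          unfolding generated_space_eq by (auto simp: y)
        have t: "translate \<gamma> g \<in> ell2"
          by (rule translate_ell2[OF g])
        have "c *\<^sub>C v + w = synth (\<lambda>p. c * translate \<gamma> g p + b p)"
          by (simp add: * synth_add[OF ell2_cmult[OF t] *(2)] synth_cmult[OF t])
        then show ?case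
          unfolding generated_space_eq using ell2_add[OF ell2_cmult[OF t] *(2)] by blast
      qed
    qed
  qed
  \<comment> \<open>Both vectors lie in the generated space and have the same samples, so
    injectivity of \<open>C\<close> identifies them.\<close>
  have expansion: "y.synth (C a) = synth a" if a: "a \<in> ell2" for a
  proof -
    have "y.synth (C a) \<in> generated_space U \<phi>"
      using y.synth_in_closure[OF C_fourier(1)[OF a]] sub by blast
    then obtain a' where a': "a' \<in> ell2" "y.synth (C a) = synth a'"
      unfolding generated_space_eq by blast
    have "C a' = C a"
    proof
      fix \<eta>
      have "C a' \<eta> = cinner (y.synth (C a)) (U \<eta> \<psi>)"
        by (simp only: a'(2) C_def[of a'] samples_def)
      then have "((\<lambda>\<gamma>. C a \<gamma> * delta \<gamma> \<eta>) has_sum C a' \<eta>) UNIV"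
        using y.cinner_synth[OF C_fourier(1)[OF a], of "U \<eta> \<psi>"] by (simp only: y_sample)
      moreover have "((\<lambda>\<gamma>. C a \<gamma> * delta \<gamma> \<eta>) has_sum C a \<eta>) UNIV"
        by (rule has_sum_finite_neutralI[of "{\<eta>}"]) (auto simp: delta_def)
      ultimately show "C a' \<eta> = C a \<eta>"
        by (rule has_sum_unique)
    qed
    then have "a' = a"
      by (rule C_inject[OF k a'(1) a])
    then show ?thesis
      by (simp add: a'(2))
  qed
  have "closure (cspan (range y)) = generated_space U \<phi>"
  proof (rule subset_antisym[OF sub], rule subsetI)
    fix z
    assume "z \<in> generated_space U \<phi>"
    then obtain a where "a \<in> ell2" "z = synth a"
      unfolding generated_space_eq by blast
    then show "z \<in> closure (cspan (range y))"
      using y.synth_in_closure[OF C_fourier(1)] expansion by metis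
  qed
  moreover have "\<exists>A B. 0 < A \<and> (\<forall>S c. finite S \<longrightarrow>
      A * (\<Sum>i\<in>S. (cmod (c i))\<^sup>2) \<le> (norm (\<Sum>i\<in>S. c i *\<^sub>C y i))\<^sup>2 \<and>
      (norm (\<Sum>i\<in>S. c i *\<^sub>C y i))\<^sup>2 \<le> B * (\<Sum>i\<in>S. (cmod (c i))\<^sup>2))"
    using y.A_pos y.lower y.upper by blast
  ultimately have "riesz_basis_of y (generated_space U \<phi>)"
    unfolding riesz_basis_of_def by blast
  moreover have "((\<lambda>\<gamma>. samples U \<psi> z \<gamma> *\<^sub>C y \<gamma>) has_sum z) UNIV" if z: "z \<in> generated_space U \<phi>" for z
  proof -
    obtain a where a: "a \<in> ell2" "z = synth a"
      using z unfolding generated_space_eq by blast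
    show ?thesis
      using y.has_sum_synth[OF C_fourier(1)[OF a(1)]]
      unfolding expansion[OF a(1)] a(2) C_def[symmetric] .
  qed
  moreover have "synth g \<in> generated_space U \<phi>"
    using g by (simp add: generated_space_eq)
  ultimately show ?thesis
    by (simp add: sampling_generator_def y_def[abs_def])
qed

text \<open>The sampling formula for \<open>\<Phi>\<close> and the trivial expansion
  \<open>\<Phi> = U sd_one \<Phi>\<close> must agree, because coefficients in a Riesz basis are
  unique. For general \<open>a\<close>, comparing the norm of \<open>synth a\<close> in the two
  Riesz bases bounds \<open>C\<close> below.\<close>

lemma sampling_generatorD:
  assumes \<Phi>: "sampling_generator U \<phi> \<psi> \<Phi>"
  obtains g k where "g \<in> ell2" "\<Phi> = synth g" "C g = delta sd_one" "C_lower k"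
proof -
  have sampling: "((\<lambda>\<gamma>. samples U \<psi> z \<gamma> *\<^sub>C U \<gamma> \<Phi>) has_sum z) UNIV" if "z \<in> generated_space U \<phi>" for z
    using \<Phi> that by (simp add: sampling_generator_def)
  obtain g where g: "g \<in> ell2" "\<Phi> = synth g"
    using \<Phi> unfolding sampling_generator_def generated_space_eq by blast
  have "riesz_basis_of (\<lambda>\<gamma>. U \<gamma> \<Phi>) (generated_space U \<phi>)"
    using \<Phi> by (simp add: sampling_generator_def)
  then obtain A' B' where AB: "0 < A'" "\<forall>S c. finite S \<longrightarrow>
      A' * (\<Sum>i\<in>S. (cmod (c i))\<^sup>2) \<le> (norm (\<Sum>i\<in>S. c i *\<^sub>C U i \<Phi>))\<^sup>2 \<and>
      (norm (\<Sum>i\<in>S. c i *\<^sub>C U i \<Phi>))\<^sup>2 \<le> B' * (\<Sum>i\<in>S. (cmod (c i))\<^sup>2)"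
    unfolding riesz_basis_of_def by blast
  interpret y: riesz_system "\<lambda>\<gamma>. U \<gamma> \<Phi>" B' A'
    by standard (use AB in auto)
  have "C g = delta sd_one"
  proof
    fix \<eta>
    have "\<Phi> \<in> generated_space U \<phi>"
      using g by (simp add: generated_space_eq)
    from sampling[OF this] have "((\<lambda>\<gamma>. C g \<gamma> *\<^sub>C U \<gamma> \<Phi>) has_sum \<Phi>) UNIV"
      by (simp add: C_def g(2))
    moreover have "((\<lambda>\<gamma>. delta sd_one \<gamma> *\<^sub>C U \<gamma> \<Phi>) has_sum \<Phi>) UNIV"
      by (rule has_sum_finite_neutralI[of "{sd_one}"]) (auto simp: delta_def U_one)
    ultimately have "((\<lambda>\<gamma>. C g \<gamma> *\<^sub>C U \<gamma> \<Phi> - delta sd_one \<gamma> *\<^sub>C U \<gamma> \<Phi>) has_sum (\<Phi> - \<Phi>)) UNIV"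
      by (rule has_sum_diff)
    then have "((\<lambda>\<gamma>. (C g \<gamma> - delta sd_one \<gamma>) *\<^sub>C U \<gamma> \<Phi>) has_sum 0) UNIV"
      by (simp add: cvs.scale_left_diff_distrib)
    from y.has_sum_0_imp_0[OF this, of \<eta>] show "C g \<eta> = delta sd_one \<eta>"
      by simp
  qed
  moreover have "C_lower ((B' + 1) / A)"
    unfolding C_lower_def
  proof (intro conjI ballI)
    \<comment> \<open>\<open>y.B_nonneg\<close> gives \<open>0 \<le> B'\<close>; the added 1 makes
      the constant positive.\<close>
    show "0 < (B' + 1) / A"
      using y.B_nonneg A_pos by simp
    fix a :: "'n \<times> 'h \<Rightarrow> complex"
    assume a: "a \<in> ell2"
    have "synth a \<in> generated_space U \<phi>"
      using a by (simp add: generated_space_eq)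
    from sampling[OF this] have "((\<lambda>\<gamma>. C a \<gamma> *\<^sub>C U \<gamma> \<Phi>) has_sum synth a) UNIV"
      by (simp add: C_def)
    then have "y.synth (C a) = synth a"
      using y.has_sum_synth[OF C_fourier(1)[OF a]] has_sum_unique by blast
    then have "A * (\<Sum>\<^sub>\<infinity>p. (cmod (a p))\<^sup>2) \<le> B' * (\<Sum>\<^sub>\<infinity>p. (cmod (C a p))\<^sup>2)"
      using norm_synth_ge[OF a] y.norm_synth_le[OF C_fourier(1)[OF a]] by simp
    also have "\<dots> \<le> (B' + 1) * (\<Sum>\<^sub>\<infinity>p. (cmod (C a p))\<^sup>2)"
      by (intro mult_right_mono infsum_nonneg) auto
    finally show "(\<Sum>\<^sub>\<infinity>p. (cmod (a p))\<^sup>2) \<le> (B' + 1) / A * (\<Sum>\<^sub>\<infinity>p. (cmod (C a p))\<^sup>2)"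
      using A_pos by (simp add: field_simps)
  qed
  ultimately show ?thesis
    using that g by blast
qed

text \<open>One inverting sequence or one sampling generator leads to \<open>C_lower\<close>; from
  there all solutions of \<open>C g = delta sd_one\<close> coincide, and they are exactly the
  sequences sought in (b) and the coefficients of the generators in (c).\<close>

lemma sampling_equivalences:
  defines "a \<equiv> essinf \<mu> (\<lambda>\<xi>. ereal (cmod (det (F \<xi>)))) > 0"
    and "b \<equiv> \<exists>!g. inverting_sequence \<sigma> \<mu> f g"
    and "c \<equiv> \<exists>!\<Phi>. sampling_generator U \<phi> \<psi> \<Phi>"
  shows "(a \<longleftrightarrow> b) \<and> (b \<longleftrightarrow> c) \<and> (b \<longrightarrow> (\<forall>g \<Phi>. inverting_sequence \<sigma> \<mu> f g \<longrightarrow> sampling_generator U \<phi> \<psi> \<Phi> \<longrightarrow>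
    \<Phi> = synthesis U \<phi> g \<and> (\<forall>\<gamma>. samples U \<psi> \<Phi> \<gamma> = (if \<gamma> = sd_one then 1 else 0))))"
proof -
  have "(\<lambda>\<xi>. cmod (det (F \<xi>))) \<in> borel_measurable \<mu>"
    using measurable_det[OF F_measurable] by simp
  from essinf_pos_iff[OF this] have a_iff: "a \<longleftrightarrow> (\<exists>\<delta>>0. AE \<xi> in \<mu>. \<delta> \<le> cmod (det (F \<xi>)))"
    by (simp add: a_def)
  have lower: "\<exists>k. C_lower k" if a
    using that C_lower_if_det unfolding a_iff by blast
  have a_if_inverting: a if "inverting_sequence \<sigma> \<mu> f g" for g
    unfolding a_iff using det_if_inverting[OF that] by blast
  have unique: "g = g'" if "a" "g \<in> ell2" "g' \<in> ell2" "C g = delta sd_one" "C g' = delta sd_one" for g g'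
    using lower[OF that(1)] C_inject that(2-) by metis
  have inverting: "inverting_sequence \<sigma> \<mu> f g" if "C_lower k" "g \<in> ell2" "C g = delta sd_one" for g k
    using bounded_entries_if_C_lower that by (simp add: inverting_sequence_iff)
  have ab: "a \<longleftrightarrow> b"
  proof
    assume a
    then obtain g where "g \<in> ell2" "C g = delta sd_one"
      unfolding a_iff using C_eq_delta_solvable by blast
    then show b
      unfolding b_def using lower[OF \<open>a\<close>] inverting unique[OF \<open>a\<close>] inverting_sequence_iff by blast
  qed (use a_if_inverting in \<open>auto simp: b_def\<close>)
  \<comment> \<open>This gives both the uniqueness in \<open>c\<close> and the final formula for
    \<open>\<Phi>\<close> with its interpolation property.\<close>
  have eq: "\<Phi> = synth g" "C g = delta sd_one"
    if inv: "inverting_sequence \<sigma> \<mu> f g" and gen: "sampling_generator U \<phi> \<psi> \<Phi>" for g \<Phi>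
  proof -
    obtain g' k where g': "g' \<in> ell2" "\<Phi> = synth g'" "C g' = delta sd_one"
      by (rule sampling_generatorD[OF gen])
    have g: "g \<in> ell2" "C g = delta sd_one"
      using inv by (simp_all add: inverting_sequence_iff)
    have "g' = g"
      by (rule unique[OF a_if_inverting[OF inv] g'(1) g(1) g'(3) g(2)])
    then show "\<Phi> = synth g" "C g = delta sd_one"
      using g' by simp_all
  qed
  have "b \<longleftrightarrow> c"
  proof
    assume b
    then obtain g where g: "inverting_sequence \<sigma> \<mu> f g"
      unfolding b_def by blast
    obtain k where "C_lower k"
      using lower[OF a_if_inverting[OF g]] by blast
    then have "sampling_generator U \<phi> \<psi> (synth g)"
      using g by (intro sampling_generator_synth) (auto simp: inverting_sequence_iff)
    then show c
      unfolding c_def using eq(1)[OF g] by blast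
  next
    assume c
    then obtain \<Phi> where "sampling_generator U \<phi> \<psi> \<Phi>"
      unfolding c_def by blast
    then obtain g k where "g \<in> ell2" "C g = delta sd_one" "C_lower k"
      by (rule sampling_generatorD)
    then have "inverting_sequence \<sigma> \<mu> f g"
      by (intro inverting)
    then show b
      using a_if_inverting ab by blast
  qed
  moreover have "\<Phi> = synthesis U \<phi> g \<and> (\<forall>\<gamma>. samples U \<psi> \<Phi> \<gamma> = (if \<gamma> = sd_one then 1 else 0))"
    if "inverting_sequence \<sigma> \<mu> f g" "sampling_generator U \<phi> \<psi> \<Phi>" for g \<Phi>
    using eq[OF that] by (auto simp: synthesis_def synth_def C_def delta_def fun_eq_iff)
  ultimately show ?thesis
    using ab by blast
qed

end

theorem theorem9:
  fixes \<sigma> :: "'h::{group_add, finite} \<Rightarrow> 'n::ab_group_add \<Rightarrow> 'n"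
    and \<mu> :: "('n \<Rightarrow> complex) measure"
    and U :: "'n \<times> 'h \<Rightarrow> 'a::complex_hilbert \<Rightarrow> 'a"
    and \<phi> \<psi> :: 'a
  assumes "automorphism_action \<sigma>"
    and "dual_haar_measure \<mu>"
    and "separable_space (euclidean :: 'a topology)"
    and "unitary_representation \<sigma> U"
    and "riesz_sequence (\<lambda>\<gamma>. U \<gamma> \<phi>)"
    and "bounded_entries \<mu> (transfer_matrix \<sigma> \<mu> (sampling_sequence \<sigma> U \<phi> \<psi>))"
  shows "(essinf \<mu> (\<lambda>\<xi>. ereal (cmod (det
            (transfer_matrix \<sigma> \<mu> (sampling_sequence \<sigma> U \<phi> \<psi>) \<xi>)))) > 0
          \<longleftrightarrow> (\<exists>!g. inverting_sequence \<sigma> \<mu> (sampling_sequence \<sigma> U \<phi> \<psi>) g))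
       \<and> ((\<exists>!g. inverting_sequence \<sigma> \<mu> (sampling_sequence \<sigma> U \<phi> \<psi>) g)
          \<longleftrightarrow> (\<exists>!\<Phi>. sampling_generator U \<phi> \<psi> \<Phi>))
       \<and> ((\<exists>!g. inverting_sequence \<sigma> \<mu> (sampling_sequence \<sigma> U \<phi> \<psi>) g) \<longrightarrow>
          (\<forall>g \<Phi>. inverting_sequence \<sigma> \<mu> (sampling_sequence \<sigma> U \<phi> \<psi>) g \<longrightarrow>
             sampling_generator U \<phi> \<psi> \<Phi> \<longrightarrow>
             \<Phi> = synthesis U \<phi> g \<and>
             (\<forall>\<gamma>. samples U \<psi> \<Phi> \<gamma> = (if \<gamma> = sd_one then 1 else 0))))"
proof -
  obtain A B where AB: "0 < A" "\<forall>S c. finite S \<longrightarrow>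
      A * (\<Sum>i\<in>S. (cmod (c i))\<^sup>2) \<le> (norm (\<Sum>i\<in>S. c i *\<^sub>C U i \<phi>))\<^sup>2 \<and>
      (norm (\<Sum>i\<in>S. c i *\<^sub>C U i \<phi>))\<^sup>2 \<le> B * (\<Sum>i\<in>S. (cmod (c i))\<^sup>2)"
    using assms(5) unfolding riesz_sequence_def riesz_basis_of_def by blast
  interpret sampling_setup \<mu> \<sigma> U \<phi> A B \<psi>
    by standard (use assms(1,2,4,6) AB in auto)
  show ?thesis
    using sampling_equivalences unfolding f_def .
qed

end
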